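(* Let $\Sigma$ be a closed 4-dimensional manifold immersed in $\mathbb{R}^m$ by a smooth immersion $\vec\Phi$. The energy $$\mathcal{E}(\Sigma)=\int_{\Sigma}\left(|\pi_{\vec n}\nabla\vec H|^2-|\vec H\cdot\vec h|^2+7|\vec H|^4\right)d\mathrm{vol}_g$$ is conformally invariant.
   Context: $g_{ij}=\nabla_i\vec\Phi\cdot\nabla_j\vec\Phi$ is the induced metric, $\nabla$ its Levi-Civita connection (acting componentwise on $\mathbb{R}^m$-valued tensors), $d\mathrm{vol}_g$ its volume element. Indices are raised and lowered with $g$, and repeated indices are summed. $\vec h_{ij}=\nabla_i\nabla_j\vec\Phi$, $\vec H=\frac14 g^{ij}\vec h_{ij}$, $\pi_{\vec n}$ is the projection onto the normal bundle, $|\pi_{\vec n}\nabla\vec H|^2=\pi_{\vec n}\nabla_i\vec H\cdot\pi_{\vec n}\nabla^i\vec H$, $|\vec H\cdot\vec h|^2=(\vec H\cdot\vec h_{ij})(\vec H\cdot\vec h^{ij})$, $|\vec H|^4=(\vec H\cdot\vec H)^2$. Conformal invariance means that the energy of $\vec\Phi$ is unchanged when $\vec\Phi$ is composed with a translation, rotation or dilation of $\mathbb{R}^m$, or with a special conformal transformation (an inversion, followed by a translation, followed by an inversion) $$x\mapsto\frac{x+|x|^2\vec c}{1+2\vec c\cdot x+|\vec c|^2|x|^2},\qquad \vec c\in\mathbb{R}^m,$$ which is finite on $\vec\Phi(\Sigma)$. The infinitesimal version of the latter is $\delta\vec\Phi=|\vec\Phi|^2\vec c-2(\vec c\cdot\vec\Phi)\vec\Phi$.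 *)

theory Defs
  imports "HOL-Analysis.Analysis"
begin

section \<open>Smooth maps and closed manifolds\<close>

text \<open>For open \<open>S\<close>, \<open>C_on k S f\<close> says that \<open>f\<close> is of class \<open>C\<^sup>k\<close> on \<open>S\<close>: by induction, \<open>f\<close> is
  differentiable and all its directional derivatives are of class \<open>C\<^sup>k\<^sup>-\<^sup>1\<close>.\<close>

primrec C_on :: "nat \<Rightarrow> 'a::real_normed_vector set \<Rightarrow> ('a \<Rightarrow> 'b::real_normed_vector) \<Rightarrow> bool" where
  "C_on 0 S f \<longleftrightarrow> continuous_on S f"
| "C_on (Suc k) S f \<longleftrightarrow> (\<forall>x\<in>S. f differentiable (at x)) \<and>
     (\<forall>v. C_on k S (\<lambda>x. frechet_derivative f (at x) v))"

definition smooth_on :: "'a::real_normed_vector set \<Rightarrow> ('a \<Rightarrow> 'b::real_normed_vector) \<Rightarrow> bool" where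
  "smooth_on S f \<longleftrightarrow> (\<forall>k. C_on k S f)"

text \<open>A chart is a pair of a coordinate domain and a coordinate map; values of the coordinate map
  outside the domain play no role.\<close>

type_synonym ('a, 'n) chart = "'a set \<times> ('a \<Rightarrow> real^'n)"

definition chart_on :: "'a::topological_space set \<Rightarrow> ('a, 'n::finite) chart \<Rightarrow> bool" where
  "chart_on M = (\<lambda>(U, \<phi>). openin (top_of_set M) U \<and> open (\<phi> ` U) \<and>
     homeomorphism U (\<phi> ` U) \<phi> (inv_into U \<phi>))"

text \<open>Closed means compact without boundary. \<open>\<A>\<close> need not be maximal; second countability is
  automatic since \<open>M\<close> is compact.\<close>

definition closed_manifold :: "'a::t2_space set \<Rightarrow> ('a, 'n::finite) chart set \<Rightarrow> bool" where
  "closed_manifold M \<A> \<longleftrightarrow> compact M \<and> (\<forall>c\<in>\<A>. chart_on M c) \<and> (\<Union>c\<in>\<A>. fst c) = M \<and>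
     (\<forall>(U, \<phi>)\<in>\<A>. \<forall>(V, \<psi>)\<in>\<A>. smooth_on (\<phi> ` (U \<inter> V)) (\<psi> \<circ> inv_into U \<phi>))"

definition local_rep :: "('a, 'n::finite) chart \<Rightarrow> ('a \<Rightarrow> 'b) \<Rightarrow> real^'n \<Rightarrow> 'b" where
  "local_rep = (\<lambda>(U, \<phi>) \<Phi>. \<Phi> \<circ> inv_into U \<phi>)"

definition smooth_immersion :: "('a, 'n::finite) chart set \<Rightarrow> ('a \<Rightarrow> real^'m::finite) \<Rightarrow> bool" where
  "smooth_immersion \<A> \<Phi> \<longleftrightarrow> (\<forall>c\<in>\<A>. smooth_on (snd c ` fst c) (local_rep c \<Phi>) \<and>
     (\<forall>x\<in>snd c ` fst c. inj (frechet_derivative (local_rep c \<Phi>) (at x))))"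

section \<open>Local geometry of a parametrized 4-dimensional submanifold\<close>

text \<open>Here \<open>X\<close> is the immersion read in a chart and \<open>x\<close> is a coordinate point.\<close>

definition pd :: "4 \<Rightarrow> (real^4 \<Rightarrow> 'b::real_normed_vector) \<Rightarrow> real^4 \<Rightarrow> 'b" where
  "pd i f x = frechet_derivative f (at x) (axis i 1)"

definition metric :: "(real^4 \<Rightarrow> real^'m::finite) \<Rightarrow> real^4 \<Rightarrow> real^4^4" where
  "metric X x = (\<chi> i j. pd i X x \<bullet> pd j X x)"

definition inv_metric :: "(real^4 \<Rightarrow> real^'m::finite) \<Rightarrow> real^4 \<Rightarrow> real^4^4" where
  "inv_metric X x = matrix_inv (metric X x)"

definition christoffel :: "(real^4 \<Rightarrow> real^'m::finite) \<Rightarrow> 4 \<Rightarrow> 4 \<Rightarrow> 4 \<Rightarrow> real^4 \<Rightarrow> real" where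
  "christoffel X k i j x = (1/2) * (\<Sum>l\<in>UNIV. inv_metric X x $ k $ l *
     (pd i (\<lambda>y. metric X y $ j $ l) x + pd j (\<lambda>y. metric X y $ i $ l) x
      - pd l (\<lambda>y. metric X y $ i $ j) x))"

text \<open>The second covariant derivative \<open>\<nabla>\<^sub>i\<nabla>\<^sub>jX\<close>, taken componentwise in the target.\<close>

definition second_ff :: "(real^4 \<Rightarrow> real^'m::finite) \<Rightarrow> 4 \<Rightarrow> 4 \<Rightarrow> real^4 \<Rightarrow> real^'m" where
  "second_ff X i j x = pd i (pd j X) x - (\<Sum>k\<in>UNIV. christoffel X k i j x *\<^sub>R pd k X x)"

definition mean_curv :: "(real^4 \<Rightarrow> real^'m::finite) \<Rightarrow> real^4 \<Rightarrow> real^'m" where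
  "mean_curv X x = (1/4) *\<^sub>R (\<Sum>i\<in>UNIV. \<Sum>j\<in>UNIV. inv_metric X x $ i $ j *\<^sub>R second_ff X i j x)"

definition tangent_space :: "(real^4 \<Rightarrow> real^'m::finite) \<Rightarrow> real^4 \<Rightarrow> (real^'m) set" where
  "tangent_space X x = range (frechet_derivative X (at x))"

definition normal_proj :: "(real^4 \<Rightarrow> real^'m::finite) \<Rightarrow> real^4 \<Rightarrow> real^'m \<Rightarrow> real^'m" where
  "normal_proj X x v = (THE w. w \<in> orthogonal_comp (tangent_space X x) \<and> v - w \<in> tangent_space X x)"

definition local_density :: "(real^4 \<Rightarrow> real^'m::finite) \<Rightarrow> real^4 \<Rightarrow> real" where
  "local_density X x =
     (let g = inv_metric X x; H = mean_curv X x; h = (\<lambda>i j. second_ff X i j x);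
          DH = (\<lambda>i. normal_proj X x (pd i (mean_curv X) x))
      in (\<Sum>i\<in>UNIV. \<Sum>j\<in>UNIV. g $ i $ j * (DH i \<bullet> DH j))
         - (\<Sum>i\<in>UNIV. \<Sum>j\<in>UNIV. \<Sum>k\<in>UNIV. \<Sum>l\<in>UNIV.
              g $ i $ k * g $ j $ l * (H \<bullet> h i j) * (H \<bullet> h k l))
         + 7 * (H \<bullet> H)\<^sup>2)"

section \<open>The energy\<close>

text \<open>For an immersion, \<open>local_density\<close> does not depend on the coordinates, so any chart around the
  point may be used.\<close>

definition energy_density :: "('a, 4) chart set \<Rightarrow> ('a \<Rightarrow> real^'m::finite) \<Rightarrow> 'a \<Rightarrow> real" where
  "energy_density \<A> \<Phi> q =
     (let c = (SOME c. c \<in> \<A> \<and> q \<in> fst c) in local_density (local_rep c \<Phi>) (snd c q))"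

text \<open>The volume measure of the induced metric: the unique Borel measure on \<open>M\<close> which in every chart
  is \<open>sqrt (det g) dx\<close>.\<close>

definition volume_measure ::
    "'a::t2_space set \<Rightarrow> ('a, 4) chart set \<Rightarrow> ('a \<Rightarrow> real^'m::finite) \<Rightarrow> 'a measure" where
  "volume_measure M \<A> \<Phi> = (THE \<mu>. sets \<mu> = sets (restrict_space borel M) \<and>
     (\<forall>c\<in>\<A>. \<forall>B\<in>sets (restrict_space borel M). B \<subseteq> fst c \<longrightarrow>
        emeasure \<mu> B = (\<integral>\<^sup>+x\<in>snd c ` B. ennreal (sqrt (det (metric (local_rep c \<Phi>) x))) \<partial>lborel)))"

definition energy ::
    "'a::t2_space set \<Rightarrow> ('a, 4) chart set \<Rightarrow> ('a \<Rightarrow> real^'m::finite) \<Rightarrow> real" where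
  "energy M \<A> \<Phi> = (\<integral>q. energy_density \<A> \<Phi> q \<partial>volume_measure M \<A> \<Phi>)"

section \<open>Special conformal transformations\<close>

definition sct_denom :: "real^'m::finite \<Rightarrow> real^'m \<Rightarrow> real" where
  "sct_denom c x = 1 + 2 * (c \<bullet> x) + (norm c)\<^sup>2 * (norm x)\<^sup>2"

text \<open>The inversion \<open>x \<mapsto> x / |x|\<^sup>2\<close>, followed by translation by \<open>c\<close>, followed by the inversion;
  finite at \<open>x\<close> exactly when \<open>sct_denom c x \<noteq> 0\<close>.\<close>

definition special_conformal :: "real^'m::finite \<Rightarrow> real^'m \<Rightarrow> real^'m" where
  "special_conformal c x = (1 / sct_denom c x) *\<^sub>R (x + (norm x)\<^sup>2 *\<^sub>R c)"

end

theory Submission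
  imports Defs
begin

text \<open>The energy density is not invariant pointwise. It changes by a divergence, and the proof consists in finding
  the field whose divergence it is.

  A translation, rotation or dilation multiplies every term of the density by the same power of the dilation
  factor, and the volume element by the inverse power (\<open>similarity_invariance\<close>). A special conformal
  transformation with \<open>c \<noteq> 0\<close> is an inversion \<open>y \<mapsto> y / |y|\<^sup>2\<close> between two similarities
  (\<open>special_conformal_eq\<close>). So the theorem reduces to the inversion of an immersion \<open>X\<close> that avoids the origin
  (\<open>inversion_invariance\<close>).

  Let \<open>s = |X|\<^sup>2\<close>, let \<open>N\<close> and \<open>t\<close> be the normal and the tangential part of \<open>X\<close>, and \<open>R\<close> the reflection in the
  hyperplane orthogonal to \<open>X\<close>. The differential of the inversion is \<open>R / s\<close>, and for the inverted surface one finds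
  the metric \<open>g / s\<^sup>2\<close>, the second fundamental form \<open>R (h + 2 g N / s) / s\<close>, the mean curvature vector \<open>R (s H + 2 N)\<close>
  and its normal derivative \<open>R (s \<pi> \<partial>\<^sub>i H + 2 t\<^sub>i H - 2 t\<^sup>k h\<^sub>i\<^sub>k)\<close>. The volume element is divided by \<open>s\<^sup>4\<close>. With these
  formulas \<open>s\<^sup>-\<^sup>4\<close> times the new density minus the old density is the divergence of
  \<open>-(4/s) S\<^sub>Q t + (10 |H|\<^sup>2 / s + 16 (N \<bullet> H) / s\<^sup>2 + 4 / s\<^sup>2 + 8 |N|\<^sup>2 / s\<^sup>3) t\<close>,
  where \<open>Q = H + N / s\<close> and \<open>S\<^sub>Q\<close> is the shape operator in the direction \<open>Q\<close> (\<open>defect_field\<close>,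
  \<open>local_density_inversion\<close>). Density, field and divergence do not depend on the coordinates, so this identity
  is checked at the centre of normal coordinates. There the Codazzi equation is the symmetry of third
  derivatives, and the rest is an identity between polynomials in scalar invariants.

  As the manifold is closed, the divergence of a tangent field has integral zero (\<open>divergence_theorem\<close>). A
  partition of unity localizes this statement to charts. In a chart, Jacobi's formula for the derivative of
  \<open>sqrt (det g)\<close> turns the divergence into partial derivatives of compactly supported functions, whose integrals
  vanish by the translation invariance of Lebesgue measure.

  The volume measure is given by a definite description. It exists because the measures \<open>sqrt (det g) dx\<close> of
  the charts agree on overlaps, and a conformal factor \<open>k\<close> of the immersion gives it the density \<open>k\<^sup>4\<close>
  (\<open>energy_conformal\<close>).\<close>



section \<open>Maps of class \<open>C\<^sup>k\<close>\<close>

lemma C_on_cong: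
  assumes "open S" "C_on k S f" "\<And>x. x \<in> S \<Longrightarrow> f x = g x"
  shows "C_on k S g"
  using assms(2,3)
proof (induction k arbitrary: f g)
  case 0
  then show ?case by (simp cong: continuous_on_cong)
next
  case (Suc k)
  have d: "f differentiable (at x)" "frechet_derivative f (at x) = frechet_derivative g (at x)"
    if "x \<in> S" for x
    using Suc.prems that frechet_derivative_transform_within_open[OF _ assms(1) that, of f g] by auto
  have "g differentiable (at x)" if x: "x \<in> S" for x
    using has_derivative_transform_within_open[OF _ assms(1) x, of f _ UNIV g] d(1)[OF x] Suc.prems(2)
    unfolding differentiable_def by auto
  moreover have "C_on k S (\<lambda>x. frechet_derivative g (at x) v)" for v
    using Suc.IH[of "\<lambda>x. frechet_derivative f (at x) v"] Suc.prems d(2) by auto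
  ultimately show ?case by auto
qed

lemma C_on_SucI:
  assumes "open S" "\<And>x. x \<in> S \<Longrightarrow> (f has_derivative f' x) (at x)" "\<And>v. C_on k S (\<lambda>x. f' x v)"
  shows "C_on (Suc k) S f"
proof -
  have "C_on k S (\<lambda>x. frechet_derivative f (at x) v)" for v
    by (rule C_on_cong[OF assms(1) assms(3)[of v]]) (metis assms(2) frechet_derivative_at)
  then show ?thesis using assms(2) by (auto simp: differentiable_def)
qed

lemma C_on_continuous: "C_on k S f \<Longrightarrow> continuous_on S f"
  by (cases k) (auto intro!: continuous_at_imp_continuous_on differentiable_imp_continuous_within)

lemma C_on_SucD: "C_on (Suc k) S f \<Longrightarrow> C_on k S f"
proof (induction k arbitrary: f)
  case 0 then show ?case using C_on_continuous[of "Suc 0" S f] by simp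
next
  case (Suc k)
  show ?case unfolding C_on.simps(2)[of k]
  proof (intro conjI allI)
    show "\<forall>x\<in>S. f differentiable at x" using Suc.prems by simp
    show "C_on k S (\<lambda>x. frechet_derivative f (at x) v)" for v
      using Suc.prems Suc.IH[of "\<lambda>x. frechet_derivative f (at x) v"] by (simp only: C_on.simps(2)) blast
  qed
qed

lemma C_on_has_derivative:
  "C_on (Suc k) S f \<Longrightarrow> x \<in> S \<Longrightarrow> (f has_derivative frechet_derivative f (at x)) (at x)"
  using frechet_derivative_works by auto

lemma C_on_const: "C_on k S (\<lambda>x. c)"
  by (induction k arbitrary: c) auto

lemma C_on_subset: "C_on k S f \<Longrightarrow> T \<subseteq> S \<Longrightarrow> C_on k T f"
  by (induction k arbitrary: f) (auto intro: continuous_on_subset)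

lemma C_on_bounded_linear:
  assumes "open S" "bounded_linear L" "C_on k S f"
  shows "C_on k S (\<lambda>x. L (f x))"
  using assms(3)
proof (induction k arbitrary: f)
  case 0 then show ?case using assms(2) by (simp add: bounded_linear.continuous_on)
next
  case (Suc k)
  show ?case
    by (rule C_on_SucI[OF assms(1) bounded_linear.has_derivative[OF assms(2) C_on_has_derivative[OF Suc.prems]]])
      (use Suc in auto)
qed

lemma C_on_linear_map: "open S \<Longrightarrow> bounded_linear L \<Longrightarrow> C_on k S L"
proof (induction k)
  case (Suc k)
  show ?case
    by (rule C_on_SucI[OF Suc.prems(1) bounded_linear_imp_has_derivative[OF Suc.prems(2)] C_on_const])
qed (simp add: linear_continuous_on)

lemma C_on_ident: "open S \<Longrightarrow> C_on k S (\<lambda>x. x)"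
  by (rule C_on_linear_map) auto

lemma C_on_add:
  assumes "open S" "C_on k S f" "C_on k S g"
  shows "C_on k S (\<lambda>x. f x + g x)"
  using assms(2,3)
proof (induction k arbitrary: f g)
  case (Suc k)
  show ?case
    by (rule C_on_SucI[OF assms(1) has_derivative_add[OF C_on_has_derivative[OF Suc.prems(1)]
          C_on_has_derivative[OF Suc.prems(2)]]]) (use Suc in auto)
qed (simp add: continuous_on_add)

lemma C_on_bilinear:
  assumes "open S" "bounded_bilinear B" "C_on k S f" "C_on k S g"
  shows "C_on k S (\<lambda>x. B (f x) (g x))"
  using assms(3,4)
proof (induction k arbitrary: f g)
  case 0 then show ?case using assms(2) by (simp add: bounded_bilinear.continuous_on)
next
  case (Suc k)
  show ?case
    by (rule C_on_SucI[OF assms(1) bounded_bilinear.FDERIV[OF assms(2) C_on_has_derivative[OF Suc.prems(1)]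
          C_on_has_derivative[OF Suc.prems(2)]]])
      (auto intro!: C_on_add[OF assms(1)] Suc.IH C_on_SucD[OF Suc.prems(1)] C_on_SucD[OF Suc.prems(2)]
         simp: Suc.prems[simplified])
qed

lemmas C_on_scaleR = C_on_bilinear[OF _ bounded_bilinear_scaleR]
lemmas C_on_inner = C_on_bilinear[OF _ bounded_bilinear_inner]
lemmas C_on_mult = C_on_bilinear[OF _ bounded_bilinear_mult]

lemma C_on_minus: "open S \<Longrightarrow> C_on k S f \<Longrightarrow> C_on k S (\<lambda>x. - f x)"
  by (rule C_on_bounded_linear[OF _ bounded_linear_minus[OF bounded_linear_ident]])

lemma C_on_diff: "open S \<Longrightarrow> C_on k S f \<Longrightarrow> C_on k S g \<Longrightarrow> C_on k S (\<lambda>x. f x - g x)"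
  using C_on_add[of S k f "\<lambda>x. - g x"] C_on_minus[of S k g] by simp

lemma C_on_sum: "open S \<Longrightarrow> (\<And>i. i \<in> I \<Longrightarrow> C_on k S (f i)) \<Longrightarrow> C_on k S (\<lambda>x. \<Sum>i\<in>I. f i x)"
  by (induction I rule: infinite_finite_induct) (auto simp: C_on_const intro!: C_on_add)

lemma C_on_prod:
  fixes f :: "'i \<Rightarrow> 'a::real_normed_vector \<Rightarrow> real"
  shows "open S \<Longrightarrow> (\<And>i. i \<in> I \<Longrightarrow> C_on k S (f i)) \<Longrightarrow> C_on k S (\<lambda>x. \<Prod>i\<in>I. f i x)"
  by (induction I rule: infinite_finite_induct) (auto simp: C_on_const intro!: C_on_mult)

lemma C_on_power:
  fixes f :: "'a::real_normed_vector \<Rightarrow> real"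
  shows "open S \<Longrightarrow> C_on k S f \<Longrightarrow> C_on k S (\<lambda>x. f x ^ n)"
  by (induction n) (auto simp: C_on_const intro!: C_on_mult)

text \<open>The chain rule differentiates \<open>f\<close> in the direction \<open>Dg(x) v\<close>, which varies with \<open>x\<close>, whereas the
  recursive definition controls derivatives in constant directions only. Expanding \<open>Dg(x) v\<close> in a
  basis turns the derivative into a sum of products to which the induction hypothesis applies.\<close>

lemma C_on_compose:
  fixes f :: "'b::euclidean_space \<Rightarrow> 'c::real_normed_vector" and g :: "'a::real_normed_vector \<Rightarrow> 'b"
  assumes "open S" "C_on k T f" "C_on k S g" "g ` S \<subseteq> T"
  shows "C_on k S (\<lambda>x. f (g x))"
  using assms(2,3)
proof (induction k arbitrary: f)
  case 0
  then show ?case using continuous_on_compose2[of T f S g] assms(4) by auto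
next
  case (Suc k)
  have der: "((\<lambda>x. f (g x)) has_derivative
      (\<lambda>v. \<Sum>b\<in>Basis. (frechet_derivative g (at x) v \<bullet> b) *\<^sub>R frechet_derivative f (at (g x)) b)) (at x)"
    if x: "x \<in> S" for x
  proof -
    have f: "(f has_derivative frechet_derivative f (at (g x))) (at (g x))"
      using C_on_has_derivative[OF Suc.prems(1)] assms(4) x by auto
    have g: "(g has_derivative frechet_derivative g (at x)) (at x)"
      using C_on_has_derivative[OF Suc.prems(2) x] .
    have "frechet_derivative f (at (g x)) w = (\<Sum>b\<in>Basis. (w \<bullet> b) *\<^sub>R frechet_derivative f (at (g x)) b)" for w
      using linear_sum[OF has_derivative_linear[OF f], of "\<lambda>b. (w \<bullet> b) *\<^sub>R b" Basis]
      unfolding euclidean_representation linear_cmul[OF has_derivative_linear[OF f]] .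
    then have "frechet_derivative f (at (g x)) \<circ> frechet_derivative g (at x)
        = (\<lambda>v. \<Sum>b\<in>Basis. (frechet_derivative g (at x) v \<bullet> b) *\<^sub>R frechet_derivative f (at (g x)) b)"
      unfolding o_def by (intro ext)
    with diff_chain_at[OF g f] show ?thesis by (simp only: o_def)
  qed
  show ?case
  proof (rule C_on_SucI[OF assms(1) der])
    fix v
    show "C_on k S (\<lambda>x. \<Sum>b\<in>Basis. (frechet_derivative g (at x) v \<bullet> b) *\<^sub>R frechet_derivative f (at (g x)) b)"
    proof (intro C_on_sum C_on_scaleR C_on_inner assms(1) C_on_const)
      show "C_on k S (\<lambda>x. frechet_derivative g (at x) v)" using Suc.prems(2) by simp
      show "C_on k S (\<lambda>x. frechet_derivative f (at (g x)) b)" for b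
        using Suc.IH[of "\<lambda>y. frechet_derivative f (at y) b"] Suc.prems by (simp add: C_on_SucD)
    qed
  qed
qed

lemma C_on_inverse:
  fixes f :: "'a::real_normed_vector \<Rightarrow> real"
  assumes "open S" "C_on k S f" "\<And>x. x \<in> S \<Longrightarrow> f x \<noteq> 0"
  shows "C_on k S (\<lambda>x. inverse (f x))"
  using assms(2)
proof (induction k)
  case 0 then show ?case using assms(3) by (auto intro!: continuous_intros)
next
  case (Suc k)
  have IH: "C_on k S (\<lambda>x. inverse (f x))" using Suc C_on_SucD by blast
  show ?case
  proof (rule C_on_SucI[OF assms(1) Deriv.has_derivative_inverse[OF assms(3) C_on_has_derivative[OF Suc.prems]]])
    show "C_on k S (\<lambda>x. - (inverse (f x) * frechet_derivative f (at x) v * inverse (f x)))" for v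
      by (intro C_on_minus C_on_mult assms IH) (use Suc.prems in auto)
  qed auto
qed

lemma C_on_sqrt:
  fixes f :: "'a::real_normed_vector \<Rightarrow> real"
  assumes "open S" "C_on k S f" "\<And>x. x \<in> S \<Longrightarrow> 0 < f x"
  shows "C_on k S (\<lambda>x. sqrt (f x))"
  using assms(2)
proof (induction k)
  case 0 then show ?case by (auto intro!: continuous_intros)
next
  case (Suc k)
  have IH: "C_on k S (\<lambda>x. sqrt (f x))" using Suc C_on_SucD by blast
  show ?case
  proof (rule C_on_SucI[OF assms(1) has_derivative_real_sqrt[OF assms(3) C_on_has_derivative[OF Suc.prems]]])
    have "C_on k S (\<lambda>x. frechet_derivative f (at x) v * inverse (sqrt (f x) * 2))" for v
      using Suc.prems by (intro C_on_mult C_on_inverse C_on_const IH assms(1)) (auto dest: assms(3))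
    moreover have "inverse (sqrt (f x) * 2) = inverse (sqrt (f x)) / 2" for x
      by (simp add: field_simps)
    ultimately show "C_on k S (\<lambda>x. frechet_derivative f (at x) v * (inverse (sqrt (f x)) / 2))" for v
      by (simp only:)
  qed auto
qed

lemma C_on_vec_nth: "open S \<Longrightarrow> C_on k S f \<Longrightarrow> C_on k S (\<lambda>x. f x $ i)"
  by (rule C_on_bounded_linear[OF _ bounded_linear_vec_nth])

lemma smooth_onI: "(\<And>k. C_on k S f) \<Longrightarrow> smooth_on S f"
  by (simp add: smooth_on_def)

lemma smooth_onD: "smooth_on S f \<Longrightarrow> C_on k S f"
  by (simp add: smooth_on_def)

section \<open>Symmetry of second derivatives\<close>

text \<open>The second difference of \<open>f\<close> over the parallelogram spanned by \<open>h a\<close> and \<open>h b\<close> is symmetric in \<open>a\<close>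
  and \<open>b\<close>. Two applications of the mean value theorem show that it equals \<open>h\<^sup>2\<close> times a value of
  either mixed derivative inside the parallelogram, so continuity identifies both at \<open>x\<close>.\<close>

lemma mixed_derivatives_real:
  fixes f :: "'a::real_normed_vector \<Rightarrow> real"
  assumes S: "open S" "x \<in> S" and f: "C_on 2 S f"
  shows "frechet_derivative (\<lambda>y. frechet_derivative f (at y) a) (at x) b
       = frechet_derivative (\<lambda>y. frechet_derivative f (at y) b) (at x) a"
proof -
  define D where "D a b y = frechet_derivative (\<lambda>y. frechet_derivative f (at y) a) (at y) b" for a b y
  have f2: "C_on (Suc (Suc 0)) S f" using f by (simp add: numeral_2_eq_2)
  have cont: "continuous_on S (D a b)" for a b using f2 unfolding D_def by simp
  have d1: "(f has_derivative frechet_derivative f (at y)) (at y)" if "y \<in> S" for y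
    using C_on_has_derivative[OF f2 that] .
  have d2: "((\<lambda>y. frechet_derivative f (at y) a) has_derivative (\<lambda>b. D a b y)) (at y)" if "y \<in> S" for y a
    using C_on_has_derivative[of 0 S "\<lambda>y. frechet_derivative f (at y) a" y] f2 that unfolding D_def by simp
  have mvt: "\<exists>\<sigma> \<tau>. 0 < \<sigma> \<and> \<sigma> < h \<and> 0 < \<tau> \<and> \<tau> < h \<and>
      f (x + h *\<^sub>R a + h *\<^sub>R b) - f (x + h *\<^sub>R a) - f (x + h *\<^sub>R b) + f x = h * h * D a b (x + \<sigma> *\<^sub>R a + \<tau> *\<^sub>R b)"
    if h: "0 < h" and par: "\<And>\<sigma> \<tau>. 0 \<le> \<sigma> \<Longrightarrow> \<sigma> \<le> h \<Longrightarrow> 0 \<le> \<tau> \<Longrightarrow> \<tau> \<le> h \<Longrightarrow> x + \<sigma> *\<^sub>R a + \<tau> *\<^sub>R b \<in> S" for h a b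
  proof -
    define g where "g \<sigma> = f (x + \<sigma> *\<^sub>R a + h *\<^sub>R b) - f (x + \<sigma> *\<^sub>R a)" for \<sigma>
    have ch: "((\<lambda>\<sigma>. f (c + \<sigma> *\<^sub>R a)) has_derivative (\<lambda>u. u * frechet_derivative f (at (c + \<sigma> *\<^sub>R a)) a)) (at \<sigma>)"
      if "c + \<sigma> *\<^sub>R a \<in> S" for c \<sigma>
    proof -
      have "((\<lambda>\<sigma>. c + \<sigma> *\<^sub>R a) has_derivative (\<lambda>u. u *\<^sub>R a)) (at \<sigma>)" by (auto intro!: derivative_eq_intros)
      from diff_chain_at[OF this d1[OF that]] show ?thesis
        using linear_cmul[OF has_derivative_linear[OF d1[OF that]]] by (simp add: o_def)
    qed
    have "(g has_derivative (\<lambda>u. u * (frechet_derivative f (at (x + \<sigma> *\<^sub>R a + h *\<^sub>R b)) a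
         - frechet_derivative f (at (x + \<sigma> *\<^sub>R a)) a))) (at \<sigma>)" if "0 \<le> \<sigma>" "\<sigma> \<le> h" for \<sigma>
      unfolding g_def right_diff_distrib
      using ch[of "x + h *\<^sub>R b" \<sigma>] ch[of x \<sigma>] par[of \<sigma> 0] par[of \<sigma> h] that h
      by (intro has_derivative_diff) (auto simp: algebra_simps)
    then have "\<exists>\<sigma>\<in>{0<..<h}. g h - g 0 = (h - 0) * (frechet_derivative f (at (x + \<sigma> *\<^sub>R a + h *\<^sub>R b)) a
         - frechet_derivative f (at (x + \<sigma> *\<^sub>R a)) a)"
      using h by (intro mvt_simple[of 0 h g "\<lambda>\<sigma> u. u * (frechet_derivative f (at (x + \<sigma> *\<^sub>R a + h *\<^sub>R b)) a
         - frechet_derivative f (at (x + \<sigma> *\<^sub>R a)) a)"]) (auto intro: has_derivative_at_withinI)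
    then obtain \<sigma> where \<sigma>: "0 < \<sigma>" "\<sigma> < h" and
       g: "g h - g 0 = h * (frechet_derivative f (at (x + \<sigma> *\<^sub>R a + h *\<^sub>R b)) a
         - frechet_derivative f (at (x + \<sigma> *\<^sub>R a)) a)" by auto
    have "((\<lambda>\<tau>. frechet_derivative f (at (x + \<sigma> *\<^sub>R a + \<tau> *\<^sub>R b)) a) has_derivative
         (\<lambda>u. u * D a b (x + \<sigma> *\<^sub>R a + \<tau> *\<^sub>R b))) (at \<tau>)" if "0 \<le> \<tau>" "\<tau> \<le> h" for \<tau>
    proof -
      have S': "x + \<sigma> *\<^sub>R a + \<tau> *\<^sub>R b \<in> S" using par that \<sigma> by simp
      have "((\<lambda>\<tau>. x + \<sigma> *\<^sub>R a + \<tau> *\<^sub>R b) has_derivative (\<lambda>u. u *\<^sub>R b)) (at \<tau>)"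
        by (auto intro!: derivative_eq_intros)
      from diff_chain_at[OF this d2[OF S']] show ?thesis
        using linear_cmul[OF has_derivative_linear[OF d2[OF S']]] by (simp add: o_def)
    qed
    then have "\<exists>\<tau>\<in>{0<..<h}. frechet_derivative f (at (x + \<sigma> *\<^sub>R a + h *\<^sub>R b)) a
         - frechet_derivative f (at (x + \<sigma> *\<^sub>R a + 0 *\<^sub>R b)) a = (h - 0) * D a b (x + \<sigma> *\<^sub>R a + \<tau> *\<^sub>R b)"
      using h by (intro mvt_simple[of 0 h "\<lambda>\<tau>. frechet_derivative f (at (x + \<sigma> *\<^sub>R a + \<tau> *\<^sub>R b)) a"
          "\<lambda>\<tau> u. u * D a b (x + \<sigma> *\<^sub>R a + \<tau> *\<^sub>R b)"]) (auto intro: has_derivative_at_withinI)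
    then obtain \<tau> where "0 < \<tau>" "\<tau> < h" "frechet_derivative f (at (x + \<sigma> *\<^sub>R a + h *\<^sub>R b)) a
         - frechet_derivative f (at (x + \<sigma> *\<^sub>R a)) a = h * D a b (x + \<sigma> *\<^sub>R a + \<tau> *\<^sub>R b)" by auto
    then show ?thesis using \<sigma> g unfolding g_def
      by (intro exI[of _ \<sigma>] exI[of _ \<tau>]) (auto simp: algebra_simps)
  qed
  have small: "\<bar>D a b x - D b a x\<bar> \<le> \<epsilon>" if "\<epsilon> > 0" for \<epsilon>
  proof -
    obtain d1 where d1: "d1 > 0" "\<And>y. dist y x < d1 \<Longrightarrow> y \<in> S" using S open_dist by metis
    obtain d2 where d2: "d2 > 0" "\<And>y. y \<in> S \<Longrightarrow> dist y x < d2 \<Longrightarrow> dist (D a b y) (D a b x) < \<epsilon>/2"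
      using cont[of a b] S(2) \<open>\<epsilon>>0\<close> unfolding continuous_on_iff by (metis half_gt_zero)
    obtain d3 where d3: "d3 > 0" "\<And>y. y \<in> S \<Longrightarrow> dist y x < d3 \<Longrightarrow> dist (D b a y) (D b a x) < \<epsilon>/2"
      using cont[of b a] S(2) \<open>\<epsilon>>0\<close> unfolding continuous_on_iff by (metis half_gt_zero)
    define d where "d = min d1 (min d2 d3)"
    \<comment> \<open>Small enough for the whole parallelogram to lie within distance \<open>d\<close> of \<open>x\<close>.\<close>
    define h where "h = d / (2 * (1 + norm a + norm b))"
    have p: "0 < 1 + norm a + norm b" by (smt (verit) norm_ge_zero)
    have d: "d > 0" using d1 d2 d3 by (simp add: d_def)
    have h: "h > 0" using d p by (simp add: h_def)
    have near: "norm (\<sigma> *\<^sub>R a + \<tau> *\<^sub>R b) < d" if "0 \<le> \<sigma>" "\<sigma> \<le> h" "0 \<le> \<tau>" "\<tau> \<le> h" for \<sigma> \<tau>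
    proof -
      have "norm (\<sigma> *\<^sub>R a + \<tau> *\<^sub>R b) \<le> \<sigma> * norm a + \<tau> * norm b"
        using norm_triangle_ineq[of "\<sigma> *\<^sub>R a" "\<tau> *\<^sub>R b"] that by simp
      also have "\<dots> \<le> h * norm a + h * norm b" using that by (intro add_mono mult_right_mono) auto
      also have "\<dots> \<le> h * (1 + norm a + norm b)" using h by (simp add: algebra_simps)
      also have "h * (2 * (1 + norm a + norm b)) = d" unfolding h_def using p by (intro nonzero_eq_divide_eq[THEN iffD1]) auto
      then have "h * (1 + norm a + norm b) = d / 2" by (simp add: algebra_simps)
      finally show ?thesis using d by simp
    qed
    have near': "norm (\<tau> *\<^sub>R b + \<sigma> *\<^sub>R a) < d" if "0 \<le> \<sigma>" "\<sigma> \<le> h" "0 \<le> \<tau>" "\<tau> \<le> h" for \<sigma> \<tau>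
      using near[OF that] by (simp add: add.commute)
    have in1: "x + \<sigma> *\<^sub>R a + \<tau> *\<^sub>R b \<in> S" "x + \<tau> *\<^sub>R b + \<sigma> *\<^sub>R a \<in> S"
      if "0 \<le> \<sigma>" "\<sigma> \<le> h" "0 \<le> \<tau>" "\<tau> \<le> h" for \<sigma> \<tau>
      using near[OF that] near'[OF that] by (auto intro!: d1(2) simp: dist_norm d_def algebra_simps)
    obtain \<sigma> \<tau> where 1: "0 < \<sigma>" "\<sigma> < h" "0 < \<tau>" "\<tau> < h"
      "f (x + h *\<^sub>R a + h *\<^sub>R b) - f (x + h *\<^sub>R a) - f (x + h *\<^sub>R b) + f x = h * h * D a b (x + \<sigma> *\<^sub>R a + \<tau> *\<^sub>R b)"
      using mvt[OF h, of a b] in1 by blast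
    obtain \<sigma>' \<tau>' where 2: "0 < \<sigma>'" "\<sigma>' < h" "0 < \<tau>'" "\<tau>' < h"
      "f (x + h *\<^sub>R b + h *\<^sub>R a) - f (x + h *\<^sub>R b) - f (x + h *\<^sub>R a) + f x = h * h * D b a (x + \<sigma>' *\<^sub>R b + \<tau>' *\<^sub>R a)"
      using mvt[OF h, of b a] in1 by blast
    have "h * h * D a b (x + \<sigma> *\<^sub>R a + \<tau> *\<^sub>R b) = h * h * D b a (x + \<sigma>' *\<^sub>R b + \<tau>' *\<^sub>R a)"
      using 1(5) 2(5) by (simp add: algebra_simps)
    then have eq: "D a b (x + \<sigma> *\<^sub>R a + \<tau> *\<^sub>R b) = D b a (x + \<sigma>' *\<^sub>R b + \<tau>' *\<^sub>R a)" using h by simp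
    have "dist (D a b (x + \<sigma> *\<^sub>R a + \<tau> *\<^sub>R b)) (D a b x) < \<epsilon>/2"
      using 1 near[of \<sigma> \<tau>] in1[of \<sigma> \<tau>] by (intro d2(2)) (auto simp: dist_norm d_def algebra_simps)
    moreover have "dist (D b a (x + \<sigma>' *\<^sub>R b + \<tau>' *\<^sub>R a)) (D b a x) < \<epsilon>/2"
      using 2 near'[of \<tau>' \<sigma>'] in1[of \<tau>' \<sigma>'] by (intro d3(2)) (auto simp: dist_norm d_def algebra_simps)
    ultimately show ?thesis unfolding eq dist_real_def by linarith
  qed
  have "D a b x = D b a x"
  proof (rule ccontr)
    assume "D a b x \<noteq> D b a x"
    then show False using small[of "\<bar>D a b x - D b a x\<bar> / 2"] by simp
  qed
  then show ?thesis by (simp add: D_def)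
qed

lemma mixed_derivatives:
  fixes f :: "'a::real_normed_vector \<Rightarrow> 'b::real_inner"
  assumes S: "open S" "x \<in> S" and f: "C_on 2 S f"
  shows "frechet_derivative (\<lambda>y. frechet_derivative f (at y) a) (at x) b
       = frechet_derivative (\<lambda>y. frechet_derivative f (at y) b) (at x) a"
proof -
  have f2: "C_on (Suc (Suc 0)) S f" using f by (simp add: numeral_2_eq_2)
  have inn: "frechet_derivative (\<lambda>z. h z \<bullet> u) (at y) c = frechet_derivative h (at y) c \<bullet> u"
    if "C_on (Suc k) S h" "y \<in> S" for h :: "'a \<Rightarrow> 'b" and u y c k
    using frechet_derivative_at[OF has_derivative_inner_left[OF C_on_has_derivative[OF that], of u]] by metis
  have "frechet_derivative (\<lambda>y. frechet_derivative f (at y) a) (at x) b \<bullet> u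
      = frechet_derivative (\<lambda>y. frechet_derivative (\<lambda>z. f z \<bullet> u) (at y) a) (at x) b" for a b u
  proof -
    have "C_on (Suc 0) S (\<lambda>y. frechet_derivative f (at y) a)" using f2 by simp
    then have d: "((\<lambda>y. frechet_derivative f (at y) a \<bullet> u) has_derivative
        (\<lambda>b. frechet_derivative (\<lambda>y. frechet_derivative f (at y) a) (at x) b \<bullet> u)) (at x)"
      by (intro has_derivative_inner_left C_on_has_derivative[OF _ S(2)])
    have "((\<lambda>y. frechet_derivative (\<lambda>z. f z \<bullet> u) (at y) a) has_derivative
        (\<lambda>b. frechet_derivative (\<lambda>y. frechet_derivative f (at y) a) (at x) b \<bullet> u)) (at x)"
      by (rule has_derivative_transform_within_open[OF d S]) (simp add: inn[OF f2])
    from frechet_derivative_at[OF this] show ?thesis by metis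
  qed
  moreover have "C_on 2 S (\<lambda>z. f z \<bullet> u)" for u
    by (intro C_on_inner S f C_on_const)
  ultimately show ?thesis
    using mixed_derivatives_real[OF S] by (metis vector_eq_rdot)
qed

section \<open>Determinants and inverses of matrix-valued maps\<close>

lemma C_on_det:
  fixes A :: "'a::real_normed_vector \<Rightarrow> real^'n^'n"
  assumes "open S" "\<And>i j. C_on k S (\<lambda>x. A x $ i $ j)"
  shows "C_on k S (\<lambda>x. det (A x))"
  unfolding det_def by (intro C_on_sum C_on_mult C_on_prod C_on_const assms)

lemma matrix_inv_mult:
  fixes A :: "real^'n^'n"
  assumes "det A \<noteq> 0"
  shows "A ** matrix_inv A = mat 1" "matrix_inv A ** A = mat 1"
proof -
  have "\<exists>B. A ** B = mat 1 \<and> B ** A = mat 1"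
    using assms by (simp flip: invertible_def add: invertible_det_nz)
  from someI_ex[OF this] show "A ** matrix_inv A = mat 1" "matrix_inv A ** A = mat 1"
    by (auto simp: matrix_inv_def)
qed

lemma matrix_inv_unique:
  fixes A B :: "real^'n^'n"
  assumes "B ** A = mat 1" "A ** B = mat 1"
  shows "matrix_inv A = B"
proof -
  have "det A \<noteq> 0" using assms by (metis invertible_def invertible_det_nz)
  then show ?thesis by (metis assms(1) matrix_inv_mult(1) matrix_mul_assoc matrix_mul_lid matrix_mul_rid)
qed

lemma matrix_inv_scaleR:
  fixes A :: "real^'n^'n"
  assumes "det A \<noteq> 0" "k \<noteq> 0"
  shows "matrix_inv (k *\<^sub>R A) = inverse k *\<^sub>R matrix_inv A"
proof (rule matrix_inv_unique)
  have *: "(a *\<^sub>R P) ** (b *\<^sub>R Q) = (a * b) *\<^sub>R (P ** Q)" for a b and P Q :: "real^'n^'n"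
    by (simp add: vec_eq_iff matrix_matrix_mult_def sum_distrib_left mult_ac)
  show "(inverse k *\<^sub>R matrix_inv A) ** (k *\<^sub>R A) = mat 1" "(k *\<^sub>R A) ** (inverse k *\<^sub>R matrix_inv A) = mat 1"
    unfolding * using matrix_inv_mult[OF assms(1)] assms(2) by auto
qed

lemma det_scaleR: "det (k *\<^sub>R (A::real^'n^'n)) = k ^ CARD('n) * det A"
proof -
  have "k *\<^sub>R A = (\<chi> i. k *s (A $ i))" by (simp add: vec_eq_iff)
  then show ?thesis using det_rows_mul[of "\<lambda>_. k" "\<lambda>i. A $ i"] by simp
qed

text \<open>Exhibiting the entries of the inverse as quotients of determinants makes their smoothness a
  consequence of the smoothness of sums and products.\<close>

lemma matrix_inv_cramer:
  fixes A :: "real^'n^'n"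
  assumes "det A \<noteq> 0"
  shows "matrix_inv A $ i $ j = det (\<chi> a b. if b = i then (if a = j then 1 else 0) else A $ a $ b) / det A"
proof -
  have "A ** matrix_inv A = mat 1"
    using assms by (rule matrix_inv_mult)
  then have "A *v (matrix_inv A *v axis j 1) = axis j 1"
    by (simp add: matrix_vector_mul_assoc)
  then have "(matrix_inv A *v axis j 1) $ i = det (\<chi> a b. if b = i then axis j 1 $ a else A $ a $ b) / det A"
    using cramer[OF assms, of "matrix_inv A *v axis j 1" "axis j 1"] by (metis (no_types, lifting) vec_lambda_beta)
  moreover have "(matrix_inv A *v axis j 1) $ i = matrix_inv A $ i $ j"
    by (simp add: matrix_vector_mult_basis column_def)
  moreover have "axis j 1 $ a = (if a = j then 1 else (0::real))" for a by (simp add: axis_def)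
  ultimately show ?thesis by (simp only:)
qed

lemma C_on_matrix_inv:
  fixes A :: "'a::real_normed_vector \<Rightarrow> real^'n^'n"
  assumes "open S" "\<And>i j. C_on k S (\<lambda>x. A x $ i $ j)" "\<And>x. x \<in> S \<Longrightarrow> det (A x) \<noteq> 0"
  shows "C_on k S (\<lambda>x. matrix_inv (A x) $ i $ j)"
proof (rule C_on_cong[OF assms(1)])
  let ?B = "\<lambda>x. (\<chi> a b. if b = i then (if a = j then 1 else 0) else A x $ a $ b) :: real^'n^'n"
  have "C_on k S (\<lambda>x. ?B x $ a $ b)" for a b
    by (cases "b = i"; cases "a = j") (auto simp: C_on_const assms)
  then show "C_on k S (\<lambda>x. det (?B x) * inverse (det (A x)))"
    by (intro C_on_mult C_on_inverse C_on_det assms)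
  show "det (?B x) * inverse (det (A x)) = matrix_inv (A x) $ i $ j" if "x \<in> S" for x
    unfolding matrix_inv_cramer[OF assms(3)[OF that]] divide_inverse ..
qed

text \<open>Jacobi's formula. By multilinearity the derivative is the sum over \<open>i\<close> of the determinants of \<open>A\<close> with
  its \<open>i\<close>-th row replaced by that of \<open>A'\<close>. Writing the new row as a combination of the rows of \<open>A\<close>,
  Cramer's rule evaluates such a determinant as \<open>det A\<close> times one diagonal entry of \<open>A' A\<^sup>-\<^sup>1\<close>.\<close>

lemma has_derivative_det:
  fixes A :: "'a::real_normed_vector \<Rightarrow> real^'n^'n"
  assumes A: "\<And>i j. ((\<lambda>x. A x $ i $ j) has_derivative (\<lambda>v. A' v $ i $ j)) (at x)"
    and nz: "det (A x) \<noteq> 0"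
  shows "((\<lambda>x. det (A x)) has_derivative
    (\<lambda>v. det (A x) * (\<Sum>i\<in>UNIV. \<Sum>j\<in>UNIV. matrix_inv (A x) $ j $ i * A' v $ i $ j))) (at x)"
proof -
  let ?P = "{p. p permutes (UNIV::'n set)}"
  have der: "((\<lambda>x. det (A x)) has_derivative (\<lambda>v. \<Sum>p\<in>?P. of_int (sign p) *
     (\<Sum>i\<in>UNIV. A' v $ i $ p i * (\<Prod>j\<in>UNIV-{i}. A x $ j $ p j)))) (at x)"
    unfolding det_def
    by (intro has_derivative_sum has_derivative_mult_right has_derivative_prod A)
  have rep: "det (\<chi> r. if r = i then A' v $ i else A x $ r)
      = (\<Sum>p\<in>?P. of_int (sign p) * (A' v $ i $ p i * (\<Prod>j\<in>UNIV-{i}. A x $ j $ p j)))" for i v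
    unfolding det_def by (intro sum.cong refl arg_cong[where f="\<lambda>t. _ * t"])
      (subst prod.remove[of UNIV i]; auto intro!: prod.cong)
  have "det (\<chi> r. if r = i then A' v $ i else A x $ r)
      = det (A x) * (\<Sum>j\<in>UNIV. matrix_inv (A x) $ j $ i * A' v $ i $ j)" for i v
  proof -
    define c where "c = A' v $ i v* matrix_inv (A x)"
    have "matrix_inv (A x) ** A x = mat 1" using nz by (rule matrix_inv_mult)
    then have "c v* A x = A' v $ i" unfolding c_def by (simp add: vector_matrix_mul_assoc)
    then have *: "(\<Sum>k\<in>UNIV. c $ k *s row k (A x)) = A' v $ i"
      by (auto simp: vec_eq_iff vector_matrix_mult_def row_def mult.commute)
    have **: "row r (A x) = A x $ r" for r by (simp add: vec_eq_iff row_def)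
    have "det (\<chi> r. if r = i then A' v $ i else A x $ r) = c $ i * det (A x)"
      using cramer_lemma_transpose[of i c "A x"] unfolding * unfolding ** .
    then show ?thesis unfolding c_def by (simp add: vector_matrix_mult_def mult.commute)
  qed
  then have "(\<Sum>p\<in>?P. of_int (sign p) * (\<Sum>i\<in>UNIV. A' v $ i $ p i * (\<Prod>j\<in>UNIV-{i}. A x $ j $ p j)))
     = det (A x) * (\<Sum>i\<in>UNIV. \<Sum>j\<in>UNIV. matrix_inv (A x) $ j $ i * A' v $ i $ j)" for v
    using rep[of _ v] by (simp add: sum_distrib_left sum.swap[of _ _ ?P])
  then show ?thesis using der by simp
qed


section \<open>Partial derivatives\<close>

lemma pd_eqI: "(f has_derivative f') (at x) \<Longrightarrow> pd i f x = f' (axis i 1)"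
  unfolding pd_def by (metis frechet_derivative_at)

lemma frechet_derivative_pd:
  assumes "f differentiable (at x)"
  shows "frechet_derivative f (at x) v = (\<Sum>i\<in>UNIV. v $ i *\<^sub>R pd i f x)"
proof -
  have lin: "linear (frechet_derivative f (at x))" using assms by (rule linear_frechet_derivative)
  have "v = (\<Sum>i\<in>UNIV. v $ i *\<^sub>R axis i 1)"
    using basis_expansion[of v] by (simp add: scalar_mult_eq_scaleR)
  then have "frechet_derivative f (at x) v = frechet_derivative f (at x) (\<Sum>i\<in>UNIV. v $ i *\<^sub>R axis i 1)" by simp
  then show ?thesis unfolding pd_def by (simp add: linear_sum[OF lin] linear_cmul[OF lin])
qed

lemma has_derivative_pd:
  "f differentiable (at x) \<Longrightarrow> (f has_derivative (\<lambda>v. \<Sum>i\<in>UNIV. v $ i *\<^sub>R pd i f x)) (at x)"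
proof -
  assume f: "f differentiable (at x)"
  have "frechet_derivative f (at x) = (\<lambda>v. \<Sum>i\<in>UNIV. v $ i *\<^sub>R pd i f x)"
    by (intro ext frechet_derivative_pd f)
  then show ?thesis using f frechet_derivative_works[of f "at x"] by (simp only:)
qed

lemma pd_cong:
  assumes "open S" "x \<in> S" "\<And>y. y \<in> S \<Longrightarrow> f y = g y"
  shows "pd i f x = pd i g x"
proof (cases "f differentiable (at x)")
  case True
  then show ?thesis unfolding pd_def
    using frechet_derivative_transform_within_open[OF True assms(1,2), of g] assms(3) by auto
next
  case False
  \<comment> \<open>Both derivatives are then arbitrary values, but chosen by the same predicate.\<close>
  have "(f has_derivative f') (at x) = (g has_derivative f') (at x)" for f'
    using has_derivative_transform_within_open[OF _ assms(1,2), of f f' UNIV g]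
      has_derivative_transform_within_open[OF _ assms(1,2), of g f' UNIV f] assms(3) by auto
  then show ?thesis unfolding pd_def frechet_derivative_def by simp
qed

lemma pd_works: "f differentiable (at x) \<Longrightarrow> (f has_derivative frechet_derivative f (at x)) (at x)"
  using frechet_derivative_works by blast

lemma pd_const [simp]: "pd i (\<lambda>x. c) x = 0"
  by (simp add: pd_def)

lemma pd_add: "f differentiable (at x) \<Longrightarrow> g differentiable (at x) \<Longrightarrow>
    pd i (\<lambda>y. f y + g y) x = pd i f x + pd i g x"
  by (subst pd_eqI[OF has_derivative_add[OF pd_works pd_works]]) (auto simp: pd_def)

lemma pd_diff: "f differentiable (at x) \<Longrightarrow> g differentiable (at x) \<Longrightarrow>
    pd i (\<lambda>y. f y - g y) x = pd i f x - pd i g x"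
  by (subst pd_eqI[OF has_derivative_diff[OF pd_works pd_works]]) (auto simp: pd_def)

lemma pd_sum: "(\<And>a. a \<in> I \<Longrightarrow> f a differentiable (at x)) \<Longrightarrow>
    pd i (\<lambda>y. \<Sum>a\<in>I. f a y) x = (\<Sum>a\<in>I. pd i (f a) x)"
  by (subst pd_eqI[OF has_derivative_sum[OF pd_works]]) (auto simp: pd_def)

lemma pd_scaleR: "f differentiable (at x) \<Longrightarrow> g differentiable (at x) \<Longrightarrow>
    pd i (\<lambda>y. f y *\<^sub>R g y) x = f x *\<^sub>R pd i g x + pd i f x *\<^sub>R g x"
  by (subst pd_eqI[OF has_derivative_scaleR[OF pd_works pd_works]]) (auto simp: pd_def)

lemma pd_mult: 
  fixes f g :: "real^4 \<Rightarrow> real"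
  shows "f differentiable (at x) \<Longrightarrow> g differentiable (at x) \<Longrightarrow>
    pd i (\<lambda>y. f y * g y) x = f x * pd i g x + pd i f x * g x"
  by (subst pd_eqI[OF has_derivative_mult[OF pd_works pd_works]]) (auto simp: pd_def)

lemma pd_inner: "f differentiable (at x) \<Longrightarrow> g differentiable (at x) \<Longrightarrow>
    pd i (\<lambda>y. f y \<bullet> g y) x = f x \<bullet> pd i g x + pd i f x \<bullet> g x"
  by (subst pd_eqI[OF has_derivative_inner[OF pd_works pd_works]]) (auto simp: pd_def)

lemma pd_bounded_linear: "bounded_linear L \<Longrightarrow> f differentiable (at x) \<Longrightarrow>
    pd i (\<lambda>y. L (f y)) x = L (pd i f x)"
  by (subst pd_eqI[OF bounded_linear.has_derivative[OF _ pd_works]]) (auto simp: pd_def)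

lemma pd_inverse:
  fixes f :: "real^4 \<Rightarrow> real"
  shows "f differentiable (at x) \<Longrightarrow> f x \<noteq> 0 \<Longrightarrow> pd i (\<lambda>y. inverse (f y)) x = - pd i f x / (f x)\<^sup>2"
proof -
  assume f: "f differentiable (at x)" "f x \<noteq> 0"
  have "pd i (\<lambda>y. inverse (f y)) x = - (inverse (f x) * pd i f x * inverse (f x))"
    unfolding pd_def[of i f] by (rule pd_eqI[OF Deriv.has_derivative_inverse[OF f(2) pd_works[OF f(1)]]])
  moreover have "- (a * d * a) = - d * (a * a)" for a d :: real by (simp add: algebra_simps)
  ultimately show ?thesis by (simp only: divide_inverse power2_eq_square inverse_mult_distrib)
qed

lemma pd_compose:
  fixes f :: "real^4 \<Rightarrow> 'b::real_normed_vector" and \<tau> :: "real^4 \<Rightarrow> real^4"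
  assumes "f differentiable (at (\<tau> x))" "\<tau> differentiable (at x)"
  shows "pd i (\<lambda>y. f (\<tau> y)) x = (\<Sum>a\<in>UNIV. pd i \<tau> x $ a *\<^sub>R pd a f (\<tau> x))"
proof -
  have "pd i (\<lambda>y. f (\<tau> y)) x = frechet_derivative f (at (\<tau> x)) (pd i \<tau> x)"
    using pd_eqI[OF diff_chain_at[OF pd_works[OF assms(2)] pd_works[OF assms(1)]], of i]
    by (simp add: o_def pd_def[of i \<tau>])
  then show ?thesis by (simp only: frechet_derivative_pd[OF assms(1)])
qed

lemma C_on_pd: "C_on (Suc k) S f \<Longrightarrow> C_on k S (pd i f)"
  unfolding pd_def[abs_def] by simp

lemma pd_commute:
  fixes f :: "real^4 \<Rightarrow> 'b::real_inner"
  assumes "open S" "x \<in> S" "C_on 2 S f"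
  shows "pd i (pd j f) x = pd j (pd i f) x"
  unfolding pd_def[abs_def] by (rule mixed_derivatives[OF assms])

lemma C_on_1I:
  fixes f :: "real^4 \<Rightarrow> 'b::real_normed_vector"
  assumes "open S" "\<And>x. x \<in> S \<Longrightarrow> f differentiable (at x)" "\<And>i. continuous_on S (pd i f)"
  shows "C_on 1 S f"
  unfolding One_nat_def
proof (rule C_on_SucI[OF assms(1) has_derivative_pd[OF assms(2)]])
  show "C_on 0 S (\<lambda>x. \<Sum>i\<in>UNIV. v $ i *\<^sub>R pd i f x)" for v
    using assms(3) by (auto intro!: continuous_intros)
qed

lemma sum_sum_swap:
  fixes F :: "'x \<Rightarrow> 'y \<Rightarrow> 'z \<Rightarrow> 'w \<Rightarrow> 'e::comm_monoid_add"
  shows "(\<Sum>i\<in>A. \<Sum>j\<in>B. \<Sum>a\<in>C. \<Sum>b\<in>D. F i j a b) = (\<Sum>a\<in>C. \<Sum>b\<in>D. \<Sum>i\<in>A. \<Sum>j\<in>B. F i j a b)"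
proof -
  have *: "(\<Sum>i\<in>A. \<Sum>j\<in>B. G i j) = (\<Sum>p\<in>A \<times> B. G (fst p) (snd p))"
    for A :: "'p set" and B :: "'q set" and G :: "'p \<Rightarrow> 'q \<Rightarrow> 'e"
    by (simp add: sum.cartesian_product case_prod_unfold)
  have "(\<Sum>i\<in>A. \<Sum>j\<in>B. \<Sum>a\<in>C. \<Sum>b\<in>D. F i j a b)
      = (\<Sum>p\<in>A \<times> B. \<Sum>q\<in>C \<times> D. F (fst p) (snd p) (fst q) (snd q))"
    by (subst *) (simp only: *)
  also have "\<dots> = (\<Sum>q\<in>C \<times> D. \<Sum>p\<in>A \<times> B. F (fst p) (snd p) (fst q) (snd q))"
    by (rule sum.swap)
  finally show ?thesis by (subst *) (simp only: *)
qed

section \<open>Geometry of an immersed patch\<close>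

definition dual_frame :: "(real^4 \<Rightarrow> real^'m::finite) \<Rightarrow> 4 \<Rightarrow> real^4 \<Rightarrow> real^'m" where
  "dual_frame X i x = (\<Sum>j\<in>UNIV. inv_metric X x $ i $ j *\<^sub>R pd j X x)"

text \<open>On tangent fields this is the Riemannian divergence. Written with ambient derivatives it needs no
  Christoffel symbols, and it applies to any \<open>\<real>\<^sup>m\<close>-valued map.\<close>

definition surface_div :: "(real^4 \<Rightarrow> real^'m::finite) \<Rightarrow> (real^4 \<Rightarrow> real^'m) \<Rightarrow> real^4 \<Rightarrow> real" where
  "surface_div X f x = (\<Sum>i\<in>UNIV. dual_frame X i x \<bullet> pd i f x)"

lemma exists_orthonormal_frame:
  fixes L :: "real^'n \<Rightarrow> real^'m"
  assumes "linear L" "inj L"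
  shows "\<exists>v :: 'n \<Rightarrow> real^'n. \<forall>a b. L (v a) \<bullet> L (v b) = (if a = b then 1 else 0)"
proof -
  have sub: "subspace (range L)" using assms by (simp add: linear_subspace_image)
  have "dim (range L) = CARD('n)" using dim_image_eq[OF assms(1), of UNIV] assms(2) by (simp add: inj_on_def)
  with orthonormal_basis_subspace[OF sub] obtain B where
    B: "B \<subseteq> range L" "pairwise orthogonal B" "\<And>x. x \<in> B \<Longrightarrow> norm x = 1" "card B = CARD('n)" "independent B" by metis
  have "finite B" using B(4) by (metis card.infinite zero_less_card_finite less_irrefl)
  then obtain f where f: "bij_betw f (UNIV :: 'n set) B"
    using B(4) finite_same_card_bij[of "UNIV :: 'n set" B] by auto
  have "\<exists>v. \<forall>a. L (v a) = f a"
    using f B(1) by (intro choice) (metis UNIV_I bij_betwE image_iff subsetD)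
  then obtain v where v: "\<And>a. L (v a) = f a" by blast
  have "f a \<bullet> f b = (if a = b then 1 else 0)" for a b
  proof (cases "a = b")
    case True
    have "f a \<in> B" using f by (auto dest: bij_betwE)
    then show ?thesis using B(3)[of "f a"] True by (simp add: norm_eq_1)
  next
    case False
    then have "f a \<noteq> f b" using f by (auto simp: bij_betw_def inj_on_def)
    moreover have "f a \<in> B" "f b \<in> B" using f by (auto dest: bij_betwE)
    ultimately show ?thesis using B(2) False by (simp add: pairwise_def orthogonal_def)
  qed
  with v show ?thesis by metis
qed

text \<open>The definition of \<open>normal_proj\<close> refers to the tangent space as a set; in practice the projection is
  found by exhibiting coefficients of the tangential part.\<close>

lemma normal_proj_eqI:
  assumes X: "X differentiable (at x)" and w: "\<And>i. w \<bullet> pd i X x = 0" and v: "v - w = (\<Sum>i\<in>UNIV. c i *\<^sub>R pd i X x)"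
  shows "normal_proj X x v = w"
proof -
  let ?T = "tangent_space X x"
  have T: "u \<in> ?T \<longleftrightarrow> (\<exists>c. u = (\<Sum>i\<in>UNIV. c i *\<^sub>R pd i X x))" for u
  proof
    assume "\<exists>c. u = (\<Sum>i\<in>UNIV. c i *\<^sub>R pd i X x)"
    then obtain c where "u = (\<Sum>i\<in>UNIV. c i *\<^sub>R pd i X x)" ..
    then have "u = frechet_derivative X (at x) (\<chi> i. c i)" by (simp add: frechet_derivative_pd[OF X])
    then show "u \<in> ?T" by (simp add: tangent_space_def)
  qed (auto simp: tangent_space_def frechet_derivative_pd[OF X])
  have N: "u \<in> orthogonal_comp ?T \<longleftrightarrow> (\<forall>i. u \<bullet> pd i X x = 0)" for u
  proof
    assume "u \<in> orthogonal_comp ?T"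
    moreover have "pd i X x \<in> ?T" for i unfolding tangent_space_def pd_def by simp
    ultimately show "\<forall>i. u \<bullet> pd i X x = 0" by (auto simp: orthogonal_comp_def orthogonal_def inner_commute)
  qed (auto simp: orthogonal_comp_def orthogonal_def T inner_sum_right inner_commute[of _ u])
  have sub: "subspace ?T" unfolding tangent_space_def
    using linear_subspace_image[OF linear_frechet_derivative[OF X], of UNIV] by simp
  show ?thesis unfolding normal_proj_def
  proof (rule the_equality)
    show "w \<in> orthogonal_comp ?T \<and> v - w \<in> ?T" using w v by (auto simp: N T)
  next
    fix w' assume w': "w' \<in> orthogonal_comp ?T \<and> v - w' \<in> ?T"
    have "v - w \<in> ?T" using v T by blast
    then have "(v - w) - (v - w') \<in> ?T" using w' by (rule subspace_diff[OF sub _ conjunct2])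
    then have "w' - w \<in> ?T" by simp
    moreover have "w' - w \<in> orthogonal_comp ?T"
      using w' w by (auto simp: N inner_diff_left)
    ultimately have "(w' - w) \<bullet> (w' - w) = 0" by (auto simp: orthogonal_comp_def orthogonal_def)
    then show "w' = w" by simp
  qed
qed

lemma inj_frechet_derivative_if_det_metric:
  assumes Y: "Y differentiable (at z)" and det: "det (metric Y z) \<noteq> 0"
  shows "inj (frechet_derivative Y (at z))"
  unfolding linear_injective_0[OF linear_frechet_derivative[OF Y]]
proof (intro allI impI)
  fix v assume v: "frechet_derivative Y (at z) v = 0"
  have "(metric Y z *v v) $ i = pd i Y z \<bullet> frechet_derivative Y (at z) v" for i
    by (simp add: matrix_vector_mult_def metric_def frechet_derivative_pd[OF Y] inner_sum_right mult.commute)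
  then have "metric Y z *v v = 0" using v by (simp add: vec_eq_iff)
  then have "(matrix_inv (metric Y z) ** metric Y z) *v v = 0"
    by (simp flip: matrix_vector_mul_assoc)
  then show "v = 0" using matrix_inv_mult(2)[OF det] by simp
qed

locale patch =
  fixes S :: "(real^4) set" and X :: "real^4 \<Rightarrow> real^'m::finite"
  assumes open_S: "open S" and smooth: "smooth_on S X"
    and immersed: "\<And>x. x \<in> S \<Longrightarrow> inj (frechet_derivative X (at x))"
begin

lemma C_X: "C_on k S X" by (rule smooth_onD[OF smooth])
lemma C_pd_X: "C_on k S (pd i X)" by (rule C_on_pd[OF C_X])
lemma C_pd_pd_X: "C_on k S (pd i (pd j X))" by (rule C_on_pd[OF C_pd_X])

lemma C_on_diffble: "C_on 1 S f \<Longrightarrow> x \<in> S \<Longrightarrow> f differentiable (at x)" by simp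

lemmas diff_X [simp] = C_on_diffble[OF C_X]
lemmas diff_pd_X [simp] = C_on_diffble[OF C_pd_X]
lemmas diff_pd_pd_X [simp] = C_on_diffble[OF C_pd_pd_X]

lemma metric_entry: "metric X x $ i $ j = pd i X x \<bullet> pd j X x"
  by (simp add: metric_def)

lemma metric_sym: "metric X x $ i $ j = metric X x $ j $ i"
  by (simp add: metric_entry inner_commute)

text \<open>If the rows of \<open>P\<close> are the coordinates of an orthonormal tangent frame, then \<open>P g P\<^sup>T = 1\<close>; taking
  determinants makes \<open>(det P)\<^sup>2 det g = 1\<close>.\<close>

lemma det_metric_pos: assumes x: "x \<in> S" shows "0 < det (metric X x)"
proof -
  let ?L = "frechet_derivative X (at x)"
  obtain v :: "4 \<Rightarrow> real^4" where v: "\<And>a b. ?L (v a) \<bullet> ?L (v b) = (if a = b then 1 else 0)"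
    using exists_orthonormal_frame[OF linear_frechet_derivative[OF diff_X[OF x]] immersed[OF x]] by auto
  let ?P = "(\<chi> a. v a) :: real^4^4"
  have "(\<Sum>i\<in>UNIV. \<Sum>j\<in>UNIV. v a $ i * v b $ j * (pd i X x \<bullet> pd j X x)) = (if a = b then 1 else 0)" for a b
    using v[of a b] unfolding frechet_derivative_pd[OF diff_X[OF x]] inner_sum_left
    unfolding inner_sum_right by (simp add: mult.assoc mult.left_commute)
  moreover have "(?P ** metric X x ** transpose ?P) $ a $ b =
      (\<Sum>i\<in>UNIV. \<Sum>j\<in>UNIV. v a $ i * v b $ j * (pd i X x \<bullet> pd j X x))" for a b
    by (subst sum.swap) (simp add: matrix_matrix_mult_def metric_entry transpose_def sum_distrib_right sum_distrib_left mult_ac)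
  ultimately have "?P ** metric X x ** transpose ?P = mat 1"
    by (simp add: vec_eq_iff mat_def)
  then have "det ?P * det (metric X x) * det ?P = 1"
    by (metis det_I det_mul det_transpose)
  then have "(det ?P)\<^sup>2 * det (metric X x) = 1" by (simp add: power2_eq_square mult_ac)
  then show ?thesis by (metis zero_less_mult_pos zero_less_one zero_le_power2 order_le_less mult_zero_left zero_neq_one)
qed

lemma metric_inv:
  assumes x: "x \<in> S"
  shows "metric X x ** inv_metric X x = mat 1" "inv_metric X x ** metric X x = mat 1"
  using matrix_inv_mult[of "metric X x"] det_metric_pos[OF x] by (auto simp: inv_metric_def)

lemma inv_metric_sym: assumes x: "x \<in> S" shows "inv_metric X x $ i $ j = inv_metric X x $ j $ i"
proof -
  have t: "transpose (metric X x) = metric X x" by (simp add: transpose_def vec_eq_iff metric_sym[of x])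
  have "transpose (inv_metric X x) ** metric X x = mat 1" "metric X x ** transpose (inv_metric X x) = mat 1"
    using arg_cong[OF metric_inv(1)[OF x], of transpose] arg_cong[OF metric_inv(2)[OF x], of transpose]
    by (simp_all add: matrix_transpose_mul t)
  then have "inv_metric X x = transpose (inv_metric X x)"
    unfolding inv_metric_def by (rule matrix_inv_unique)
  then have "inv_metric X x $ i $ j = transpose (inv_metric X x) $ i $ j" by simp
  then show ?thesis by (simp add: transpose_def)
qed

lemma dual_frame_pd: assumes x: "x \<in> S" shows "dual_frame X i x \<bullet> pd j X x = (if i = j then 1 else 0)"
  using metric_inv(2)[OF x] by (simp add: dual_frame_def inner_sum_left metric_entry[symmetric]
    matrix_matrix_mult_def vec_eq_iff mat_def)

lemma dual_frame_dual_frame: assumes x: "x \<in> S" shows "dual_frame X i x \<bullet> dual_frame X j x = inv_metric X x $ i $ j"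
proof -
  have "dual_frame X i x \<bullet> dual_frame X j x = (\<Sum>k\<in>UNIV. inv_metric X x $ j $ k * (dual_frame X i x \<bullet> pd k X x))"
    by (simp add: dual_frame_def[of X j] inner_sum_right)
  also have "\<dots> = inv_metric X x $ j $ i" by (simp add: dual_frame_pd[OF x] if_distrib cong: if_cong)
  finally show ?thesis using inv_metric_sym[OF x] by simp
qed

lemma C_metric: "C_on k S (\<lambda>x. metric X x $ i $ j)"
  unfolding metric_entry by (intro C_on_inner open_S C_pd_X)

lemma C_inv_metric: "C_on k S (\<lambda>x. inv_metric X x $ i $ j)"
  unfolding inv_metric_def
  by (rule C_on_matrix_inv[OF open_S C_metric]) (use det_metric_pos in force)

lemma C_dual_frame: "C_on k S (dual_frame X i)"
  unfolding dual_frame_def[abs_def] by (intro C_on_sum C_on_scaleR open_S C_inv_metric C_pd_X)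

lemmas diff_dual_frame [simp] = C_on_diffble[OF C_dual_frame]
lemmas diff_inv_metric [simp] = C_on_diffble[OF C_inv_metric]

lemma tangent_part_pd:
  assumes x: "x \<in> S"
  shows "(\<Sum>i\<in>UNIV. (dual_frame X i x \<bullet> v) *\<^sub>R pd i X x) \<bullet> pd j X x = v \<bullet> pd j X x"
proof -
  have d: "dual_frame X i x \<bullet> v = (\<Sum>k\<in>UNIV. inv_metric X x $ i $ k * (pd k X x \<bullet> v))" for i
    by (simp add: dual_frame_def inner_sum_left)
  have "(\<Sum>i\<in>UNIV. (dual_frame X i x \<bullet> v) * (pd i X x \<bullet> pd j X x))
     = (\<Sum>i\<in>UNIV. \<Sum>k\<in>UNIV. metric X x $ j $ i * inv_metric X x $ i $ k * (pd k X x \<bullet> v))"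
    unfolding d by (simp add: sum_distrib_right sum_distrib_left metric_entry inner_commute[of "pd j X x"] mult_ac)
  also have "\<dots> = (\<Sum>k\<in>UNIV. (metric X x ** inv_metric X x) $ j $ k * (pd k X x \<bullet> v))"
    by (subst sum.swap) (simp add: matrix_matrix_mult_def sum_distrib_right)
  also have "\<dots> = v \<bullet> pd j X x"
    by (simp add: metric_inv[OF x] mat_def if_distrib[of "\<lambda>t. t * _"] inner_commute cong: if_cong)
  finally show ?thesis by (simp add: inner_sum_left)
qed

lemma normal_proj_eq:
  assumes x: "x \<in> S"
  shows "normal_proj X x v = v - (\<Sum>i\<in>UNIV. (dual_frame X i x \<bullet> v) *\<^sub>R pd i X x)"
  by (rule normal_proj_eqI[OF diff_X[OF x]]) (simp_all add: inner_diff_left tangent_part_pd[OF x])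

lemma normal_proj_pd_inner: "x \<in> S \<Longrightarrow> normal_proj X x v \<bullet> pd j X x = 0"
  by (simp add: normal_proj_eq inner_diff_left tangent_part_pd)

lemma normal_proj_add: "x \<in> S \<Longrightarrow> normal_proj X x (u + v) = normal_proj X x u + normal_proj X x v"
  by (simp add: normal_proj_eq inner_add_right scaleR_add_left sum.distrib)

lemma normal_proj_scaleR: "x \<in> S \<Longrightarrow> normal_proj X x (c *\<^sub>R v) = c *\<^sub>R normal_proj X x v"
  by (simp add: normal_proj_eq scaleR_diff_right scaleR_sum_right)

lemma linear_normal_proj: "x \<in> S \<Longrightarrow> linear (normal_proj X x)"
  by (intro linearI) (auto simp: normal_proj_add normal_proj_scaleR)

lemma normal_proj_pd: "x \<in> S \<Longrightarrow> normal_proj X x (pd j X x) = 0"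
  by (rule normal_proj_eqI[where c="\<lambda>i. if i = j then 1 else 0"]) (simp_all add: if_distrib[of "\<lambda>t. t *\<^sub>R _"] cong: if_cong)

lemma normal_proj_normal: "x \<in> S \<Longrightarrow> (\<And>i. w \<bullet> pd i X x = 0) \<Longrightarrow> normal_proj X x w = w"
  by (rule normal_proj_eqI[where c="\<lambda>i. 0"]) simp_all

lemma inner_normal_proj:
  assumes "x \<in> S" "\<And>i. w \<bullet> pd i X x = 0"
  shows "w \<bullet> normal_proj X x v = w \<bullet> v"
  by (simp add: normal_proj_eq[OF assms(1)] inner_diff_right inner_sum_right assms(2))

lemma C_normal_proj: "C_on k S f \<Longrightarrow> C_on k S (\<lambda>x. normal_proj X x (f x))"
  by (rule C_on_cong[OF open_S, where f="\<lambda>x. f x - (\<Sum>i\<in>UNIV. (dual_frame X i x \<bullet> f x) *\<^sub>R pd i X x)"])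
    (auto simp: normal_proj_eq intro!: C_on_diff C_on_sum C_on_scaleR C_on_inner open_S C_dual_frame C_pd_X)

lemma pd_pd_commute: "x \<in> S \<Longrightarrow> pd i (pd j X) x = pd j (pd i X) x"
  by (rule pd_commute[OF open_S _ C_X])

lemma pd_metric: "x \<in> S \<Longrightarrow>
    pd k (\<lambda>y. metric X y $ i $ j) x = pd i X x \<bullet> pd k (pd j X) x + pd k (pd i X) x \<bullet> pd j X x"
  unfolding metric_entry by (rule pd_inner) auto

text \<open>The ambient space is flat, so the Christoffel symbols are the tangential coefficients of the second
  derivatives of \<open>X\<close>. Therefore \<open>second_ff\<close> is the normal part of the second derivative, the form in
  which it is used from here on.\<close>

lemma christoffel_eq:
  assumes x: "x \<in> S"
  shows "christoffel X k i j x = dual_frame X k x \<bullet> pd i (pd j X) x"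
proof -
  have "pd i (\<lambda>y. metric X y $ j $ l) x + pd j (\<lambda>y. metric X y $ i $ l) x - pd l (\<lambda>y. metric X y $ i $ j) x
     = 2 * (pd l X x \<bullet> pd i (pd j X) x)" for l
    using pd_pd_commute[OF x, of i j] pd_pd_commute[OF x, of i l] pd_pd_commute[OF x, of j l]
    by (simp add: pd_metric[OF x] inner_commute)
  then show ?thesis unfolding christoffel_def
    by (simp add: dual_frame_def inner_sum_left sum_distrib_left)
qed

lemma second_ff_eq: "x \<in> S \<Longrightarrow> second_ff X i j x = normal_proj X x (pd i (pd j X) x)"
  by (simp add: second_ff_def christoffel_eq normal_proj_eq)

lemma second_ff_pd_inner: "x \<in> S \<Longrightarrow> second_ff X i j x \<bullet> pd k X x = 0"
  by (simp add: second_ff_eq normal_proj_pd_inner)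

lemma second_ff_sym: "x \<in> S \<Longrightarrow> second_ff X i j x = second_ff X j i x"
  using pd_pd_commute[of x i j] by (simp add: second_ff_eq)

lemma C_second_ff: "C_on k S (second_ff X i j)"
  by (rule C_on_cong[OF open_S C_normal_proj[OF C_pd_pd_X]]) (simp add: second_ff_eq)

lemma C_mean_curv: "C_on k S (mean_curv X)"
  unfolding mean_curv_def[abs_def]
  by (intro C_on_sum C_on_scaleR C_on_const open_S C_inv_metric C_second_ff)

lemmas diff_mean_curv [simp] = C_on_diffble[OF C_mean_curv]
lemmas diff_second_ff [simp] = C_on_diffble[OF C_second_ff]

lemma mean_curv_pd_inner: "x \<in> S \<Longrightarrow> mean_curv X x \<bullet> pd k X x = 0"
  by (simp add: mean_curv_def inner_sum_left second_ff_pd_inner)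

lemma patch_subset: "open T \<Longrightarrow> T \<subseteq> S \<Longrightarrow> patch T X"
  using smooth immersed by unfold_locales (auto simp: smooth_on_def intro: C_on_subset)

end


section \<open>Change of coordinates\<close>

text \<open>The same surface in two coordinate systems, \<open>X = Y \<circ> \<tau>\<close>. The map \<open>\<tau>\<close> will be a transition between two
  charts, or the passage to normal coordinates.\<close>

locale reparametrization = XP: patch S X + YP: patch T Y
  for S and X :: "real^4 \<Rightarrow> real^'m::finite" and T and Y +
  fixes \<tau> :: "real^4 \<Rightarrow> real^4"
  assumes smooth_\<tau>: "smooth_on S \<tau>" and \<tau>_in: "x \<in> S \<Longrightarrow> \<tau> x \<in> T" and X_eq: "x \<in> S \<Longrightarrow> X x = Y (\<tau> x)"
begin

abbreviation J :: "real^4 \<Rightarrow> 4 \<Rightarrow> 4 \<Rightarrow> real" where "J x a i \<equiv> pd i \<tau> x $ a"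

lemma C_\<tau>: "C_on k S \<tau>" by (rule smooth_onD[OF smooth_\<tau>])
lemma diff_\<tau> [simp]: "x \<in> S \<Longrightarrow> \<tau> differentiable (at x)" using C_\<tau>[of 1] by simp

lemma C_J: "C_on k S (\<lambda>x. J x a i)" by (intro C_on_vec_nth XP.open_S C_on_pd C_\<tau>)
lemma diff_J [simp]: "x \<in> S \<Longrightarrow> (\<lambda>x. J x a i) differentiable (at x)" using C_J[of 1] by simp

lemma pd_pullback:
  assumes "x \<in> S" "f differentiable (at (\<tau> x))" "\<And>y. y \<in> S \<Longrightarrow> F y = f (\<tau> y)"
  shows "pd i F x = (\<Sum>a\<in>UNIV. J x a i *\<^sub>R pd a f (\<tau> x))"
  using pd_cong[OF XP.open_S assms(1), of F "\<lambda>y. f (\<tau> y)"] assms pd_compose[OF assms(2) diff_\<tau>] by simp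

lemma pd_X: "x \<in> S \<Longrightarrow> pd i X x = (\<Sum>a\<in>UNIV. J x a i *\<^sub>R pd a Y (\<tau> x))"
  by (rule pd_pullback) (auto simp: \<tau>_in X_eq)

lemma metric_pullback:
  assumes x: "x \<in> S"
  shows "metric X x = transpose (\<chi> a i. J x a i) ** metric Y (\<tau> x) ** (\<chi> a i. J x a i)"
proof -
  have "metric X x $ i $ j = (\<Sum>b\<in>UNIV. \<Sum>a\<in>UNIV. J x a i * (metric Y (\<tau> x) $ a $ b * J x b j))" for i j
    unfolding XP.metric_entry pd_X[OF x] inner_sum_left unfolding inner_sum_right
    by (subst sum.swap) (simp add: YP.metric_entry mult_ac)
  then show ?thesis
    by (simp add: vec_eq_iff matrix_matrix_mult_def transpose_def sum_distrib_right mult.assoc)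
qed

lemma det_metric_pullback:
  "x \<in> S \<Longrightarrow> det (metric X x) = (det (\<chi> a i. J x a i))\<^sup>2 * det (metric Y (\<tau> x))"
  by (simp add: metric_pullback det_mul power2_eq_square)

lemma det_J_nonzero: "x \<in> S \<Longrightarrow> det (\<chi> a i. J x a i) \<noteq> 0"
  using det_metric_pullback XP.det_metric_pos by force

lemma inv_metric_pushforward:
  assumes x: "x \<in> S"
  shows "(\<Sum>i\<in>UNIV. \<Sum>j\<in>UNIV. inv_metric X x $ i $ j * (J x a i * J x b j)) = inv_metric Y (\<tau> x) $ a $ b"
proof -
  let ?J = "(\<chi> a i. J x a i) :: real^4^4"
  let ?GX = "inv_metric X x" and ?GY = "inv_metric Y (\<tau> x)"
  let ?K = "matrix_inv ?J"
  have J: "?J ** ?K = mat 1" "?K ** ?J = mat 1" using matrix_inv_mult[OF det_J_nonzero[OF x]] by auto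
  have JT: "transpose ?K ** transpose ?J = mat 1" "transpose ?J ** transpose ?K = mat 1"
    using arg_cong[OF J(1), of transpose] arg_cong[OF J(2), of transpose] by (simp_all add: matrix_transpose_mul)
  have g: "metric X x = transpose ?J ** metric Y (\<tau> x) ** ?J" by (rule metric_pullback[OF x])
  have m: "metric Y (\<tau> x) = transpose ?K ** metric X x ** ?K"
  proof -
    have "transpose ?K ** metric X x ** ?K = (transpose ?K ** transpose ?J) ** metric Y (\<tau> x) ** (?J ** ?K)"
      unfolding g by (simp only: matrix_mul_assoc)
    then show ?thesis by (simp only: J JT matrix_mul_lid matrix_mul_rid)
  qed
  have "(?J ** ?GX ** transpose ?J) ** metric Y (\<tau> x) = mat 1"
  proof -
    have "(?J ** ?GX ** transpose ?J) ** metric Y (\<tau> x)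
        = ?J ** (?GX ** ((transpose ?J ** transpose ?K) ** metric X x)) ** ?K"
      unfolding m by (simp add: matrix_mul_assoc)
    then show ?thesis using JT J XP.metric_inv[OF x] by simp
  qed
  moreover have "metric Y (\<tau> x) ** (?J ** ?GX ** transpose ?J) = mat 1"
    using calculation by (simp add: matrix_left_right_inverse)
  ultimately have "?GY = ?J ** ?GX ** transpose ?J"
    unfolding inv_metric_def by (intro matrix_inv_unique)
  then have "?GY $ a $ b = (\<Sum>j\<in>UNIV. \<Sum>i\<in>UNIV. J x a i * (?GX $ i $ j * J x b j))"
    by (simp add: matrix_matrix_mult_def transpose_def sum_distrib_right mult.assoc)
  then show ?thesis by (subst sum.swap) (simp add: mult_ac)
qed

text \<open>Contracting both slots of a covariant tensor with the inverse metric is independent of the coordinates.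
  Each invariance below reduces to this fact.\<close>

lemma contraction:
  fixes C :: "4 \<Rightarrow> 4 \<Rightarrow> 'v::real_vector"
  assumes x: "x \<in> S" and B: "\<And>i j. B i j = (\<Sum>a\<in>UNIV. \<Sum>b\<in>UNIV. (J x a i * J x b j) *\<^sub>R C a b)"
  shows "(\<Sum>i\<in>UNIV. \<Sum>j\<in>UNIV. inv_metric X x $ i $ j *\<^sub>R B i j)
       = (\<Sum>a\<in>UNIV. \<Sum>b\<in>UNIV. inv_metric Y (\<tau> x) $ a $ b *\<^sub>R C a b)"
proof -
  have "(\<Sum>i\<in>UNIV. \<Sum>j\<in>UNIV. inv_metric X x $ i $ j *\<^sub>R B i j)
    = (\<Sum>a\<in>UNIV. \<Sum>b\<in>UNIV. \<Sum>i\<in>UNIV. \<Sum>j\<in>UNIV. (inv_metric X x $ i $ j * (J x a i * J x b j)) *\<^sub>R C a b)"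
    unfolding B by (subst sum_sum_swap[symmetric]) (simp add: scaleR_sum_right)
  then show ?thesis by (simp add: scaleR_sum_left[symmetric] inv_metric_pushforward[OF x])
qed

lemma contraction_real:
  fixes C :: "4 \<Rightarrow> 4 \<Rightarrow> real"
  assumes x: "x \<in> S" and B: "\<And>i j. B i j = (\<Sum>a\<in>UNIV. \<Sum>b\<in>UNIV. J x a i * J x b j * C a b)"
  shows "(\<Sum>i\<in>UNIV. \<Sum>j\<in>UNIV. inv_metric X x $ i $ j * B i j)
       = (\<Sum>a\<in>UNIV. \<Sum>b\<in>UNIV. inv_metric Y (\<tau> x) $ a $ b * C a b)"
  using contraction[OF x, of B C] B by simp

lemma normal_proj_pullback: assumes x: "x \<in> S" shows "normal_proj X x v = normal_proj Y (\<tau> x) v"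
proof (rule normal_proj_eqI[symmetric])
  show "Y differentiable (at (\<tau> x))" using \<tau>_in[OF x] by simp
  let ?J = "(\<chi> a i. J x a i) :: real^4^4"
  let ?K = "matrix_inv ?J"
  have "?J ** ?K = mat 1" using matrix_inv_mult[OF det_J_nonzero[OF x]] by auto
  then have K: "(\<Sum>i\<in>UNIV. J x b i * ?K $ i $ a) = (if b = a then 1 else 0)" for a b
    by (simp add: vec_eq_iff matrix_matrix_mult_def mat_def)
  have Y: "pd a Y (\<tau> x) = (\<Sum>i\<in>UNIV. ?K $ i $ a *\<^sub>R pd i X x)" for a
  proof -
    have "(\<Sum>i\<in>UNIV. ?K $ i $ a *\<^sub>R pd i X x) = (\<Sum>b\<in>UNIV. (\<Sum>i\<in>UNIV. J x b i * ?K $ i $ a) *\<^sub>R pd b Y (\<tau> x))"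
      unfolding pd_X[OF x] scaleR_sum_right scaleR_sum_left by (subst sum.swap) (simp add: mult.commute)
    also have "\<dots> = pd a Y (\<tau> x)" by (simp add: K if_distrib[of "\<lambda>t. t *\<^sub>R _"] cong: if_cong)
    finally show ?thesis by simp
  qed
  show "normal_proj X x v \<bullet> pd a Y (\<tau> x) = 0" for a
    by (simp add: Y inner_sum_right XP.normal_proj_pd_inner[OF x])
  show "v - normal_proj X x v = (\<Sum>a\<in>UNIV. (\<Sum>i\<in>UNIV. J x a i * (dual_frame X i x \<bullet> v)) *\<^sub>R pd a Y (\<tau> x))"
    unfolding XP.normal_proj_eq[OF x] pd_X[OF x] scaleR_sum_right scaleR_sum_left
    by (subst sum.swap) (simp add: mult.commute)
qed

lemma pd_pd_X:
  assumes x: "x \<in> S"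
  shows "pd i (pd j X) x = (\<Sum>a\<in>UNIV. \<Sum>b\<in>UNIV. (J x a i * J x b j) *\<^sub>R pd a (pd b Y) (\<tau> x))
     + (\<Sum>a\<in>UNIV. pd i (\<lambda>y. J y a j) x *\<^sub>R pd a Y (\<tau> x))"
proof -
  have d: "(\<lambda>y. pd a Y (\<tau> y)) differentiable (at x)" for a
    using differentiable_chain_at[OF diff_\<tau>[OF x] YP.diff_pd_X[OF \<tau>_in[OF x]]] by (simp add: o_def)
  have "pd i (pd j X) x = pd i (\<lambda>y. \<Sum>a\<in>UNIV. J y a j *\<^sub>R pd a Y (\<tau> y)) x"
    by (rule pd_cong[OF XP.open_S x]) (rule pd_X)
  also have "\<dots> = (\<Sum>b\<in>UNIV. J x b j *\<^sub>R pd i (\<lambda>y. pd b Y (\<tau> y)) x + pd i (\<lambda>y. J y b j) x *\<^sub>R pd b Y (\<tau> x))"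
    using x d by (subst pd_sum) (simp_all add: pd_scaleR)
  also have "\<dots> = (\<Sum>b\<in>UNIV. \<Sum>a\<in>UNIV. (J x a i * J x b j) *\<^sub>R pd a (pd b Y) (\<tau> x))
     + (\<Sum>a\<in>UNIV. pd i (\<lambda>y. J y a j) x *\<^sub>R pd a Y (\<tau> x))"
    using x \<tau>_in by (simp add: sum.distrib pd_compose scaleR_sum_right mult.commute)
  finally show ?thesis by (subst sum.swap)
qed

text \<open>The second derivatives of \<open>\<tau>\<close> enter only through combinations of the tangent vectors \<open>pd a Y\<close>, which
  the normal projection annihilates.\<close>

lemma second_ff_pullback:
  assumes x: "x \<in> S"
  shows "second_ff X i j x = (\<Sum>a\<in>UNIV. \<Sum>b\<in>UNIV. (J x a i * J x b j) *\<^sub>R second_ff Y a b (\<tau> x))"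
proof -
  note tx = \<tau>_in[OF x]
  have lin: "linear (normal_proj Y (\<tau> x))" by (rule YP.linear_normal_proj[OF tx])
  show ?thesis
    unfolding XP.second_ff_eq[OF x] YP.second_ff_eq[OF tx] normal_proj_pullback[OF x] pd_pd_X[OF x]
    by (simp add: linear_add[OF lin] linear_sum[OF lin] linear_cmul[OF lin] YP.normal_proj_pd[OF tx])
qed

lemma mean_curv_pullback: "x \<in> S \<Longrightarrow> mean_curv X x = mean_curv Y (\<tau> x)"
  unfolding mean_curv_def by (subst contraction[OF _ second_ff_pullback]) auto

lemma surface_div_pullback:
  assumes x: "x \<in> S" and f: "f differentiable (at (\<tau> x))" "\<And>y. y \<in> S \<Longrightarrow> F y = f (\<tau> y)"
  shows "surface_div X F x = surface_div Y f (\<tau> x)"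
proof -
  have F: "pd i F x = (\<Sum>a\<in>UNIV. J x a i *\<^sub>R pd a f (\<tau> x))" for i
    by (rule pd_pullback[OF x f(1)]) (rule f(2))
  have "surface_div X F x = (\<Sum>i\<in>UNIV. \<Sum>j\<in>UNIV. inv_metric X x $ i $ j * (pd j X x \<bullet> pd i F x))"
    by (simp add: surface_div_def dual_frame_def inner_sum_left)
  also have "\<dots> = (\<Sum>a\<in>UNIV. \<Sum>b\<in>UNIV. inv_metric Y (\<tau> x) $ a $ b * (pd b Y (\<tau> x) \<bullet> pd a f (\<tau> x)))"
  proof (rule contraction_real[OF x])
    show "pd j X x \<bullet> pd i F x = (\<Sum>a\<in>UNIV. \<Sum>b\<in>UNIV. J x a i * J x b j * (pd b Y (\<tau> x) \<bullet> pd a f (\<tau> x)))" for i j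
      unfolding pd_X[OF x] F inner_sum_left unfolding inner_sum_right
      by (subst sum.swap) (simp add: mult_ac)
  qed
  finally show ?thesis by (simp add: surface_div_def dual_frame_def inner_sum_left)
qed

text \<open>The squared norm of a bilinear form contracts four slots; the contraction is carried out in two of them
  with the other two held fixed, and then in the remaining pair.\<close>

lemma bilinear_pullback_square:
  fixes b' :: "4 \<Rightarrow> 4 \<Rightarrow> real"
  assumes x: "x \<in> S" and b: "\<And>i j. b i j = (\<Sum>a\<in>UNIV. \<Sum>c\<in>UNIV. J x a i * J x c j * b' a c)"
  shows "(\<Sum>i\<in>UNIV. \<Sum>j\<in>UNIV. \<Sum>k\<in>UNIV. \<Sum>l\<in>UNIV. inv_metric X x $ i $ k * inv_metric X x $ j $ l * b i j * b k l)
    = (\<Sum>i\<in>UNIV. \<Sum>j\<in>UNIV. \<Sum>k\<in>UNIV. \<Sum>l\<in>UNIV.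
        inv_metric Y (\<tau> x) $ i $ k * inv_metric Y (\<tau> x) $ j $ l * b' i j * b' k l)"
proof -
  have reorder: "(\<Sum>i\<in>UNIV. \<Sum>j\<in>UNIV. \<Sum>k\<in>UNIV. \<Sum>l\<in>UNIV. g $ i $ k * g $ j $ l * b i j * b k l)
     = (\<Sum>i\<in>UNIV. \<Sum>k\<in>UNIV. g $ i $ k * (\<Sum>j\<in>UNIV. \<Sum>l\<in>UNIV. g $ j $ l * (b i j * b k l)))"
    for g :: "real^4^4" and b
    by (subst sum.swap[of _ UNIV UNIV]) (simp add: sum_distrib_left mult.assoc)
  define p where "p i c = (\<Sum>a\<in>UNIV. J x a i * b' a c)" for i c
  have b2: "b i j = (\<Sum>c\<in>UNIV. J x c j * p i c)" for i j
    unfolding b p_def sum_distrib_left by (subst sum.swap) (simp add: mult_ac)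
  have inner: "(\<Sum>j\<in>UNIV. \<Sum>l\<in>UNIV. inv_metric X x $ j $ l * (b i j * b k l))
     = (\<Sum>c\<in>UNIV. \<Sum>d\<in>UNIV. inv_metric Y (\<tau> x) $ c $ d * (p i c * p k d))" for i k
    by (rule contraction_real[OF x]) (simp add: b2 sum_product mult_ac)
  have "(\<Sum>i\<in>UNIV. \<Sum>k\<in>UNIV. inv_metric X x $ i $ k * (\<Sum>c\<in>UNIV. \<Sum>d\<in>UNIV. inv_metric Y (\<tau> x) $ c $ d * (p i c * p k d)))
    = (\<Sum>a\<in>UNIV. \<Sum>e\<in>UNIV. inv_metric Y (\<tau> x) $ a $ e *
        (\<Sum>c\<in>UNIV. \<Sum>d\<in>UNIV. inv_metric Y (\<tau> x) $ c $ d * (b' a c * b' e d)))"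
  proof (rule contraction_real[OF x])
    fix i k
    have "(\<Sum>c\<in>UNIV. \<Sum>d\<in>UNIV. inv_metric Y (\<tau> x) $ c $ d * (p i c * p k d)) =
      (\<Sum>c\<in>UNIV. \<Sum>d\<in>UNIV. \<Sum>a\<in>UNIV. \<Sum>e\<in>UNIV. J x a i * J x e k * (inv_metric Y (\<tau> x) $ c $ d * (b' a c * b' e d)))"
      unfolding p_def sum_product by (simp add: sum_distrib_left mult_ac)
    also have "\<dots> = (\<Sum>a\<in>UNIV. \<Sum>e\<in>UNIV. J x a i * J x e k *
         (\<Sum>c\<in>UNIV. \<Sum>d\<in>UNIV. inv_metric Y (\<tau> x) $ c $ d * (b' a c * b' e d)))"
      by (subst sum_sum_swap) (simp add: sum_distrib_left)
    finally show "(\<Sum>c\<in>UNIV. \<Sum>d\<in>UNIV. inv_metric Y (\<tau> x) $ c $ d * (p i c * p k d)) = \<dots>" .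
  qed
  then show ?thesis unfolding reorder inner .
qed

theorem local_density_pullback:
  assumes x: "x \<in> S"
  shows "local_density X x = local_density Y (\<tau> x)"
proof -
  note tx = \<tau>_in[OF x]
  have lin: "linear (normal_proj Y (\<tau> x))" by (rule YP.linear_normal_proj[OF tx])
  have H: "mean_curv X x = mean_curv Y (\<tau> x)" by (rule mean_curv_pullback[OF x])
  have DH: "normal_proj X x (pd i (mean_curv X) x)
     = (\<Sum>a\<in>UNIV. J x a i *\<^sub>R normal_proj Y (\<tau> x) (pd a (mean_curv Y) (\<tau> x)))" for i
  proof -
    have "pd i (mean_curv X) x = (\<Sum>a\<in>UNIV. J x a i *\<^sub>R pd a (mean_curv Y) (\<tau> x))"
      by (rule pd_pullback[OF x YP.diff_mean_curv[OF tx]]) (rule mean_curv_pullback)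
    then show ?thesis
      by (simp add: normal_proj_pullback[OF x] linear_sum[OF lin] linear_cmul[OF lin])
  qed
  have 1: "(\<Sum>i\<in>UNIV. \<Sum>j\<in>UNIV. inv_metric X x $ i $ j *
       (normal_proj X x (pd i (mean_curv X) x) \<bullet> normal_proj X x (pd j (mean_curv X) x)))
    = (\<Sum>i\<in>UNIV. \<Sum>j\<in>UNIV. inv_metric Y (\<tau> x) $ i $ j *
       (normal_proj Y (\<tau> x) (pd i (mean_curv Y) (\<tau> x)) \<bullet> normal_proj Y (\<tau> x) (pd j (mean_curv Y) (\<tau> x))))"
    by (rule contraction_real[OF x], unfold DH inner_sum_left, unfold inner_sum_right) (simp add: mult_ac)
  have 2: "mean_curv X x \<bullet> second_ff X i j x
      = (\<Sum>a\<in>UNIV. \<Sum>b\<in>UNIV. J x a i * J x b j * (mean_curv Y (\<tau> x) \<bullet> second_ff Y a b (\<tau> x)))" for i j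
    unfolding H second_ff_pullback[OF x] by (simp add: inner_sum_right)
  show ?thesis
    unfolding local_density_def Let_def 1 bilinear_pullback_square[OF x 2] unfolding H ..
qed

end


section \<open>The divergence theorem in a patch\<close>

context patch
begin

lemma C_volume: "C_on k S (\<lambda>x. sqrt (det (metric X x)))"
  by (intro C_on_sqrt C_on_det open_S C_metric det_metric_pos)

lemma pd_volume:
  assumes x: "x \<in> S"
  shows "pd l (\<lambda>y. sqrt (det (metric X y))) x
    = sqrt (det (metric X x)) * (\<Sum>k\<in>UNIV. dual_frame X k x \<bullet> pd l (pd k X) x)"
proof -
  let ?K = "\<Sum>k\<in>UNIV. dual_frame X k x \<bullet> pd l (pd k X) x"
  let ?A = "\<lambda>v. \<chi> i j. \<Sum>k\<in>UNIV. v $ k *\<^sub>R pd k (\<lambda>y. metric X y $ i $ j) x"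
  have nz: "det (metric X x) \<noteq> 0" and pos: "0 < det (metric X x)" using det_metric_pos[OF x] by auto
  have "((\<lambda>y. metric X y $ i $ j) has_derivative (\<lambda>v. ?A v $ i $ j)) (at x)" for i j
    using has_derivative_pd[OF C_on_diffble[OF C_metric x]] by simp
  from has_derivative_det[of "metric X" ?A, OF this nz]
  have det: "((\<lambda>y. det (metric X y)) has_derivative (\<lambda>v. det (metric X x) *
      (\<Sum>i\<in>UNIV. \<Sum>j\<in>UNIV. inv_metric X x $ j $ i * ?A v $ i $ j))) (at x)"
    unfolding inv_metric_def .
  have A: "?A (axis l 1) $ i $ j = pd l (\<lambda>y. metric X y $ i $ j) x" for i j
    by (simp add: axis_def if_distrib[of "\<lambda>t. t * _"] cong: if_cong)
  have "(\<Sum>i\<in>UNIV. \<Sum>j\<in>UNIV. inv_metric X x $ j $ i * ?A (axis l 1) $ i $ j)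
      = (\<Sum>i\<in>UNIV. \<Sum>j\<in>UNIV. inv_metric X x $ j $ i * (pd i X x \<bullet> pd l (pd j X) x))
      + (\<Sum>i\<in>UNIV. \<Sum>j\<in>UNIV. inv_metric X x $ i $ j * (pd j X x \<bullet> pd l (pd i X) x))"
    unfolding A unfolding pd_metric[OF x] by (simp add: distrib_left sum.distrib inner_commute inv_metric_sym[OF x])
  also have "(\<Sum>i\<in>UNIV. \<Sum>j\<in>UNIV. inv_metric X x $ i $ j * (pd j X x \<bullet> pd l (pd i X) x)) = ?K"
    by (simp add: dual_frame_def inner_sum_left)
  also have "(\<Sum>i\<in>UNIV. \<Sum>j\<in>UNIV. inv_metric X x $ j $ i * (pd i X x \<bullet> pd l (pd j X) x)) = ?K"
    by (subst sum.swap) (simp add: dual_frame_def inner_sum_left)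
  finally have tr: "(\<Sum>i\<in>UNIV. \<Sum>j\<in>UNIV. inv_metric X x $ j $ i * ?A (axis l 1) $ i $ j) = ?K + ?K" .
  have "pd l (\<lambda>y. sqrt (det (metric X y))) x = det (metric X x) * (?K + ?K) * (inverse (sqrt (det (metric X x))) / 2)"
    using pd_eqI[OF has_derivative_real_sqrt[OF pos det], of l] unfolding tr .
  also have "\<dots> = (det (metric X x) * inverse (sqrt (det (metric X x)))) * ?K" by simp
  also have "det (metric X x) * inverse (sqrt (det (metric X x))) = sqrt (det (metric X x))"
    using pos by (simp add: divide_inverse[symmetric] real_div_sqrt)
  finally show ?thesis .
qed

text \<open>Let \<open>E\<^sub>i\<close> be the dual frame. Differentiating \<open>E\<^sub>i \<bullet> pd j X = const\<close> gives
  \<open>pd i E\<^sub>i \<bullet> pd j X = - E\<^sub>i \<bullet> pd i (pd j X)\<close>, and for tangent \<open>f\<close> these terms cancel against the derivative of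
  the volume density.\<close>

lemma volume_divergence:
  assumes x: "x \<in> S" and f: "f differentiable (at x)" and tangent: "normal_proj X x (f x) = 0"
  shows "(\<Sum>i\<in>UNIV. pd i (\<lambda>y. sqrt (det (metric X y)) * (dual_frame X i y \<bullet> f y)) x)
       = sqrt (det (metric X x)) * surface_div X f x"
proof -
  let ?w = "sqrt (det (metric X x))" and ?E = "\<lambda>i. dual_frame X i x"
  have w: "(\<lambda>y. sqrt (det (metric X y))) differentiable (at x)"
    by (rule C_on_diffble[OF C_volume x])
  have fx: "f x = (\<Sum>j\<in>UNIV. (?E j \<bullet> f x) *\<^sub>R pd j X x)"
    using tangent by (simp add: normal_proj_eq[OF x])
  have "pd i (\<lambda>y. dual_frame X i y \<bullet> pd j X y) x = 0" for i j
    using pd_cong[OF open_S x, of "\<lambda>y. dual_frame X i y \<bullet> pd j X y" "\<lambda>y. if i = j then 1 else 0" i]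
    by (simp add: dual_frame_pd)
  then have dE: "pd i (dual_frame X i) x \<bullet> pd j X x = - (?E i \<bullet> pd j (pd i X) x)" for i j
    using pd_inner[OF diff_dual_frame[OF x] diff_pd_X[OF x], of i i j] pd_pd_commute[OF x, of i j] by simp
  have dEf: "pd i (dual_frame X i) x \<bullet> f x = - (\<Sum>j\<in>UNIV. (?E j \<bullet> f x) * (?E i \<bullet> pd j (pd i X) x))" for i
    by (subst fx) (simp add: inner_sum_right dE sum_negf)
  have "(\<Sum>i\<in>UNIV. pd i (\<lambda>y. sqrt (det (metric X y)) * (dual_frame X i y \<bullet> f y)) x)
     = (\<Sum>i\<in>UNIV. ?w * (?E i \<bullet> pd i f x) + ?w * (pd i (dual_frame X i) x \<bullet> f x)
         + (\<Sum>k\<in>UNIV. ?w * ((?E k \<bullet> pd i (pd k X) x) * (?E i \<bullet> f x))))"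
    using w f x by (simp add: pd_mult pd_inner pd_volume sum_distrib_left sum_distrib_right distrib_left mult.assoc)
  also have "\<dots> = ?w * surface_div X f x"
    unfolding dEf sum.distrib sum_distrib_left[symmetric] surface_div_def
    using sum.swap[of "\<lambda>i k. (?E k \<bullet> pd i (pd k X) x) * (?E i \<bullet> f x)" UNIV UNIV]
    by (simp add: sum_negf mult.commute)
  finally show ?thesis .
qed

end

text \<open>The difference quotients of \<open>u\<close> in the direction of the \<open>i\<close>-th axis have integral zero because Lebesgue
  measure is translation invariant. They converge to \<open>pd i u\<close> and are bounded, by the mean value theorem,
  by a constant on a fixed ball, so the integrals converge as well.\<close>

lemma integral_pd_compact_support:
  fixes u :: "real^4 \<Rightarrow> real"
  assumes u: "C_on 1 UNIV u" and K: "compact K" "\<And>x. x \<notin> K \<Longrightarrow> u x = 0"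
  shows "has_bochner_integral lborel (pd i u) 0"
proof -
  define e :: "real^4" where "e = axis i 1"
  have ne: "norm e = 1" by (simp add: e_def)
  have diff: "u differentiable (at x)" for x using u by simp
  have contu: "continuous_on UNIV u" using u C_on_continuous by blast
  have contd: "continuous_on UNIV (pd i u)" using C_on_pd[of 0 UNIV u i] u by simp
  have supp: "pd i u x = 0" if "x \<notin> K" for x
    using pd_cong[of "- K" x u "\<lambda>_. 0" i] that K compact_imp_closed by auto
  obtain B where B: "\<And>x. \<bar>pd i u x\<bar> \<le> B"
  proof -
    have "compact (pd i u ` K)" using contd K(1) by (intro compact_continuous_image) (auto intro: continuous_on_subset)
    then obtain B where "\<And>y. y \<in> pd i u ` K \<Longrightarrow> norm y \<le> B" by (meson compact_imp_bounded bounded_iff)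
    then have "\<bar>pd i u x\<bar> \<le> max B 0" for x using supp[of x] by (cases "x \<in> K") force+
    then show ?thesis using that by blast
  qed
  obtain R where R: "\<And>x. x \<in> K \<Longrightarrow> norm x \<le> R" using K(1) by (meson compact_imp_bounded bounded_iff)
  have line: "((\<lambda>t. u (x + t *\<^sub>R e)) has_real_derivative pd i u (x + t *\<^sub>R e)) (at t)" for x t
  proof -
    have "((\<lambda>t. x + t *\<^sub>R e) has_derivative (\<lambda>h. h *\<^sub>R e)) (at t)" by (auto intro!: derivative_eq_intros)
    from diff_chain_at[OF this pd_works[OF diff]]
    have "((\<lambda>t. u (x + t *\<^sub>R e)) has_derivative (\<lambda>h. h * pd i u (x + t *\<^sub>R e))) (at t)"
      using linear_cmul[OF linear_frechet_derivative[OF diff]] by (simp add: o_def pd_def e_def)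
    then show ?thesis by (simp add: has_field_derivative_def mult.commute[of _ "pd i u _"])
  qed
  define h where "h n = inverse (real (Suc n))" for n
  have h: "0 < h n" "h n \<le> 1" for n by (auto simp: h_def field_simps)
  define d where "d n x = (u (x + h n *\<^sub>R e) - u x) / h n" for n x
  have bound: "\<bar>d n x\<bar> \<le> indicator (cball 0 (R + 1)) x * B" for n x
  proof (cases "d n x = 0")
    case True then show ?thesis using B[of x] by (simp add: indicator_def)
  next
    case False
    then have "u x \<noteq> 0 \<or> u (x + h n *\<^sub>R e) \<noteq> 0" by (auto simp: d_def)
    then have "x \<in> K \<or> x + h n *\<^sub>R e \<in> K" using K(2) by blast
    then have "norm x \<le> R + 1"
      using R[of x] R[of "x + h n *\<^sub>R e"] norm_triangle_ineq4[of "x + h n *\<^sub>R e" "h n *\<^sub>R e"] h[of n] ne by auto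
    moreover obtain z where "u (x + h n *\<^sub>R e) - u (x + 0 *\<^sub>R e) = (h n - 0) * pd i u (x + z *\<^sub>R e)"
      using MVT2[of 0 "h n" "\<lambda>t. u (x + t *\<^sub>R e)" "\<lambda>t. pd i u (x + t *\<^sub>R e)"] line h by blast
    then have "d n x = pd i u (x + z *\<^sub>R e)" using h[of n] by (simp add: d_def)
    ultimately show ?thesis using B[of "x + z *\<^sub>R e"] by simp
  qed
  have lim: "(\<lambda>n. d n x) \<longlonglongrightarrow> pd i u x" for x
  proof -
    have "((\<lambda>k. (u (x + k *\<^sub>R e) - u x) / k) \<longlongrightarrow> pd i u x) (at 0)"
      using line[of x 0] by (simp add: DERIV_def)
    moreover have "filterlim h (at 0) sequentially"
    proof -
      have "h \<longlonglongrightarrow> 0" using LIMSEQ_inverse_real_of_nat unfolding h_def[abs_def] .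
      then show ?thesis using h(1) by (auto simp: filterlim_at intro!: always_eventually less_imp_neq[symmetric])
    qed
    ultimately show ?thesis unfolding d_def by (rule filterlim_compose)
  qed
  have intu: "integrable lborel u"
  proof -
    have "integrable lborel (\<lambda>x. indicator K x *\<^sub>R u x)"
      by (rule borel_integrable_compact[OF K(1)]) (auto intro: continuous_on_subset[OF contu])
    also have "(\<lambda>x. indicator K x *\<^sub>R u x) = u" using K(2) by (force simp: indicator_def fun_eq_iff)
    finally show ?thesis .
  qed
  have mu: "u \<in> borel_measurable borel" using contu by (rule borel_measurable_continuous_onI)
  have trans: "integrable lborel (\<lambda>x. u (x + c))" "(\<integral>x. u (x + c) \<partial>lborel) = (\<integral>x. u x \<partial>lborel)" for c
  proof -
    have eq: "distr lborel borel (\<lambda>x. x + c) = lborel"     proof -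
      have "(\<lambda>x. x + c) = (+) c" by (simp add: fun_eq_iff)
      then show ?thesis using lborel_distr_plus[of c] by (simp only:)
    qed
    show "integrable lborel (\<lambda>x. u (x + c))"
      using integrable_distr_eq[of "\<lambda>x. x + c" lborel borel u] mu intu by (simp add: eq)
    show "(\<integral>x. u (x + c) \<partial>lborel) = (\<integral>x. u x \<partial>lborel)"
      using integral_distr[of "\<lambda>x. x + c" lborel borel u] mu by (simp add: eq)
  qed
  have intd: "integrable lborel (d n)" "(\<integral>x. d n x \<partial>lborel) = 0" for n
    unfolding d_def[abs_def] using trans intu by (auto simp: Bochner_Integration.integral_diff)
  have w: "integrable lborel (\<lambda>x::real^4. indicator (cball 0 (R + 1)) x * B)"
    using borel_integrable_compact[of "cball (0::real^4) (R+1)" "\<lambda>_. B"] by simp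
  have meas: "pd i u \<in> borel_measurable lborel" "\<And>n. d n \<in> borel_measurable lborel"
    using contd intd borel_measurable_continuous_onI by (auto dest: borel_measurable_integrable)
  have "integrable lborel (pd i u)"
    by (rule integrable_dominated_convergence[where s=d, OF meas w]) (use lim bound in auto)
  moreover have "(\<lambda>n. \<integral>x. d n x \<partial>lborel) \<longlonglongrightarrow> (\<integral>x. pd i u x \<partial>lborel)"
    by (rule integral_dominated_convergence[where s=d, OF meas w]) (use lim bound in auto)
  ultimately show ?thesis using intd(2) by (simp add: has_bochner_integral_iff LIMSEQ_const_iff)
qed

text \<open>By \<open>volume_divergence\<close> the integrand is a sum of partial derivatives of functions which, extended by
  zero outside \<open>S\<close>, are of class \<open>C\<^sup>1\<close> with compact support on the whole space.\<close>

lemma (in patch) integral_surface_div_compact_support: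
  assumes f: "C_on 1 S f" and tangent: "\<And>x. x \<in> S \<Longrightarrow> normal_proj X x (f x) = 0"
    and K: "compact K" "K \<subseteq> S" "\<And>x. x \<in> S - K \<Longrightarrow> f x = 0"
  shows "has_bochner_integral lborel (\<lambda>x. indicator S x * (sqrt (det (metric X x)) * surface_div X f x)) 0"
proof -
  define u where "u i x = (if x \<in> S then sqrt (det (metric X x)) * (dual_frame X i x \<bullet> f x) else 0)" for i x
  have opK: "open (- K)" using K(1) compact_imp_closed by auto
  have uS: "C_on 1 S (u i)" for i
    by (rule C_on_cong[OF open_S, where f="\<lambda>x. sqrt (det (metric X x)) * (dual_frame X i x \<bullet> f x)"])
      (auto simp: u_def intro!: C_on_mult C_on_inner open_S C_volume C_dual_frame f simp del: C_on.simps One_nat_def)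
  have uK: "C_on 1 (- K) (u i)" for i
    by (rule C_on_cong[OF opK C_on_const[of _ _ 0]]) (use K in \<open>auto simp: u_def\<close>)
  have "C_on 1 UNIV (u i)" for i
  proof (rule C_on_1I)
    show "u i differentiable (at x)" for x using uS[of i] uK[of i] K(2) by (cases "x \<in> K") auto
    have "continuous_on (S \<union> - K) (pd j (u i))" for j
      using C_on_pd[of 0 S "u i" j] C_on_pd[of 0 "- K" "u i" j] uS[of i] uK[of i] open_S opK
      by (intro continuous_on_open_Un) auto
    moreover have "S \<union> - K = UNIV" using K(2) by auto
    ultimately show "continuous_on UNIV (pd j (u i))" for j by simp
  qed auto
  then have "has_bochner_integral lborel (pd i (u i)) 0" for i
    by (rule integral_pd_compact_support[OF _ K(1)]) (use K in \<open>auto simp: u_def\<close>)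
  then have "has_bochner_integral lborel (\<lambda>x. \<Sum>i\<in>UNIV. pd i (u i) x) (\<Sum>i\<in>(UNIV::4 set). 0)"
    by (intro has_bochner_integral_sum)
  moreover have "(\<Sum>i\<in>UNIV. pd i (u i) x) = indicator S x * (sqrt (det (metric X x)) * surface_div X f x)" for x
  proof (cases "x \<in> S")
    case True
    have "pd i (u i) x = pd i (\<lambda>x. sqrt (det (metric X x)) * (dual_frame X i x \<bullet> f x)) x" for i
      by (rule pd_cong[OF open_S True]) (simp add: u_def)
    then show ?thesis using volume_divergence[OF True C_on_diffble[OF f True] tangent[OF True]] True by simp
  next
    case False
    then have "pd i (u i) x = pd i (\<lambda>_. 0) x" for i
      by (intro pd_cong[OF opK]) (use K in \<open>auto simp: u_def\<close>)
    then show ?thesis using False by simp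
  qed
  ultimately show ?thesis by simp
qed


section \<open>Inversion of a patch\<close>

definition inversion :: "'a::real_inner \<Rightarrow> 'a" where
  "inversion y = inverse (y \<bullet> y) *\<^sub>R y"

text \<open>Reflection in the hyperplane orthogonal to \<open>p\<close>. The differential of the inversion at \<open>p\<close> is this map
  divided by \<open>p \<bullet> p\<close>.\<close>

definition reflect :: "'a::real_inner \<Rightarrow> 'a \<Rightarrow> 'a" where
  "reflect p v = v - (2 * (p \<bullet> v) * inverse (p \<bullet> p)) *\<^sub>R p"

lemma linear_reflect: "linear (reflect p)"
  by (rule linearI) (auto simp: reflect_def inner_add_right algebra_simps)

lemma reflect_add: "reflect p (u + v) = reflect p u + reflect p v"
  by (rule linear_add[OF linear_reflect])
lemma reflect_diff: "reflect p (u - v) = reflect p u - reflect p v"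
  by (rule linear_diff[OF linear_reflect])
lemma reflect_scaleR: "reflect p (c *\<^sub>R v) = c *\<^sub>R reflect p v"
  by (rule linear_cmul[OF linear_reflect])
lemma reflect_sum: "reflect p (\<Sum>i\<in>I. f i) = (\<Sum>i\<in>I. reflect p (f i))"
  by (rule linear_sum[OF linear_reflect])

lemma reflect_inner: "p \<noteq> 0 \<Longrightarrow> reflect p u \<bullet> reflect p v = u \<bullet> v"
  by (simp add: reflect_def inner_diff_left inner_diff_right inner_commute field_simps)

lemma reflect_self: "p \<noteq> 0 \<Longrightarrow> reflect p p = - p"
proof -
  assume "p \<noteq> 0"
  then have "2 * (p \<bullet> p) * inverse (p \<bullet> p) = 2" by simp
  then show ?thesis by (simp only: reflect_def) (simp add: scaleR_2)
qed

text \<open>Throughout, \<open>r = 1 / |X|\<^sup>2\<close> is the conformal factor of the inversion along the surface, \<open>N\<close> the normal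
  part of the position vector \<open>X\<close>, and \<open>t i\<close> the covariant components of its tangential part.\<close>

locale punctured_patch = patch +
  assumes nonzero: "x \<in> S \<Longrightarrow> X x \<noteq> 0"
begin

definition r where "r x = inverse (X x \<bullet> X x)"
abbreviation "Xt \<equiv> \<lambda>x. inversion (X x)"
abbreviation "N \<equiv> \<lambda>x. normal_proj X x (X x)"
abbreviation "H \<equiv> mean_curv X"
abbreviation "t \<equiv> \<lambda>i x. X x \<bullet> pd i X x"
abbreviation "h \<equiv> second_ff X"

lemma r_pos: "x \<in> S \<Longrightarrow> 0 < r x" using nonzero by (simp add: r_def)
lemma r_inverse: "x \<in> S \<Longrightarrow> r x * (X x \<bullet> X x) = 1" using nonzero by (simp add: r_def)

lemma C_r: "C_on k S r" unfolding r_def[abs_def]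
  by (intro C_on_inverse C_on_inner open_S C_X) (simp add: nonzero)
lemmas diff_r [simp] = C_on_diffble[OF C_r]

lemma C_N: "C_on k S N" by (rule C_normal_proj[OF C_X])
lemmas diff_N [simp] = C_on_diffble[OF C_N]

lemma Xt_eq: "Xt x = r x *\<^sub>R X x" by (simp add: inversion_def r_def)

lemma C_Xt: "C_on k S Xt" unfolding Xt_eq by (intro C_on_scaleR open_S C_r C_X)

lemma pd_r: assumes x: "x \<in> S" shows "pd i r x = - 2 * t i x * (r x)\<^sup>2"
proof -
  have "pd i r x = - pd i (\<lambda>y. X y \<bullet> X y) x / (X x \<bullet> X x)\<^sup>2"
    unfolding r_def[abs_def] using x nonzero by (intro pd_inverse) auto
  also have "\<dots> = - 2 * t i x * (r x)\<^sup>2"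
    using x by (simp add: pd_inner inner_commute r_def power_inverse divide_inverse)
  finally show ?thesis .
qed

lemma reflect_X: "reflect (X x) v = v - (2 * (X x \<bullet> v) * r x) *\<^sub>R X x"
  by (simp add: reflect_def r_def)

lemma pd_Xt: assumes x: "x \<in> S" shows "pd i Xt x = r x *\<^sub>R reflect (X x) (pd i X x)"
  unfolding Xt_eq using x
  by (simp add: pd_scaleR pd_r reflect_X scaleR_diff_right power2_eq_square mult_ac)

lemma pd_pd_Xt:
  assumes x: "x \<in> S"
  shows "pd i (pd j Xt) x = reflect (X x) (r x *\<^sub>R pd i (pd j X) x + (2 * (r x)\<^sup>2 * metric X x $ i $ j) *\<^sub>R X x
     - (2 * t i x * (r x)\<^sup>2) *\<^sub>R pd j X x - (2 * t j x * (r x)\<^sup>2) *\<^sub>R pd i X x)"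
proof -

  have "pd i (pd j Xt) x = pd i (\<lambda>y. r y *\<^sub>R pd j X y - (2 * (t j y * (r y * r y))) *\<^sub>R X y) x"
    by (rule pd_cong[OF open_S x]) (simp add: pd_Xt reflect_X scaleR_diff_right mult_ac)
  also have "\<dots> = r x *\<^sub>R pd i (pd j X) x - (2 * t i x * (r x)\<^sup>2) *\<^sub>R pd j X x
     - (2 * ((pd i X x \<bullet> pd j X x + X x \<bullet> pd i (pd j X) x) * (r x)\<^sup>2 - 4 * t j x * t i x * (r x)^3)) *\<^sub>R X x
     - (2 * t j x * (r x)\<^sup>2) *\<^sub>R pd i X x"
    using x by (simp add: pd_diff pd_scaleR pd_mult pd_inner pd_r power2_eq_square power3_eq_cube)
      (simp add: algebra_simps)
  also have "\<dots> = reflect (X x) (r x *\<^sub>R pd i (pd j X) x + (2 * (r x)\<^sup>2 * metric X x $ i $ j) *\<^sub>R X x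
     - (2 * t i x * (r x)\<^sup>2) *\<^sub>R pd j X x - (2 * t j x * (r x)\<^sup>2) *\<^sub>R pd i X x)"
    unfolding reflect_add reflect_diff reflect_scaleR reflect_self[OF nonzero[OF x]] metric_entry
    by (rule vector_eq_ldot[THEN iffD1], rule allI)
      (simp only: reflect_X inner_diff_right inner_add_right inner_scaleR_right inner_minus_right,
       simp add: algebra_simps power2_eq_square power3_eq_cube)
  finally show ?thesis .
qed

lemma metric_Xt: "x \<in> S \<Longrightarrow> metric Xt x = (r x)\<^sup>2 *\<^sub>R metric X x"
  by (simp add: vec_eq_iff metric_def pd_Xt reflect_inner[OF nonzero] power2_eq_square)

lemma patch_Xt: "patch S Xt"
proof
  show "open S" by (rule open_S)
  show "smooth_on S Xt" by (intro smooth_onI C_Xt)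
  show "inj (frechet_derivative Xt (at x))" if x: "x \<in> S" for x
    by (rule inj_frechet_derivative_if_det_metric[OF C_on_diffble[OF C_Xt x]])
      (use det_metric_pos[OF x] r_pos[OF x] in \<open>simp add: metric_Xt[OF x] det_scaleR\<close>)
qed

lemma inv_metric_Xt:
  assumes x: "x \<in> S"
  shows "inv_metric Xt x $ i $ j = (inverse (r x))\<^sup>2 * inv_metric X x $ i $ j"
proof -
  have "inv_metric Xt x = inverse ((r x)\<^sup>2) *\<^sub>R inv_metric X x"
    unfolding inv_metric_def metric_Xt[OF x] using det_metric_pos[OF x] r_pos[OF x]
    by (intro matrix_inv_scaleR) auto
  then show ?thesis by (simp add: power_inverse)
qed

text \<open>The reflection in the hyperplane orthogonal to \<open>X x\<close> carries the tangent space of \<open>X\<close> at \<open>x\<close> to that of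
  the inverted surface, hence normal spaces to normal spaces.\<close>

lemma normal_proj_Xt:
  assumes x: "x \<in> S"
  shows "normal_proj Xt x (reflect (X x) v) = reflect (X x) (normal_proj X x v)"
proof (rule normal_proj_eqI)
  show "Xt differentiable (at x)" by (rule C_on_diffble[OF C_Xt x])
  show "reflect (X x) (normal_proj X x v) \<bullet> pd i Xt x = 0" for i
    by (simp add: pd_Xt[OF x] reflect_inner[OF nonzero[OF x]] normal_proj_pd_inner[OF x])
  have "reflect (X x) v - reflect (X x) (normal_proj X x v)
      = reflect (X x) (\<Sum>i\<in>UNIV. (dual_frame X i x \<bullet> v) *\<^sub>R pd i X x)"
    unfolding reflect_diff[symmetric] by (simp add: normal_proj_eq[OF x])
  then show "reflect (X x) v - reflect (X x) (normal_proj X x v)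
      = (\<Sum>i\<in>UNIV. ((dual_frame X i x \<bullet> v) * inverse (r x)) *\<^sub>R pd i Xt x)"
    using less_imp_neq[OF r_pos[OF x]] by (simp add: pd_Xt[OF x] reflect_sum reflect_scaleR mult.assoc)
qed

lemma second_ff_Xt:
  assumes x: "x \<in> S"
  shows "second_ff Xt i j x = reflect (X x) (r x *\<^sub>R (h i j x + (2 * r x * metric X x $ i $ j) *\<^sub>R N x))"
proof -
  interpret XT: patch S Xt by (rule patch_Xt)
  note lin = linear_normal_proj[OF x]
  show ?thesis
    unfolding XT.second_ff_eq[OF x] pd_pd_Xt[OF x] normal_proj_Xt[OF x]
    by (simp add: linear_add[OF lin] linear_diff[OF lin] linear_cmul[OF lin] normal_proj_pd[OF x]
      second_ff_eq[OF x] scaleR_add_right power2_eq_square mult_ac)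
qed

lemma inv_metric_metric_trace: "x \<in> S \<Longrightarrow> (\<Sum>i\<in>UNIV. \<Sum>j\<in>UNIV. inv_metric X x $ i $ j * metric X x $ i $ j) = 4"
proof -
  assume x: "x \<in> S"
  have "(\<Sum>j\<in>UNIV. inv_metric X x $ i $ j * metric X x $ i $ j) = (inv_metric X x ** metric X x) $ i $ i" for i
    by (simp add: matrix_matrix_mult_def metric_sym[of x i])
  then show ?thesis by (simp add: metric_inv[OF x] mat_def)
qed

lemma mean_curv_Xt:
  assumes x: "x \<in> S"
  shows "mean_curv Xt x = reflect (X x) ((X x \<bullet> X x) *\<^sub>R H x + 2 *\<^sub>R N x)"
proof -
  have 4: "(\<Sum>i\<in>UNIV. \<Sum>j\<in>UNIV. inv_metric X x $ i $ j *\<^sub>R h i j x) = 4 *\<^sub>R H x"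
    by (simp add: mean_curv_def)
  have "(\<Sum>i\<in>UNIV. \<Sum>j\<in>UNIV. inv_metric Xt x $ i $ j *\<^sub>R second_ff Xt i j x)
     = reflect (X x) ((inverse (r x))\<^sup>2 *\<^sub>R (r x *\<^sub>R ((\<Sum>i\<in>UNIV. \<Sum>j\<in>UNIV. inv_metric X x $ i $ j *\<^sub>R h i j x)
        + (2 * r x * (\<Sum>i\<in>UNIV. \<Sum>j\<in>UNIV. inv_metric X x $ i $ j * metric X x $ i $ j)) *\<^sub>R N x)))"
    unfolding inv_metric_Xt[OF x] second_ff_Xt[OF x]
    by (simp add: reflect_sum[symmetric] reflect_scaleR[symmetric] scaleR_sum_right scaleR_sum_left
        sum_distrib_left sum.distrib scaleR_add_right mult_ac)
  also have "\<dots> = reflect (X x) (4 *\<^sub>R ((X x \<bullet> X x) *\<^sub>R H x + 2 *\<^sub>R N x))"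
  proof -
    have "(inverse (r x))\<^sup>2 * r x = X x \<bullet> X x" "(inverse (r x))\<^sup>2 * (r x * r x) = 1"
      using nonzero[OF x] by (simp_all add: r_def power2_eq_square field_simps)
    moreover have "(inverse (r x))\<^sup>2 *\<^sub>R (r x *\<^sub>R (4 *\<^sub>R H x + (2 * r x * 4) *\<^sub>R N x))
      = (4 * ((inverse (r x))\<^sup>2 * r x)) *\<^sub>R H x + (8 * ((inverse (r x))\<^sup>2 * (r x * r x))) *\<^sub>R N x"
      by (simp add: scaleR_add_right mult_ac)
    ultimately show ?thesis unfolding 4 inv_metric_metric_trace[OF x]
      by (simp add: scaleR_add_right)
  qed
  finally show ?thesis unfolding mean_curv_def[of Xt] by (simp add: reflect_scaleR)
qed

lemma normal_proj_pd_N: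
  assumes x: "x \<in> S"
  shows "normal_proj X x (pd i N x) = - (\<Sum>k\<in>UNIV. (dual_frame X k x \<bullet> X x) *\<^sub>R h i k x)"
proof -
  note lin = linear_normal_proj[OF x]
  have d: "(\<lambda>y. dual_frame X k y \<bullet> X y) differentiable (at x)" for k using x by simp
  have "pd i N x = pd i (\<lambda>y. X y - (\<Sum>k\<in>UNIV. (dual_frame X k y \<bullet> X y) *\<^sub>R pd k X y)) x"
    by (rule pd_cong[OF open_S x]) (rule normal_proj_eq)
  also have "\<dots> = pd i X x - (\<Sum>k\<in>UNIV. (dual_frame X k x \<bullet> X x) *\<^sub>R pd i (pd k X) x
      + pd i (\<lambda>y. dual_frame X k y \<bullet> X y) x *\<^sub>R pd k X x)"
    using x d by (simp add: pd_diff pd_sum pd_scaleR)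
  finally show ?thesis
    by (simp add: linear_diff[OF lin] linear_sum[OF lin] linear_add[OF lin] linear_cmul[OF lin]
      normal_proj_pd[OF x] second_ff_eq[OF x])
qed

text \<open>The mean curvature of the inverted surface is the reflection of the normal field \<open>W = |X|\<^sup>2 H + 2 N\<close>. The
  reflection varies with the point, but as \<open>W\<close> is normal, differentiating it contributes only the
  reflection of a multiple of \<open>pd i X\<close>, which is tangent. So the normal derivative of the reflected field
  is the reflection of the normal derivative of \<open>W\<close>.\<close>

lemma normal_proj_pd_mean_curv_Xt:
  assumes x: "x \<in> S"
  shows "normal_proj Xt x (pd i (mean_curv Xt) x)
    = reflect (X x) ((X x \<bullet> X x) *\<^sub>R normal_proj X x (pd i H x) + (2 * t i x) *\<^sub>R H x
        - 2 *\<^sub>R (\<Sum>k\<in>UNIV. (dual_frame X k x \<bullet> X x) *\<^sub>R h i k x))"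
proof -
  note lin = linear_normal_proj[OF x]
  define W where "W y = (X y \<bullet> X y) *\<^sub>R H y + 2 *\<^sub>R N y" for y
  have dW: "W differentiable (at x)" unfolding W_def[abs_def] using x by (auto intro!: derivative_intros)
  have W: "W x \<bullet> pd i X x = 0" for i
    by (simp add: W_def inner_add_left mean_curv_pd_inner[OF x] normal_proj_pd_inner[OF x])
  have "pd i (mean_curv Xt) x = pd i (\<lambda>y. W y - (2 * ((X y \<bullet> W y) * r y)) *\<^sub>R X y) x"
    by (rule pd_cong[OF open_S x]) (simp add: mean_curv_Xt W_def[symmetric] reflect_X mult.assoc)
  also have "\<dots> = pd i W x - (2 * ((X x \<bullet> pd i W x + pd i X x \<bullet> W x) * r x
        + (X x \<bullet> W x) * pd i r x)) *\<^sub>R X x - (2 * ((X x \<bullet> W x) * r x)) *\<^sub>R pd i X x"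
    using x dW by (simp add: pd_diff pd_scaleR pd_mult pd_inner algebra_simps)
  also have "\<dots> = reflect (X x) (pd i W x - (2 * ((X x \<bullet> W x) * r x)) *\<^sub>R pd i X x)"
    unfolding pd_r[OF x] reflect_diff reflect_scaleR inner_commute[of "pd i X x"] W
    by (simp add: reflect_X algebra_simps power2_eq_square)
  finally have "normal_proj Xt x (pd i (mean_curv Xt) x) = reflect (X x) (normal_proj X x (pd i W x))"
    by (simp add: normal_proj_Xt[OF x] linear_diff[OF lin] linear_cmul[OF lin] normal_proj_pd[OF x])
  also have "pd i W x = (X x \<bullet> X x) *\<^sub>R pd i H x + (2 * t i x) *\<^sub>R H x + 2 *\<^sub>R pd i N x"
    unfolding W_def[abs_def] using x
    by (subst pd_add) (auto simp: pd_scaleR pd_inner inner_commute intro!: derivative_intros)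
  finally show ?thesis
    by (simp add: linear_add[OF lin] linear_cmul[OF lin] normal_proj_pd_N[OF x]
      normal_proj_normal[OF x mean_curv_pd_inner[OF x]])
qed

end


section \<open>The change of the energy density under inversion\<close>

text \<open>The covector \<open>j \<mapsto> t\<^sup>l (Q \<bullet> h\<^sub>l\<^sub>j)\<close>: the shape operator in the direction \<open>Q\<close>, applied to the tangential
  part \<open>t\<close> of the position vector.\<close>

definition shape_coeff :: "(real^4 \<Rightarrow> real^'m::finite) \<Rightarrow> (real^'m) \<Rightarrow> real^4 \<Rightarrow> 4 \<Rightarrow> real" where
  "shape_coeff X Q x j = (\<Sum>k\<in>UNIV. \<Sum>l\<in>UNIV. inv_metric X x $ k $ l * ((X x \<bullet> pd k X x) * (Q \<bullet> second_ff X l j x)))"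

text \<open>Up to the scaling of the volume element, inversion changes the energy density by the divergence of
  this tangent field.

  The coefficients are found as follows. The new density contains \<open>-4 r t\<^sup>k (h\<^sub>i\<^sub>k \<bullet> \<partial>\<^sup>iH)\<close>, a cross term of
  \<open>|\<pi> \<partial>H + 2 r t H - 2 r t h|\<^sup>2\<close>, and the divergence of \<open>-4 r S\<^sub>H t\<close>, with \<open>S\<close> the shape operator, contains the
  same term. By the Codazzi equation this divergence also contains multiples of \<open>t \<bullet> \<partial>|H|\<^sup>2\<close>, which a multiple
  of \<open>r |H|\<^sup>2 t\<close> corrects. What is left has no derivative of \<open>H\<close>. It is the Bochner expression
  \<open>|\<nabla>t|\<^sup>2 + Ric(t,t) - (div t)\<^sup>2\<close>, weighted by \<open>-4 r\<^sup>2\<close>, plus a polynomial in \<open>r\<close>, \<open>N \<bullet> H\<close> and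
  \<open>|N|\<^sup>2\<close>, and the whole is the divergence of \<open>-4 r\<^sup>2 (\<nabla>\<^sub>t t - (div t) t) - 8 r\<^sup>3 |t|\<^sup>2 t\<close>. Substituting
  \<open>\<nabla>\<^sub>t t = t + S\<^sub>N t\<close>, \<open>div t = 4 + 4 N \<bullet> H\<close> and \<open>|t|\<^sup>2 = 1/r - |N|\<^sup>2\<close> gives the formula.\<close>

definition defect_field :: "(real^4 \<Rightarrow> real^'m::finite) \<Rightarrow> real^4 \<Rightarrow> real^'m" where
  "defect_field X x = (let r = inverse (X x \<bullet> X x); N = normal_proj X x (X x); H = mean_curv X x in
     (- (4 * r)) *\<^sub>R (\<Sum>i\<in>UNIV. \<Sum>j\<in>UNIV. inv_metric X x $ i $ j *\<^sub>R (shape_coeff X (H + r *\<^sub>R N) x j *\<^sub>R pd i X x))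
     + (10 * r * (H \<bullet> H) + 16 * r\<^sup>2 * (N \<bullet> H) + 4 * r\<^sup>2 + 8 * r^3 * (N \<bullet> N)) *\<^sub>R (X x - N))"

lemma (in reparametrization) defect_field_pullback:
  assumes x: "x \<in> S"
  shows "defect_field X x = defect_field Y (\<tau> x)"
proof -
  have sc: "shape_coeff X Q x j = (\<Sum>b\<in>UNIV. J x b j * shape_coeff Y Q (\<tau> x) b)" for Q j
  proof -
    have "shape_coeff X Q x j = (\<Sum>a\<in>UNIV. \<Sum>c\<in>UNIV. inv_metric Y (\<tau> x) $ a $ c *
       ((Y (\<tau> x) \<bullet> pd a Y (\<tau> x)) * (\<Sum>b\<in>UNIV. J x b j * (Q \<bullet> second_ff Y c b (\<tau> x)))))"
      unfolding shape_coeff_def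
    proof (rule contraction_real[OF x])
      show "X x \<bullet> pd k X x * (Q \<bullet> second_ff X l j x) = (\<Sum>a\<in>UNIV. \<Sum>c\<in>UNIV. J x a k * J x c l *
          (Y (\<tau> x) \<bullet> pd a Y (\<tau> x) * (\<Sum>b\<in>UNIV. J x b j * (Q \<bullet> second_ff Y c b (\<tau> x)))))" for k l
      proof -
        have 1: "X x \<bullet> pd k X x = (\<Sum>a\<in>UNIV. J x a k * (Y (\<tau> x) \<bullet> pd a Y (\<tau> x)))"
          by (simp add: X_eq[OF x] pd_X[OF x] inner_sum_right)
        have 2: "Q \<bullet> second_ff X l j x = (\<Sum>c\<in>UNIV. J x c l * (\<Sum>b\<in>UNIV. J x b j * (Q \<bullet> second_ff Y c b (\<tau> x))))"
          by (simp add: second_ff_pullback[OF x] inner_sum_right sum_distrib_left mult_ac)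
        show ?thesis unfolding 1 2 sum_product by (simp add: mult_ac)
      qed
    qed
    also have "\<dots> = (\<Sum>b\<in>UNIV. J x b j * shape_coeff Y Q (\<tau> x) b)"
      unfolding shape_coeff_def sum_distrib_left
      by (subst (2) sum.swap, subst (3) sum.swap) (simp add: mult_ac)
    finally show ?thesis .
  qed
  have "(\<Sum>i\<in>UNIV. \<Sum>j\<in>UNIV. inv_metric X x $ i $ j *\<^sub>R (shape_coeff X Q x j *\<^sub>R pd i X x))
    = (\<Sum>a\<in>UNIV. \<Sum>b\<in>UNIV. inv_metric Y (\<tau> x) $ a $ b *\<^sub>R (shape_coeff Y Q (\<tau> x) b *\<^sub>R pd a Y (\<tau> x)))" for Q
    by (rule contraction[OF x])
      (simp add: sc pd_X[OF x] scaleR_sum_left scaleR_sum_right sum_distrib_left sum_distrib_right mult_ac)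
  then show ?thesis
    by (simp add: defect_field_def Let_def mean_curv_pullback[OF x] normal_proj_pullback[OF x] X_eq[OF x])
qed

context punctured_patch
begin

abbreviation "Q \<equiv> \<lambda>x. H x + r x *\<^sub>R N x"
abbreviation "f \<equiv> \<lambda>x. 10 * r x * (H x \<bullet> H x) + 16 * (r x)\<^sup>2 * (N x \<bullet> H x) + 4 * (r x)\<^sup>2 + 8 * (r x)^3 * (N x \<bullet> N x)"

lemma C_Q: "C_on k S Q" by (intro C_on_add C_on_scaleR open_S C_mean_curv C_r C_N)
lemma C_f: "C_on k S f"
  by (intro C_on_add C_on_scaleR C_on_mult C_on_power C_on_inner C_on_const open_S C_mean_curv C_r C_N)
lemmas diff_Q [simp] = C_on_diffble[OF C_Q]
lemmas diff_f [simp] = C_on_diffble[OF C_f]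

lemma Q_pd_inner: "x \<in> S \<Longrightarrow> Q x \<bullet> pd k X x = 0"
  by (simp add: inner_add_left mean_curv_pd_inner normal_proj_pd_inner)

lemma shape_coeff_eq:
  assumes x: "x \<in> S"
  shows "shape_coeff X (Q x) x j = (\<Sum>l\<in>UNIV. (X x \<bullet> dual_frame X l x) * (Q x \<bullet> pd l (pd j X) x))"
proof -
  have "Q x \<bullet> second_ff X l j x = Q x \<bullet> pd l (pd j X) x" for l
    unfolding second_ff_eq[OF x] by (rule inner_normal_proj[OF x Q_pd_inner[OF x]])
  then show ?thesis unfolding shape_coeff_def
    by (subst sum.swap) (simp add: dual_frame_def inner_sum_right sum_distrib_right inv_metric_sym[OF x] mult_ac)
qed

lemma defect_field_eq:
  assumes x: "x \<in> S"
  shows "defect_field X x = (\<Sum>j\<in>UNIV. (- 4 * r x *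
      (\<Sum>l\<in>UNIV. (X x \<bullet> dual_frame X l x) * (Q x \<bullet> pd l (pd j X) x))) *\<^sub>R dual_frame X j x) + f x *\<^sub>R (X x - N x)"
proof -
  have "(\<Sum>i\<in>UNIV. \<Sum>j\<in>UNIV. inv_metric X x $ i $ j *\<^sub>R (c j *\<^sub>R pd i X x)) = (\<Sum>j\<in>UNIV. c j *\<^sub>R dual_frame X j x)" for c
    by (subst sum.swap) (simp add: dual_frame_def scaleR_sum_right mult.commute inv_metric_sym[OF x])
  then show ?thesis
    unfolding defect_field_def Let_def r_def[symmetric] shape_coeff_eq[OF x]
    by (simp add: scaleR_sum_right mult.assoc sum_negf)
qed

lemma C_defect_field: "C_on k S (defect_field X)"
  by (rule C_on_cong[OF open_S _ defect_field_eq[symmetric]])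
    (intro C_on_add C_on_sum C_on_scaleR C_on_mult C_on_inner C_on_diff C_on_const C_on_power open_S C_mean_curv
      C_r C_N C_X C_dual_frame C_pd_pd_X)

lemma defect_field_tangent:
  assumes x: "x \<in> S" shows "normal_proj X x (defect_field X x) = 0"
proof -
  note lin = linear_normal_proj[OF x]
  have "normal_proj X x (N x) = N x" by (rule normal_proj_normal[OF x normal_proj_pd_inner[OF x]])
  then show ?thesis unfolding defect_field_def Let_def
    by (simp add: linear_add[OF lin] linear_diff[OF lin] linear_sum[OF lin] linear_cmul[OF lin]
      linear_neg[OF lin] normal_proj_pd[OF x])
qed

end

text \<open>A point at which the coordinates are normal: the coordinate frame is orthonormal and the Christoffel
  symbols vanish. There the inverse metric and the dual frame agree with the metric and the frame, and
  the first derivatives of the inverse metric are zero.\<close>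

locale normal_point = punctured_patch +
  fixes x
  assumes x: "x \<in> S"
    and orthonormal: "\<And>i j. pd i X x \<bullet> pd j X x = (if i = j then 1 else 0)"
    and second_normal: "\<And>i j k. pd i (pd j X) x \<bullet> pd k X x = 0"
begin

lemma inv_metric_x: "inv_metric X x = mat 1"
  unfolding inv_metric_def
  by (rule matrix_inv_unique) (simp_all add: vec_eq_iff metric_entry orthonormal matrix_matrix_mult_def mat_def
    if_distrib[of "\<lambda>t. t * _"] cong: if_cong)

lemma dual_x: "dual_frame X i x = pd i X x"
  by (simp add: dual_frame_def inv_metric_x mat_def if_distrib[of "\<lambda>t. t *\<^sub>R _"] cong: if_cong)

lemma inv_metric_scaleR: "inv_metric X x $ i $ j *\<^sub>R (v::'v::real_vector) = (if i = j then v else 0)"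
  by (simp add: inv_metric_x mat_def)

lemma inv_metric_sum: "(\<Sum>j\<in>UNIV. inv_metric X x $ i $ j * B j) = (B i :: real)"
  using inv_metric_scaleR[where 'v=real] by simp

lemma trace_x: "(\<Sum>i\<in>UNIV. \<Sum>j\<in>UNIV. inv_metric X x $ i $ j *\<^sub>R (B i j :: 'v::real_vector)) = (\<Sum>i\<in>UNIV. B i i)"
  by (simp add: inv_metric_scaleR)

lemma trace_x_real: "(\<Sum>i\<in>UNIV. \<Sum>j\<in>UNIV. inv_metric X x $ i $ j * B i j) = (\<Sum>i\<in>UNIV. (B i i :: real))"
  using trace_x[of B] by simp

lemma h_x: "h i j x = pd i (pd j X) x"
  unfolding second_ff_eq[OF x] by (rule normal_proj_normal[OF x]) (rule second_normal)

lemma h_sum: "(\<Sum>i\<in>UNIV. h i i x) = 4 *\<^sub>R H x"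
  by (simp add: mean_curv_def trace_x)

lemma pd_dual_pd: "pd i (dual_frame X j) x \<bullet> pd k X x = 0"
proof -
  have "pd i (\<lambda>y. dual_frame X j y \<bullet> pd k X y) x = pd i (\<lambda>y. if j = k then 1 else 0) x"
    by (rule pd_cong[OF open_S x]) (rule dual_frame_pd)
  then show ?thesis using x
    by (simp add: pd_inner dual_x inner_commute[of "pd j X x"] second_normal)
qed

lemma pd_inv_metric_x: "pd i (\<lambda>y. inv_metric X y $ j $ k) x = 0"
proof -
  have "pd i (\<lambda>y. inv_metric X y $ j $ k) x = pd i (\<lambda>y. dual_frame X j y \<bullet> dual_frame X k y) x"
    by (rule pd_cong[OF open_S x]) (rule dual_frame_dual_frame[symmetric])
  then show ?thesis using x
    by (simp add: pd_inner dual_x pd_dual_pd inner_commute[of "pd j X x"])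
qed

lemma pd_dual_x: "pd i (dual_frame X j) x = h i j x"
proof -
  have "pd i (\<lambda>y. \<Sum>k\<in>UNIV. inv_metric X y $ j $ k *\<^sub>R pd k X y) x = pd i (pd j X) x"
    using x by (simp add: pd_sum pd_scaleR pd_inv_metric_x inv_metric_x mat_def if_distrib[of "\<lambda>t. t *\<^sub>R _"] cong: if_cong)
  then show ?thesis by (simp add: dual_frame_def[abs_def] h_x)
qed

lemma X_h: "X x \<bullet> h i j x = N x \<bullet> h i j x"
  by (simp add: normal_proj_eq[OF x] inner_diff_left inner_sum_left h_x inner_commute[of "pd _ X x"] second_normal)

text \<open>The traced Codazzi equation. At a normal point the covariant derivatives of the second fundamental form
  are the normal parts of the third derivatives of \<open>X\<close>, and these are symmetric.\<close>

lemma codazzi_trace: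
  assumes n: "\<And>k. n \<bullet> pd k X x = 0"
  shows "(\<Sum>i\<in>UNIV. n \<bullet> pd i (pd l (pd i X)) x) = 4 * (n \<bullet> pd l H x)"
proof -
  have "pd l (h i i) x = pd l (\<lambda>y. pd i (pd i X) y - (\<Sum>k\<in>UNIV. (dual_frame X k y \<bullet> pd i (pd i X) y) *\<^sub>R pd k X y)) x" for i
    by (rule pd_cong[OF open_S x]) (simp add: second_ff_eq normal_proj_eq)
  also have "\<dots> i = pd l (pd i (pd i X)) x - (\<Sum>k\<in>UNIV. pd l (\<lambda>y. dual_frame X k y \<bullet> pd i (pd i X) y) x *\<^sub>R pd k X x)" for i
  proof -
    have d: "(\<lambda>y. dual_frame X k y \<bullet> pd i (pd i X) y) differentiable (at x)" for k using x by simp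
    show ?thesis
      using x d by (simp add: pd_diff pd_sum pd_scaleR dual_x inner_commute[of "pd _ X x"] second_normal)
  qed
  finally have "n \<bullet> pd l (h i i) x = n \<bullet> pd l (pd i (pd i X)) x" for i
    by (simp add: inner_diff_right inner_sum_right n)
  moreover have "pd l (pd i (pd i X)) x = pd i (pd l (pd i X)) x" for i
    by (rule pd_commute[OF open_S x C_pd_X])
  moreover have "4 * (n \<bullet> pd l H x) = (\<Sum>i\<in>UNIV. n \<bullet> pd l (h i i) x)"
  proof -
    have d: "(\<lambda>y. inv_metric X y $ i $ j *\<^sub>R h i j y) differentiable (at x)" for i j using x by simp
    have "pd l H x = pd l (\<lambda>y. (1/4::real) *\<^sub>R (\<Sum>i\<in>UNIV. \<Sum>j\<in>UNIV. inv_metric X y $ i $ j *\<^sub>R h i j y)) x"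
      by (simp add: mean_curv_def[abs_def])
    also have "\<dots> = (1/4) *\<^sub>R (\<Sum>i\<in>UNIV. \<Sum>j\<in>UNIV. inv_metric X x $ i $ j *\<^sub>R pd l (h i j) x)"
      using x d by (simp add: pd_scaleR[where f="\<lambda>_. 1/4"] pd_sum pd_scaleR pd_inv_metric_x)
    finally show ?thesis by (simp add: trace_x inner_sum_right)
  qed
  ultimately show ?thesis by simp
qed

abbreviation "D \<equiv> \<lambda>i. normal_proj X x (pd i H x)"
definition w where "w i = (\<Sum>k\<in>UNIV. t k x *\<^sub>R h i k x)"

lemma inner_pd_H: "(\<And>k. n \<bullet> pd k X x = 0) \<Longrightarrow> n \<bullet> pd i H x = n \<bullet> D i"
  by (rule inner_normal_proj[OF x, symmetric])

lemma inner_pd_N: assumes "\<And>k. n \<bullet> pd k X x = 0" shows "n \<bullet> pd i N x = - (n \<bullet> w i)"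
  using inner_normal_proj[OF x assms, of "pd i N x"]
  by (simp add: normal_proj_pd_N[OF x] w_def dual_x inner_commute[of "X x"])

lemma norm_N: "N x \<bullet> N x = X x \<bullet> X x - (\<Sum>i\<in>UNIV. (t i x)\<^sup>2)"
proof -
  have "N x \<bullet> N x = N x \<bullet> X x" by (rule inner_normal_proj[OF x normal_proj_pd_inner[OF x]])
  also have "\<dots> = X x \<bullet> X x - (\<Sum>i\<in>UNIV. (t i x)\<^sup>2)"
    unfolding normal_proj_eq[OF x]
    by (simp add: inner_diff_left inner_sum_left dual_x inner_commute[of "pd _ X x" "X x"] power2_eq_square)
  finally show ?thesis .
qed

lemma pd_f: "pd i f x = 20 * r x * (H x \<bullet> D i) - 20 * (r x)\<^sup>2 * t i x * (H x \<bullet> H x)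
   + 16 * (r x)\<^sup>2 * (N x \<bullet> D i - H x \<bullet> w i) - 64 * (r x)^3 * t i x * (N x \<bullet> H x)
   - 16 * (r x)^3 * t i x - 16 * (r x)^3 * (N x \<bullet> w i) - 48 * (r x)^4 * t i x * (N x \<bullet> N x)"
proof -
  have HN: "H x \<bullet> pd k X x = 0" "N x \<bullet> pd k X x = 0" for k
    by (rule mean_curv_pd_inner[OF x], rule normal_proj_pd_inner[OF x])
  have e: "pd i (\<lambda>y. H y \<bullet> H y) x = 2 * (H x \<bullet> D i)" "pd i (\<lambda>y. N y \<bullet> H y) x = N x \<bullet> D i - H x \<bullet> w i"
    "pd i (\<lambda>y. N y \<bullet> N y) x = - 2 * (N x \<bullet> w i)"
    using x HN by (simp_all add: pd_inner inner_pd_H inner_pd_N inner_commute[of "pd i _ x"])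
  have d: "(\<lambda>y. H y \<bullet> H y) differentiable (at x)" "(\<lambda>y. N y \<bullet> H y) differentiable (at x)"
     "(\<lambda>y. N y \<bullet> N y) differentiable (at x)" using x by simp_all
  have "pd i (\<lambda>x. 10 * (r x * (H x \<bullet> H x)) + 16 * (r x * (r x * (N x \<bullet> H x))) + 4 * (r x * r x)
        + 8 * (r x * (r x * (r x * (N x \<bullet> N x))))) x
    = 10 * (r x * pd i (\<lambda>y. H y \<bullet> H y) x + pd i r x * (H x \<bullet> H x))
    + 16 * (2 * r x * pd i r x * (N x \<bullet> H x) + (r x)\<^sup>2 * pd i (\<lambda>y. N y \<bullet> H y) x) + 8 * r x * pd i r x
    + 8 * (3 * (r x)\<^sup>2 * pd i r x * (N x \<bullet> N x) + (r x)^3 * pd i (\<lambda>y. N y \<bullet> N y) x)"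
    using x d by (simp add: pd_add pd_mult) (simp add: algebra_simps power2_eq_square power3_eq_cube)
  then show ?thesis unfolding e pd_r[OF x]
    by (simp add: algebra_simps power2_eq_square power3_eq_cube power4_eq_xxxx)
qed

text \<open>Since the dual frame is orthonormal at \<open>x\<close> and its derivatives are normal there, the divergence of
  \<open>\<Sum>j. \<alpha> j E\<^sub>j\<close> is \<open>\<Sum>j. pd j (\<alpha> j)\<close>. The only third derivatives of \<open>X\<close> that occur are those which the traced Codazzi
  equation turns into derivatives of \<open>H\<close>.\<close>

lemma surface_div_defect_field:
  "surface_div X (defect_field X) x =
    - 4 * r x * (4 * (Q x \<bullet> H x) + (\<Sum>i\<in>UNIV. \<Sum>l\<in>UNIV. (N x \<bullet> h i l x) * (Q x \<bullet> h i l x))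
       + (\<Sum>i\<in>UNIV. w i \<bullet> D i) - 2 * (r x)\<^sup>2 * (\<Sum>i\<in>UNIV. t i x * (N x \<bullet> w i)) - r x * (\<Sum>i\<in>UNIV. w i \<bullet> w i)
       + 4 * (\<Sum>i\<in>UNIV. t i x * (Q x \<bullet> D i)))
    + 8 * (r x)\<^sup>2 * (\<Sum>i\<in>UNIV. t i x * (Q x \<bullet> w i))
    + f x * (4 + 4 * (N x \<bullet> H x)) + (\<Sum>i\<in>UNIV. t i x * pd i f x)"
proof -
  define c where "c j y = (\<Sum>l\<in>UNIV. (X y \<bullet> dual_frame X l y) * (Q y \<bullet> pd l (pd j X) y))" for j y
  have dc: "c j differentiable (at x)" for j unfolding c_def[abs_def] using x by simp
  have Q0: "Q x \<bullet> pd k X x = 0" and N0: "N x \<bullet> pd k X x = 0" and h0: "h i j x \<bullet> pd k X x = 0" for i j k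
    using x by (rule Q_pd_inner, rule normal_proj_pd_inner, rule second_ff_pd_inner)
  have hsym: "h i j x = h j i x" for i j by (rule second_ff_sym[OF x])
  have cx: "c j x = Q x \<bullet> w j" for j
    by (simp add: c_def dual_x w_def inner_sum_right h_x[symmetric] hsym[of j])
  have dX: "pd i (\<lambda>y. X y \<bullet> dual_frame X l y) x = (if i = l then 1 else 0) + N x \<bullet> h i l x" for i l
    using x by (simp add: pd_inner pd_dual_x dual_x X_h orthonormal)
  have dQ: "h i l x \<bullet> pd i Q x = h i l x \<bullet> D i - 2 * t i x * (r x)\<^sup>2 * (N x \<bullet> h i l x) - r x * (h i l x \<bullet> w i)" for i l
    using x by (simp add: pd_add pd_scaleR inner_add_right inner_diff_right inner_pd_H h0 inner_pd_N pd_r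
      inner_commute[of _ "N x"])
  have "pd i (c i) x = (\<Sum>l\<in>UNIV. ((if i = l then 1 else 0) + N x \<bullet> h i l x) * (Q x \<bullet> h i l x)
       + t l x * (h i l x \<bullet> pd i Q x + Q x \<bullet> pd i (pd l (pd i X)) x))" for i
  proof -
    have hx: "pd l (pd i X) x = h i l x" for l using h_x[of l i] hsym[of l i] by simp
    have e: "pd i (\<lambda>y. Q y \<bullet> pd l (pd i X) y) x = Q x \<bullet> pd i (pd l (pd i X)) x + pd i Q x \<bullet> h i l x" for l
      using pd_inner[OF diff_Q[OF x] diff_pd_pd_X[OF x], of i l i] unfolding hx .
    have d: "(\<lambda>y. X y \<bullet> dual_frame X l y) differentiable (at x)" "(\<lambda>y. Q y \<bullet> pd l (pd i X) y) differentiable (at x)" for l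
      using x by (intro differentiable_inner; simp)+
    have "pd i (c i) x = (\<Sum>l\<in>UNIV. pd i (\<lambda>y. (X y \<bullet> dual_frame X l y) * (Q y \<bullet> pd l (pd i X) y)) x)"
      unfolding c_def[abs_def] by (rule pd_sum) (intro differentiable_mult d)
    also have "\<dots> = (\<Sum>l\<in>UNIV. (X x \<bullet> dual_frame X l x) * (Q x \<bullet> pd i (pd l (pd i X)) x + pd i Q x \<bullet> h i l x)
        + ((if i = l then 1 else 0) + N x \<bullet> h i l x) * (Q x \<bullet> h i l x))"
      unfolding pd_mult[OF d] dX e hx ..
    finally show ?thesis by (simp only: dual_x inner_commute[of "pd i Q x"] add.commute)
  qed
  then have "(\<Sum>i\<in>UNIV. pd i (c i) x) = 4 * (Q x \<bullet> H x)
       + (\<Sum>i\<in>UNIV. \<Sum>l\<in>UNIV. (N x \<bullet> h i l x) * (Q x \<bullet> h i l x))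
       + (\<Sum>i\<in>UNIV. \<Sum>l\<in>UNIV. t l x * (h i l x \<bullet> pd i Q x))
       + (\<Sum>i\<in>UNIV. \<Sum>l\<in>UNIV. t l x * (Q x \<bullet> pd i (pd l (pd i X)) x))"
    by (simp add: sum.distrib distrib_left distrib_right if_distrib[of "\<lambda>t. t * _"] inner_sum_right[symmetric] h_sum cong: if_cong)
  also have "(\<Sum>i\<in>UNIV. \<Sum>l\<in>UNIV. t l x * (Q x \<bullet> pd i (pd l (pd i X)) x)) = 4 * (\<Sum>i\<in>UNIV. t i x * (Q x \<bullet> D i))"
  proof -
    have "(\<Sum>i\<in>UNIV. \<Sum>l\<in>UNIV. t l x * (Q x \<bullet> pd i (pd l (pd i X)) x)) = (\<Sum>l\<in>UNIV. t l x * (4 * (Q x \<bullet> D l)))"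
      by (subst sum.swap) (simp only: sum_distrib_left[symmetric] codazzi_trace[OF Q0] inner_pd_H[OF Q0])
    then show ?thesis by (simp add: sum_distrib_left mult_ac)
  qed
  also have "(\<Sum>i\<in>UNIV. \<Sum>l\<in>UNIV. t l x * (h i l x \<bullet> pd i Q x))
     = (\<Sum>i\<in>UNIV. w i \<bullet> D i) - 2 * (r x)\<^sup>2 * (\<Sum>i\<in>UNIV. t i x * (N x \<bullet> w i)) - r x * (\<Sum>i\<in>UNIV. w i \<bullet> w i)"
  proof -
    have "(\<Sum>l\<in>UNIV. t l x * (h i l x \<bullet> pd i Q x)) = w i \<bullet> D i - 2 * (r x)\<^sup>2 * (t i x * (N x \<bullet> w i)) - r x * (w i \<bullet> w i)" for i
    proof -
      have 1: "w i \<bullet> v = (\<Sum>l\<in>UNIV. t l x * (h i l x \<bullet> v))" for v by (simp add: w_def inner_sum_left)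
      have 2: "N x \<bullet> w i = (\<Sum>l\<in>UNIV. t l x * (N x \<bullet> h i l x))" by (simp add: w_def inner_sum_right)
      have "t l x * (h i l x \<bullet> pd i Q x) = t l x * (h i l x \<bullet> D i)
          - (2 * (r x)\<^sup>2 * t i x) * (t l x * (N x \<bullet> h i l x)) - r x * (t l x * (h i l x \<bullet> w i))" for l
        unfolding dQ by (simp add: algebra_simps)
      then have "(\<Sum>l\<in>UNIV. t l x * (h i l x \<bullet> pd i Q x)) = w i \<bullet> D i
          - (2 * (r x)\<^sup>2 * t i x) * (N x \<bullet> w i) - r x * (w i \<bullet> w i)"
        by (simp only: sum_subtractf sum_distrib_left[symmetric] 1[symmetric] 2[symmetric])
      then show ?thesis by simp
    qed
    then show ?thesis by (simp add: sum_subtractf sum_distrib_left)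
  qed
  finally have dc_sum: "(\<Sum>i\<in>UNIV. pd i (c i) x) = 4 * (Q x \<bullet> H x)
       + (\<Sum>i\<in>UNIV. \<Sum>l\<in>UNIV. (N x \<bullet> h i l x) * (Q x \<bullet> h i l x))
       + ((\<Sum>i\<in>UNIV. w i \<bullet> D i) - 2 * (r x)\<^sup>2 * (\<Sum>i\<in>UNIV. t i x * (N x \<bullet> w i)) - r x * (\<Sum>i\<in>UNIV. w i \<bullet> w i))
       + 4 * (\<Sum>i\<in>UNIV. t i x * (Q x \<bullet> D i))" .
  have "pd i (defect_field X) x \<bullet> pd i X x
      = - 4 * r x * pd i (c i) x + 8 * (r x)\<^sup>2 * (t i x * c i x) + f x * (1 + N x \<bullet> h i i x) + t i x * pd i f x" for i
  proof -
    define \<alpha> where "\<alpha> j y = - 4 * r y * c j y" for j y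
    have d: "\<alpha> j differentiable (at x)" for j unfolding \<alpha>_def[abs_def] using x dc by simp
    have "pd i (defect_field X) x = pd i (\<lambda>y. (\<Sum>j\<in>UNIV. \<alpha> j y *\<^sub>R dual_frame X j y) + f y *\<^sub>R (X y - N y)) x"
      by (rule pd_cong[OF open_S x]) (simp add: defect_field_eq c_def \<alpha>_def)
    also have "\<dots> = (\<Sum>j\<in>UNIV. \<alpha> j x *\<^sub>R h i j x + pd i (\<alpha> j) x *\<^sub>R pd j X x)
        + (f x *\<^sub>R (pd i X x - pd i N x) + pd i f x *\<^sub>R (X x - N x))"
      using x d by (simp add: pd_add pd_sum pd_scaleR pd_diff pd_dual_x dual_x)
    finally have "pd i (defect_field X) x \<bullet> pd i X x = pd i (\<alpha> i) x
        + (f x * (1 - pd i N x \<bullet> pd i X x) + pd i f x * t i x)"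
      by (simp add: inner_add_left inner_sum_left inner_diff_left h0 orthonormal N0
        if_distrib[of "\<lambda>t. _ * t"] cong: if_cong)
    moreover have "pd i N x \<bullet> pd i X x = - (N x \<bullet> h i i x)"
    proof -
      have "pd i (\<lambda>y. N y \<bullet> pd i X y) x = pd i (\<lambda>y. 0) x"
        by (rule pd_cong[OF open_S x]) (rule normal_proj_pd_inner)
      then show ?thesis using x by (simp add: pd_inner h_x)
    qed
    moreover have "pd i (\<alpha> i) x = - 4 * r x * pd i (c i) x + 8 * (r x)\<^sup>2 * (t i x * c i x)"
    proof -
      have "pd i (\<lambda>y. (- 4) * (r y * c i y)) x = (- 4) * pd i (\<lambda>y. r y * c i y) x"
        using x dc by (subst pd_mult) auto
      then show ?thesis using x dc by (simp add: \<alpha>_def[abs_def] pd_mult pd_r algebra_simps power2_eq_square)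
    qed
    ultimately show ?thesis by (simp add: algebra_simps)
  qed
  then have "surface_div X (defect_field X) x
     = - 4 * r x * (\<Sum>i\<in>UNIV. pd i (c i) x) + 8 * (r x)\<^sup>2 * (\<Sum>i\<in>UNIV. t i x * c i x)
      + f x * (4 + N x \<bullet> (\<Sum>i\<in>UNIV. h i i x)) + (\<Sum>i\<in>UNIV. t i x * pd i f x)"
    by (simp add: surface_div_def dual_x inner_commute[of "pd _ X x"] sum.distrib sum_subtractf sum_negf
      sum_distrib_left inner_sum_right distrib_left)
  then show ?thesis by (simp add: dc_sum h_sum cx add.assoc)
qed

text \<open>Both sides are polynomials in \<open>r\<close>, \<open>|X|\<^sup>2\<close> and the scalar invariants abbreviated below, of which \<open>?a1\<close> to
  \<open>?a9\<close> are contractions of \<open>t\<close>, \<open>N\<close>, \<open>H\<close>, the second fundamental form and the normal derivative of \<open>H\<close>. They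
  agree on account of \<open>r |X|\<^sup>2 = 1\<close> and \<open>|t|\<^sup>2 = |X|\<^sup>2 - |N|\<^sup>2\<close>.\<close>

lemma local_density_inversion_at_normal_point:
  "(r x)^4 * local_density Xt x = local_density X x + surface_div X (defect_field X) x"
proof -
  let ?HH = "H x \<bullet> H x" and ?NH = "N x \<bullet> H x" and ?NN = "N x \<bullet> N x" and ?s = "X x \<bullet> X x"
  let ?a1 = "\<Sum>i\<in>UNIV. w i \<bullet> D i" and ?a2 = "\<Sum>i\<in>UNIV. w i \<bullet> w i"
  let ?a3 = "\<Sum>i\<in>UNIV. \<Sum>l\<in>UNIV. (N x \<bullet> h i l x) * (H x \<bullet> h i l x)" and ?a4 = "\<Sum>i\<in>UNIV. \<Sum>l\<in>UNIV. (N x \<bullet> h i l x) * (N x \<bullet> h i l x)"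
  let ?a5 = "\<Sum>i\<in>UNIV. t i x * (H x \<bullet> D i)" and ?a6 = "\<Sum>i\<in>UNIV. t i x * (N x \<bullet> D i)"
  let ?a7 = "\<Sum>i\<in>UNIV. t i x * (H x \<bullet> w i)" and ?a8 = "\<Sum>i\<in>UNIV. t i x * (N x \<bullet> w i)"
  let ?a9 = "\<Sum>i\<in>UNIV. \<Sum>l\<in>UNIV. (H x \<bullet> h i l x) * (H x \<bullet> h i l x)"
  let ?D2 = "\<Sum>i\<in>UNIV. D i \<bullet> D i" and ?T = "\<Sum>i\<in>UNIV. t i x * t i x"
  have rs: "r x * ?s = 1" by (rule r_inverse[OF x])
  have T: "?T = ?s - ?NN" using norm_N by (simp add: power2_eq_square)
  have div: "surface_div X (defect_field X) x =
    - 4 * r x * (4 * (?HH + r x * ?NH) + (?a3 + r x * ?a4) + ?a1 - 2 * (r x)\<^sup>2 * ?a8 - r x * ?a2 + 4 * (?a5 + r x * ?a6))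
    + 8 * (r x)\<^sup>2 * (?a7 + r x * ?a8)
    + f x * (4 + 4 * ?NH) + (20 * r x * ?a5 - 20 * (r x)\<^sup>2 * ?T * ?HH + 16 * (r x)\<^sup>2 * (?a6 - ?a7)
      - 64 * (r x)^3 * ?T * ?NH - 16 * (r x)^3 * ?T - 16 * (r x)^3 * ?a8 - 48 * (r x)^4 * ?T * ?NN)"
    unfolding surface_div_defect_field pd_f
    by (simp add: inner_add_left distrib_left right_diff_distrib sum.distrib sum_subtractf sum_distrib_left sum_distrib_right mult_ac)
  have quad: "(\<Sum>i\<in>UNIV. \<Sum>j\<in>UNIV. \<Sum>k\<in>UNIV. \<Sum>l\<in>UNIV. inv_metric X x $ i $ k * inv_metric X x $ j $ l * b i j * b k l)
     = (\<Sum>i\<in>UNIV. \<Sum>j\<in>UNIV. b i j * b i j)" for b :: "4 \<Rightarrow> 4 \<Rightarrow> real"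
  proof -
    have "(\<Sum>k\<in>UNIV. \<Sum>l\<in>UNIV. inv_metric X x $ i $ k * inv_metric X x $ j $ l * b i j * b k l)
      = (\<Sum>k\<in>UNIV. inv_metric X x $ i $ k * (\<Sum>l\<in>UNIV. inv_metric X x $ j $ l * (b i j * b k l)))" for i j
      by (simp add: sum_distrib_left mult.assoc)
    then show ?thesis by (simp add: inv_metric_sum)
  qed
  have dens: "local_density X x = ?D2 - ?a9 + 7 * ?HH\<^sup>2"
    unfolding local_density_def Let_def quad trace_x_real ..
  have dens_t: "(r x)^4 * local_density Xt x = (r x)\<^sup>2 * (?s\<^sup>2 * ?D2 + 4 * ?T * ?HH + 4 * ?a2 + 4 * ?s * ?a5 - 4 * ?s * ?a1 - 8 * ?a7)
     - (?a9 + 4 * r x * ?a3 + 4 * (r x)\<^sup>2 * ?a4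
        + 8 * (2 * r x * ?NH + 4 * (r x)\<^sup>2 * ?NN) * (?HH + 2 * r x * ?NH) + 4 * (2 * r x * ?NH + 4 * (r x)\<^sup>2 * ?NN)\<^sup>2)
     + 7 * (?HH + 4 * r x * ?NH + 4 * (r x)\<^sup>2 * ?NN)\<^sup>2"
  proof -
    define W where "W = ?s *\<^sub>R H x + 2 *\<^sub>R N x"
    define V where "V i = ?s *\<^sub>R D i + (2 * t i x) *\<^sub>R H x - 2 *\<^sub>R w i" for i
    define K where "K = 2 * r x * ?NH + 4 * (r x)\<^sup>2 * ?NN"
    define b where "b i j = mean_curv Xt x \<bullet> second_ff Xt i j x" for i j
    let ?c = "inverse (r x)"
    have c: "r x * ?c = 1" using r_pos[OF x] by simp
    have Ht: "mean_curv Xt x \<bullet> mean_curv Xt x = W \<bullet> W"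
      by (simp add: mean_curv_Xt[OF x] reflect_inner[OF nonzero[OF x]] W_def)
    have Vt: "normal_proj Xt x (pd i (mean_curv Xt) x) \<bullet> normal_proj Xt x (pd j (mean_curv Xt) x) = V i \<bullet> V j" for i j
      by (simp add: normal_proj_pd_mean_curv_Xt[OF x] reflect_inner[OF nonzero[OF x]] V_def w_def dual_x
        inner_commute[of "pd _ X x" "X x"])
    have b: "b i j = H x \<bullet> h i j x + 2 * r x * (N x \<bullet> h i j x) + (if i = j then K else 0)" for i j
    proof -
      have "b i j = W \<bullet> (r x *\<^sub>R (h i j x + (2 * r x * metric X x $ i $ j) *\<^sub>R N x))"
        by (simp add: b_def mean_curv_Xt[OF x] second_ff_Xt[OF x] reflect_inner[OF nonzero[OF x]] W_def)
      also have "\<dots> = (r x * ?s) * (H x \<bullet> h i j x) + 2 * r x * (N x \<bullet> h i j x)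
          + metric X x $ i $ j * (2 * r x * (r x * ?s) * ?NH + 4 * (r x)\<^sup>2 * ?NN)"
        by (simp add: W_def inner_add_left inner_add_right inner_commute[of "H x" "N x"] algebra_simps power2_eq_square)
      finally show ?thesis by (simp add: rs K_def metric_entry orthonormal)
    qed
    have h4: "(\<Sum>i\<in>UNIV. n \<bullet> h i i x) = 4 * (n \<bullet> H x)" for n
      by (simp add: inner_sum_right[symmetric] h_sum)
    have "b i j * b i j = (H x \<bullet> h i j x) * (H x \<bullet> h i j x) + 4 * r x * ((N x \<bullet> h i j x) * (H x \<bullet> h i j x))
        + 4 * (r x)\<^sup>2 * ((N x \<bullet> h i j x) * (N x \<bullet> h i j x))
        + (if i = j then 2 * K * (H x \<bullet> h i i x) + 4 * K * r x * (N x \<bullet> h i i x) + K\<^sup>2 else 0)" for i j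
      unfolding b by (simp add: algebra_simps power2_eq_square)
    then have bb: "(\<Sum>i\<in>UNIV. \<Sum>j\<in>UNIV. b i j * b i j) = ?a9 + 4 * r x * ?a3 + 4 * (r x)\<^sup>2 * ?a4
        + 2 * K * (4 * ?HH) + 4 * K * r x * (4 * ?NH) + 4 * K\<^sup>2"
      by (simp add: sum.distrib sum_distrib_left[symmetric] h4)
    have VV: "(\<Sum>i\<in>UNIV. V i \<bullet> V i) = ?s\<^sup>2 * ?D2 + 4 * ?T * ?HH + 4 * ?a2 + 4 * ?s * ?a5 - 4 * ?s * ?a1 - 8 * ?a7"
    proof -
      have "V i \<bullet> V i = ?s\<^sup>2 * (D i \<bullet> D i) + (4 * ?HH) * (t i x * t i x) + 4 * (w i \<bullet> w i) + (4 * ?s) * (t i x * (H x \<bullet> D i))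
         - (4 * ?s) * (w i \<bullet> D i) - 8 * (t i x * (H x \<bullet> w i))" for i
        by (simp add: V_def inner_add_left inner_add_right inner_diff_left inner_diff_right
          inner_commute[of "D i" "H x"] inner_commute[of "D i" "w i"] inner_commute[of "w i" "H x"]
          algebra_simps power2_eq_square)
      then show ?thesis by (simp only: sum.distrib sum_subtractf sum_distrib_left[symmetric]) (simp add: mult_ac)
    qed
    have WW: "(r x)\<^sup>2 * (W \<bullet> W) = (r x * ?s)\<^sup>2 * ?HH + 4 * r x * (r x * ?s) * ?NH + 4 * (r x)\<^sup>2 * ?NN"
      by (simp add: W_def inner_add_left inner_add_right inner_commute[of "H x" "N x"] algebra_simps power2_eq_square)
    have 1: "(\<Sum>i\<in>UNIV. \<Sum>j\<in>UNIV. inv_metric Xt x $ i $ j * (V i \<bullet> V j)) = ?c\<^sup>2 * (\<Sum>i\<in>UNIV. V i \<bullet> V i)"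
      unfolding inv_metric_Xt[OF x] by (simp only: mult.assoc sum_distrib_left[symmetric] trace_x_real)
    have 2: "(\<Sum>i\<in>UNIV. \<Sum>j\<in>UNIV. \<Sum>k\<in>UNIV. \<Sum>l\<in>UNIV. inv_metric Xt x $ i $ k * inv_metric Xt x $ j $ l * b i j * b k l)
        = ?c^4 * (\<Sum>i\<in>UNIV. \<Sum>j\<in>UNIV. b i j * b i j)"
      unfolding inv_metric_Xt[OF x] quad[symmetric] by (simp add: sum_distrib_left mult_ac power2_eq_square power4_eq_xxxx)
    have "(r x)^4 * local_density Xt x = (r x * ?c)\<^sup>2 * (r x)\<^sup>2 * (\<Sum>i\<in>UNIV. V i \<bullet> V i)
        - (r x * ?c)^4 * (\<Sum>i\<in>UNIV. \<Sum>j\<in>UNIV. b i j * b i j) + 7 * ((r x)\<^sup>2 * (W \<bullet> W))\<^sup>2"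
      unfolding local_density_def Let_def Vt Ht b_def[symmetric] 1 2
      by (simp only: power_mult_distrib) (simp add: algebra_simps power2_eq_square power4_eq_xxxx)
    then show ?thesis unfolding c bb VV WW rs K_def by (simp add: algebra_simps power2_eq_square)
  qed
  have r0: "r x \<noteq> 0" using r_pos[OF x] by simp
  have s: "?s = inverse (r x)" using rs r0 by (simp add: field_simps)
  show ?thesis unfolding div dens dens_t T unfolding s using r0
    by (simp add: field_simps power2_eq_square power3_eq_cube power4_eq_xxxx)
qed

end


section \<open>Normal coordinates\<close>

text \<open>The linear part of \<open>\<theta>\<close> sends the coordinate axes to the coordinate vectors \<open>v a\<close> of an orthonormal tangent
  frame. The quadratic part has coefficients \<open>c i j\<close> that cancel the tangential part of the second
  derivatives \<open>u i j\<close> of \<open>X\<close> in this frame, so that only normal vectors remain.\<close>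

lemma (in patch) normal_coordinates:
  assumes x: "x \<in> S"
  obtains T \<theta> where "reparametrization T (\<lambda>z. X (\<theta> z)) S X \<theta>" "0 \<in> T" "\<theta> 0 = x"
    "\<And>i j. pd i (\<lambda>z. X (\<theta> z)) 0 \<bullet> pd j (\<lambda>z. X (\<theta> z)) 0 = (if i = j then 1 else 0)"
    "\<And>i j k. pd i (pd j (\<lambda>z. X (\<theta> z))) 0 \<bullet> pd k (\<lambda>z. X (\<theta> z)) 0 = 0"
proof -
  let ?L = "frechet_derivative X (at x)"
  obtain v :: "4 \<Rightarrow> real^4" where v: "\<And>a b. ?L (v a) \<bullet> ?L (v b) = (if a = b then 1 else 0)"
    using exists_orthonormal_frame[OF linear_frechet_derivative[OF diff_X[OF x]] immersed[OF x]] by auto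
  define u where "u i j = (\<Sum>a\<in>UNIV. \<Sum>b\<in>UNIV. (v i $ a * v j $ b) *\<^sub>R pd a (pd b X) x)" for i j
  define c :: "4 \<Rightarrow> 4 \<Rightarrow> real^4" where "c i j = (\<chi> a. - (dual_frame X a x \<bullet> u i j))" for i j
  have u_sym: "u i j = u j i" for i j
    unfolding u_def by (subst sum.swap) (simp add: pd_pd_commute[OF x] mult.commute)
  have c_sym: "c i j = c j i" for i j unfolding c_def u_sym[of i j] ..
  define \<theta> :: "real^4 \<Rightarrow> real^4" where "\<theta> z = x + (\<Sum>a\<in>UNIV. z $ a *\<^sub>R v a)
      + (\<Sum>a\<in>UNIV. \<Sum>b\<in>UNIV. (1/2 * (z $ a * z $ b)) *\<^sub>R c a b)" for z
  have C_coord: "C_on k UNIV (\<lambda>z::real^4. z $ a)" for k a by (intro C_on_vec_nth C_on_ident open_UNIV)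
  have d_coord: "(\<lambda>z::real^4. z $ a) differentiable (at z)" for a z using C_coord[of 1] by simp
  have pd_coord: "pd i (\<lambda>z::real^4. z $ a) z = (if a = i then 1 else 0)" for i a z
    by (subst pd_eqI[OF bounded_linear_imp_has_derivative[OF bounded_linear_vec_nth]]) (simp add: axis_def)
  have C_\<theta>: "C_on k UNIV \<theta>" for k
    unfolding \<theta>_def[abs_def] by (intro C_on_add C_on_sum C_on_scaleR C_on_mult C_on_const C_coord open_UNIV)
  have d_\<theta>: "\<theta> differentiable (at z)" for z using C_\<theta>[of 1] by simp
  have pd_\<theta>: "pd i \<theta> z = v i + (\<Sum>b\<in>UNIV. z $ b *\<^sub>R c i b)" for i z
  proof -
    have quad: "pd i (\<lambda>z. (1/2 * (z $ a * z $ b)) *\<^sub>R c a b) z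
       = (1/2 * (z $ a * (if b = i then 1 else 0) + (if a = i then 1 else 0) * z $ b)) *\<^sub>R c a b" for a b
      using d_coord[of _ z] by (simp only: pd_scaleR pd_mult pd_coord pd_const differentiable_mult differentiable_const)
        (simp only: mult_zero_left mult_zero_right add_0_right add_0_left scaleR_zero_right)
    have "pd i \<theta> z = (\<Sum>a\<in>UNIV. (if a = i then 1 else 0) *\<^sub>R v a) +
        (\<Sum>a\<in>UNIV. \<Sum>b\<in>UNIV. (1/2 * (z $ a * (if b = i then 1 else 0) + (if a = i then 1 else 0) * z $ b)) *\<^sub>R c a b)"
      unfolding \<theta>_def[abs_def] quad[symmetric] using d_coord[of _ z]
      by (simp add: pd_add pd_sum pd_scaleR pd_coord)
    also have "\<dots> = v i + ((\<Sum>a\<in>UNIV. (1/2 * z $ a) *\<^sub>R c a i) + (\<Sum>b\<in>UNIV. (1/2 * z $ b) *\<^sub>R c i b))"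
      by (simp add: distrib_left scaleR_add_left sum.distrib if_distrib[of "\<lambda>t. t *\<^sub>R _"] if_distrib[of "\<lambda>t. _ * t"]
          if_distrib[of "\<lambda>t. t * _"] if_distrib[of "\<lambda>t. t / 2"] sum.swap[of _ UNIV UNIV] cong: if_cong)
    also have "(\<Sum>a\<in>UNIV. (1/2 * z $ a) *\<^sub>R c a i) = (\<Sum>b\<in>UNIV. (1/2 * z $ b) *\<^sub>R c i b)"
      by (simp add: c_sym[of _ i])
    finally show ?thesis by (simp add: sum.distrib[symmetric] scaleR_add_left[symmetric])
  qed
  have \<theta>0: "\<theta> 0 = x" by (simp add: \<theta>_def)
  have pd_\<theta>0: "pd i \<theta> 0 = v i" for i by (simp add: pd_\<theta>)
  define Y where "Y z = X (\<theta> z)" for z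
  define T0 where "T0 = \<theta> -` S"
  have T0: "open T0" unfolding T0_def using C_on_continuous[OF C_\<theta>[of 0]] open_S
    by (intro open_vimage) (auto simp: continuous_on_eq_continuous_at)
  have C_Y: "C_on k T0 Y" for k unfolding Y_def[abs_def]
    by (rule C_on_compose[OF T0 C_X C_on_subset[OF C_\<theta>]]) (auto simp: T0_def)
  have pdY: "pd i Y z = (\<Sum>a\<in>UNIV. pd i \<theta> z $ a *\<^sub>R pd a X (\<theta> z))" if "z \<in> T0" for i z
    unfolding Y_def[abs_def] using that by (intro pd_compose d_\<theta>) (simp add: T0_def)
  have z0: "0 \<in> T0" using x \<theta>0 by (simp add: T0_def)
  have pdY0: "pd i Y 0 = ?L (v i)" for i
    unfolding pdY[OF z0] \<theta>0 pd_\<theta>0 frechet_derivative_pd[OF diff_X[OF x]] ..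
  have m0: "metric Y 0 = mat 1" by (simp add: vec_eq_iff metric_def pdY0 v mat_def)
  \<comment> \<open>Away from the origin \<open>\<theta>\<close> may degenerate, which the determinant of the metric detects.\<close>
  define T where "T = T0 \<inter> (\<lambda>z. det (metric Y z)) -` (- {0})"
  have "C_on 0 T0 (\<lambda>z. det (metric Y z))"
    unfolding metric_def by (rule C_on_det[OF T0]) (simp del: C_on.simps add: C_on_inner[OF T0] C_on_pd[OF C_Y])
  then have T: "open T" unfolding T_def using T0 by (intro continuous_open_preimage) auto
  have 0: "0 \<in> T" using z0 by (simp add: T_def m0)
  interpret R: reparametrization T Y S X \<theta>
  proof
    show "open T" by fact
    show "smooth_on T Y" by (intro smooth_onI C_on_subset[OF C_Y]) (auto simp: T_def)
    show "smooth_on T \<theta>" by (intro smooth_onI C_on_subset[OF C_\<theta>]) auto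
    show "inj (frechet_derivative Y (at z))" if "z \<in> T" for z
      using that C_Y[of 1] by (intro inj_frechet_derivative_if_det_metric) (auto simp: T_def)
  qed (auto simp: T_def T0_def Y_def)
  have second: "pd i (pd j Y) 0 = normal_proj X x (u i j)" for i j
  proof -
    have "pd i (\<lambda>z. pd j \<theta> z $ a) 0 = c j i $ a" for a
    proof -
      have "pd i (\<lambda>z. pd j \<theta> z $ a) 0 = pd i (\<lambda>z. v j $ a + (\<Sum>b\<in>UNIV. z $ b * c j b $ a)) 0"
        by (simp add: pd_\<theta>)
      also have "\<dots> = c j i $ a" using d_coord[of _ 0]
        by (simp add: pd_add pd_sum pd_mult pd_coord if_distrib[of "\<lambda>t. t * _"] cong: if_cong)
      finally show ?thesis .
    qed
    then show ?thesis
      unfolding R.pd_pd_X[OF 0] \<theta>0 pd_\<theta>0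
      by (simp add: normal_proj_eq[OF x] c_sym[of j i] u_def[symmetric]) (simp add: c_def sum_negf)
  qed
  have "normal_proj X x w \<bullet> pd k Y 0 = 0" for w k
    unfolding pdY[OF z0] \<theta>0 by (simp add: inner_sum_right normal_proj_pd_inner[OF x])
  then have n: "pd i (pd j Y) 0 \<bullet> pd k Y 0 = 0" for i j k unfolding second .
  show thesis
    by (rule that[of T \<theta>])
      (use R.reparametrization_axioms 0 \<theta>0 n v pdY0 in \<open>simp_all add: Y_def[abs_def, symmetric]\<close>)
qed

text \<open>All three terms are independent of the coordinates, so they may be computed in normal coordinates
  centred at the point.\<close>

lemma (in punctured_patch) local_density_inversion:
  assumes x: "x \<in> S"
  shows "(r x)^4 * local_density Xt x = local_density X x + surface_div X (defect_field X) x"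
proof -
  obtain T \<theta> where R: "reparametrization T (\<lambda>z. X (\<theta> z)) S X \<theta>" and 0: "0 \<in> T" and \<theta>0: "\<theta> 0 = x"
    and o: "\<And>i j. pd i (\<lambda>z. X (\<theta> z)) 0 \<bullet> pd j (\<lambda>z. X (\<theta> z)) 0 = (if i = j then 1 else 0)"
    "\<And>i j k. pd i (pd j (\<lambda>z. X (\<theta> z))) 0 \<bullet> pd k (\<lambda>z. X (\<theta> z)) 0 = 0"
    using normal_coordinates[OF x] by blast
  interpret R: reparametrization T "\<lambda>z. X (\<theta> z)" S X \<theta> by (rule R)
  interpret NP: normal_point T "\<lambda>z. X (\<theta> z)" 0
    by unfold_locales (use o 0 R.\<tau>_in nonzero in auto)
  interpret Rt: reparametrization T "\<lambda>z. inversion (X (\<theta> z))" S Xt \<theta>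
    by (intro reparametrization.intro reparametrization_axioms.intro NP.patch_Xt patch_Xt)
      (auto intro: R.smooth_\<tau> R.\<tau>_in)
  have "surface_div (\<lambda>z. X (\<theta> z)) (defect_field (\<lambda>z. X (\<theta> z))) 0 = surface_div X (defect_field X) (\<theta> 0)"
    by (rule R.surface_div_pullback[OF 0])
      (use C_on_diffble[OF C_defect_field] x \<theta>0 R.defect_field_pullback in auto)
  then show ?thesis
    using NP.local_density_inversion_at_normal_point R.local_density_pullback[OF 0] Rt.local_density_pullback[OF 0]
    by (simp add: \<theta>0 NP.r_def r_def)
qed

section \<open>Similarities\<close>

locale similarity_patch = patch S X for S and X :: "real^4 \<Rightarrow> real^'m::finite" +
  fixes c :: real and U :: "real^'m \<Rightarrow> real^'m" and a :: "real^'m"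
  assumes c: "0 < c" and U: "orthogonal_transformation U"
begin

abbreviation "Xs \<equiv> \<lambda>x. c *\<^sub>R U (X x) + a"

lemma U_inner: "U u \<bullet> U v = u \<bullet> v" using U by (simp add: orthogonal_transformation_def)
lemma linear_U: "linear U" using U by (rule orthogonal_transformation_linear)
lemma bounded_linear_U: "bounded_linear U" using linear_U by (rule linear_conv_bounded_linear[THEN iffD1])

lemma C_Xs: "C_on k S Xs"
  by (intro C_on_add C_on_scaleR C_on_const C_on_bounded_linear[OF _ bounded_linear_U] open_S C_X)

lemma pd_scaled_U:
  "g differentiable (at x) \<Longrightarrow> pd i (\<lambda>y. k *\<^sub>R U (g y)) x = k *\<^sub>R U (pd i g x)"
  by (rule pd_bounded_linear) (intro bounded_linear_const_scaleR bounded_linear_U)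

lemma pd_Xs: assumes x: "x \<in> S" shows "pd i Xs x = c *\<^sub>R U (pd i X x)"
proof -
  have "(\<lambda>y. c *\<^sub>R U (X y)) differentiable (at x)"
    by (rule C_on_diffble[OF _ x]) (intro C_on_scaleR C_on_const C_on_bounded_linear[OF _ bounded_linear_U] open_S C_X)
  then show ?thesis using x by (simp add: pd_add pd_scaled_U)
qed

lemma pd_pd_Xs: assumes x: "x \<in> S" shows "pd i (pd j Xs) x = c *\<^sub>R U (pd i (pd j X) x)"
proof -
  have "pd i (pd j Xs) x = pd i (\<lambda>y. c *\<^sub>R U (pd j X y)) x" by (rule pd_cong[OF open_S x]) (rule pd_Xs)
  then show ?thesis using x by (simp add: pd_scaled_U)
qed

lemma metric_Xs: "x \<in> S \<Longrightarrow> metric Xs x = c\<^sup>2 *\<^sub>R metric X x"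
  by (simp add: vec_eq_iff metric_def pd_Xs U_inner power2_eq_square)

lemma patch_Xs: "patch S Xs"
proof
  show "open S" by (rule open_S)
  show "smooth_on S Xs" by (intro smooth_onI C_Xs)
  show "inj (frechet_derivative Xs (at x))" if x: "x \<in> S" for x
    by (rule inj_frechet_derivative_if_det_metric[OF C_on_diffble[OF C_Xs x]])
      (use det_metric_pos[OF x] c in \<open>simp add: metric_Xs[OF x] det_scaleR\<close>)
qed

lemma inv_metric_Xs: "x \<in> S \<Longrightarrow> inv_metric Xs x = inverse (c\<^sup>2) *\<^sub>R inv_metric X x"
  unfolding inv_metric_def metric_Xs using det_metric_pos[of x] c by (intro matrix_inv_scaleR) auto

lemma normal_proj_Xs: assumes x: "x \<in> S" shows "normal_proj Xs x (k *\<^sub>R U v) = k *\<^sub>R U (normal_proj X x v)"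
proof (rule normal_proj_eqI[OF C_on_diffble[OF C_Xs x]])
  show "k *\<^sub>R U (normal_proj X x v) \<bullet> pd i Xs x = 0" for i
    by (simp add: pd_Xs[OF x] U_inner normal_proj_pd_inner[OF x])
  have "k *\<^sub>R U v - k *\<^sub>R U (normal_proj X x v) = k *\<^sub>R U (\<Sum>i\<in>UNIV. (dual_frame X i x \<bullet> v) *\<^sub>R pd i X x)"
    by (simp add: normal_proj_eq[OF x] linear_diff[OF linear_U, symmetric] flip: scaleR_diff_right)
  then show "k *\<^sub>R U v - k *\<^sub>R U (normal_proj X x v)
      = (\<Sum>i\<in>UNIV. (k * (dual_frame X i x \<bullet> v) * inverse c) *\<^sub>R pd i Xs x)"
    using less_imp_neq[OF c] by (simp add: pd_Xs[OF x] linear_sum[OF linear_U] linear_cmul[OF linear_U]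
      scaleR_sum_right mult.assoc)
qed

lemma second_ff_Xs: assumes x: "x \<in> S" shows "second_ff Xs i j x = c *\<^sub>R U (second_ff X i j x)"
proof -
  interpret Xs: patch S Xs by (rule patch_Xs)
  show ?thesis by (simp add: Xs.second_ff_eq[OF x] second_ff_eq[OF x] pd_pd_Xs[OF x] normal_proj_Xs[OF x])
qed

lemma mean_curv_Xs: assumes x: "x \<in> S" shows "mean_curv Xs x = inverse c *\<^sub>R U (mean_curv X x)"
  unfolding mean_curv_def inv_metric_Xs[OF x] second_ff_Xs[OF x] using c
  by (simp add: linear_cmul[OF linear_U] linear_sum[OF linear_U]
    scaleR_sum_right power2_eq_square field_simps)

lemma local_density_similarity:
  assumes x: "x \<in> S"
  shows "c^4 * local_density Xs x = local_density X x"
proof -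
  let ?k = "inverse c"
  have k: "c * ?k = 1" using c by simp
  let ?H = "mean_curv X x" and ?D = "\<lambda>i. normal_proj X x (pd i (mean_curv X) x)"
  have D: "normal_proj Xs x (pd i (mean_curv Xs) x) = ?k *\<^sub>R U (?D i)" for i
  proof -
    have "pd i (mean_curv Xs) x = pd i (\<lambda>y. ?k *\<^sub>R U (mean_curv X y)) x"
      by (rule pd_cong[OF open_S x]) (rule mean_curv_Xs)
    then show ?thesis using x by (simp add: pd_scaled_U normal_proj_Xs)
  qed
  have Hh: "mean_curv Xs x \<bullet> second_ff Xs i j x = ?H \<bullet> second_ff X i j x" for i j
    using c by (simp add: mean_curv_Xs[OF x] second_ff_Xs[OF x] U_inner)
  have HH: "mean_curv Xs x \<bullet> mean_curv Xs x = ?k\<^sup>2 * (?H \<bullet> ?H)"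
    by (simp add: mean_curv_Xs[OF x] U_inner power2_eq_square)
  have 1: "(\<Sum>i\<in>UNIV. \<Sum>j\<in>UNIV. inv_metric Xs x $ i $ j * (?k *\<^sub>R U (?D i) \<bullet> ?k *\<^sub>R U (?D j)))
     = ?k^4 * (\<Sum>i\<in>UNIV. \<Sum>j\<in>UNIV. inv_metric X x $ i $ j * (?D i \<bullet> ?D j))"
    by (simp add: inv_metric_Xs[OF x] U_inner sum_distrib_left power2_eq_square power4_eq_xxxx mult_ac)
  have 2: "(\<Sum>i\<in>UNIV. \<Sum>j\<in>UNIV. \<Sum>k\<in>UNIV. \<Sum>l\<in>UNIV. inv_metric Xs x $ i $ k * inv_metric Xs x $ j $ l * b i j * b k l)
     = ?k^4 * (\<Sum>i\<in>UNIV. \<Sum>j\<in>UNIV. \<Sum>k\<in>UNIV. \<Sum>l\<in>UNIV. inv_metric X x $ i $ k * inv_metric X x $ j $ l * b i j * b k l)" for b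
    by (simp add: inv_metric_Xs[OF x] sum_distrib_left power2_eq_square power4_eq_xxxx mult_ac)
  have "c^4 * local_density Xs x = (c * ?k)^4 * local_density X x"
    unfolding local_density_def Let_def D Hh HH 1 2 power_mult_distrib
    by (simp add: algebra_simps power2_eq_square power4_eq_xxxx)
  then show ?thesis unfolding k by simp
qed

end


section \<open>Change of variables and densities\<close>

lemma nn_integral_absolutely_integrable:
  fixes h :: "'a::euclidean_space \<Rightarrow> real"
  assumes h: "set_borel_measurable borel T h" and nn: "\<And>x. x \<in> T \<Longrightarrow> 0 \<le> h x"
  shows "(\<integral>\<^sup>+x\<in>T. ennreal (h x) \<partial>lborel) < \<infinity> \<longleftrightarrow> h absolutely_integrable_on T"
    "h absolutely_integrable_on T \<Longrightarrow> (\<integral>\<^sup>+x\<in>T. ennreal (h x) \<partial>lborel) = ennreal (integral T h)"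
proof -
  have m: "(\<lambda>x. indicator T x *\<^sub>R h x) \<in> borel_measurable lborel"
    using h by (simp add: set_borel_measurable_def)
  have eq: "(\<integral>\<^sup>+x\<in>T. ennreal (h x) \<partial>lborel) = (\<integral>\<^sup>+x. ennreal (norm (indicator T x *\<^sub>R h x)) \<partial>lborel)"
    using nn by (intro nn_integral_cong) (auto simp: indicator_def)
  have "integrable lborel (\<lambda>x. indicator T x *\<^sub>R h x) \<longleftrightarrow> (\<integral>\<^sup>+x\<in>T. ennreal (h x) \<partial>lborel) < \<infinity>"
    using m unfolding eq by (simp add: integrable_iff_bounded)
  then show 1: "(\<integral>\<^sup>+x\<in>T. ennreal (h x) \<partial>lborel) < \<infinity> \<longleftrightarrow> h absolutely_integrable_on T"
    unfolding set_integrable_def integrable_completion[OF m] by simp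
  show "h absolutely_integrable_on T \<Longrightarrow> (\<integral>\<^sup>+x\<in>T. ennreal (h x) \<partial>lborel) = ennreal (integral T h)"
    using set_nn_integral_lborel_eq_integral[OF h nn] 1 by simp
qed

text \<open>For nonnegative functions the change of variables also covers the value \<open>\<infinity>\<close>: one of the two integrals is
  finite if and only if the other one is.\<close>

lemma nn_integral_change_of_variables:
  fixes g :: "real^'n::{finite,wellorder} \<Rightarrow> real^'n::_" and f F :: "real^'n::_ \<Rightarrow> real"
  assumes S: "S \<in> sets borel" and f: "set_borel_measurable borel (g ` S) f" "\<And>y. y \<in> g ` S \<Longrightarrow> 0 \<le> f y"
    and F: "set_borel_measurable borel S F" "\<And>x. x \<in> S \<Longrightarrow> F x = \<bar>det (matrix (g' x))\<bar> * f (g x)"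
    and g: "\<And>x. x \<in> S \<Longrightarrow> (g has_derivative g' x) (at x)" "inj_on g S"
  shows "(\<integral>\<^sup>+y\<in>g ` S. ennreal (f y) \<partial>lborel) = (\<integral>\<^sup>+x\<in>S. ennreal (F x) \<partial>lborel)"
proof -
  have F0: "0 \<le> F x" if "x \<in> S" for x using F(2)[OF that] f(2) that by simp
  have "(\<lambda>x. \<bar>det (matrix (g' x))\<bar> *\<^sub>R vec (f (g x)) :: real^1) absolutely_integrable_on S \<and>
      integral S (\<lambda>x. \<bar>det (matrix (g' x))\<bar> *\<^sub>R vec (f (g x))) = (vec b :: real^1)
     \<longleftrightarrow> (\<lambda>x. vec (f x) :: real^1) absolutely_integrable_on (g ` S) \<and> integral (g ` S) (\<lambda>x. vec (f x)) = (vec b :: real^1)" for b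
    using S g by (intro has_absolute_integral_change_of_variables) (auto intro: has_derivative_at_withinI)
  then have iff0: "(\<lambda>x. \<bar>det (matrix (g' x))\<bar> * f (g x)) absolutely_integrable_on S \<and> integral S (\<lambda>x. \<bar>det (matrix (g' x))\<bar> * f (g x)) = b
     \<longleftrightarrow> f absolutely_integrable_on (g ` S) \<and> integral (g ` S) f = b" for b
    by (simp add: absolutely_integrable_on_1_iff integral_on_1_eq)
  have "(\<lambda>x. \<bar>det (matrix (g' x))\<bar> * f (g x)) absolutely_integrable_on S \<longleftrightarrow> F absolutely_integrable_on S"
    by (rule set_integrable_cong) (simp_all add: F(2))
  moreover have "integral S (\<lambda>x. \<bar>det (matrix (g' x))\<bar> * f (g x)) = integral S F"
    by (rule integral_cong) (simp add: F(2))
  ultimately have iff: "F absolutely_integrable_on S \<and> integral S F = b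
     \<longleftrightarrow> f absolutely_integrable_on (g ` S) \<and> integral (g ` S) f = b" for b
    using iff0[of b] by simp
  show ?thesis
  proof (cases "F absolutely_integrable_on S")
    case True
    then show ?thesis
      using iff[of "integral S F"] nn_integral_absolutely_integrable(2)[OF F(1) F0] nn_integral_absolutely_integrable(2)[OF f]
      by simp
  next
    case False
    then have "\<not> f absolutely_integrable_on (g ` S)" using iff by blast
    then show ?thesis
      using False nn_integral_absolutely_integrable(1)[OF F(1) F0] nn_integral_absolutely_integrable(1)[OF f]
      by (metis infinity_ennreal_def top.not_eq_extremum)
  qed
qed

text \<open>A positive density can be divided out, so \<open>f\<close> and \<open>g f\<close> are measurable together. If they are not
  measurable, both integrals are zero by convention.\<close>

lemma integral_density_positive:
  fixes f g :: "'a \<Rightarrow> real"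
  assumes g: "g \<in> borel_measurable M" "\<And>x. x \<in> space M \<Longrightarrow> 0 < g x"
  shows "integral\<^sup>L (density M (\<lambda>x. ennreal (g x))) f = (\<integral>x. g x * f x \<partial>M)"
proof (cases "f \<in> borel_measurable M")
  case True
  have "AE x in M. 0 \<le> g x" using g(2) by (intro AE_I2) (simp add: less_imp_le)
  then show ?thesis using integral_density[OF True g(1)] by simp
next
  case False
  have "(\<lambda>x. g x * f x) \<notin> borel_measurable M"
  proof
    assume "(\<lambda>x. g x * f x) \<in> borel_measurable M"
    then have "(\<lambda>x. (g x * f x) / g x) \<in> borel_measurable M"
      by (rule borel_measurable_divide[OF _ g(1)])
    also have "(\<lambda>x. (g x * f x) / g x) \<in> borel_measurable M \<longleftrightarrow> f \<in> borel_measurable M"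
      by (rule measurable_cong) (use g(2) in force)
    finally show False using False by simp
  qed
  moreover have "f \<notin> borel_measurable (density M (\<lambda>x. ennreal (g x)))" using False by simp
  ultimately show ?thesis
    by (metis borel_measurable_integrable not_integrable_integral_eq)
qed

lemma C_on_Un:
  assumes "open S" "open T" "C_on k S f" "C_on k T f"
  shows "C_on k (S \<union> T) f"
  using assms(3,4)
  by (induction k arbitrary: f) (auto intro: continuous_on_open_Un assms(1,2))

section \<open>The volume measure of a closed immersed manifold\<close>

locale closed_immersed =
  fixes M :: "'a::t2_space set" and \<A> :: "('a, 4) chart set" and \<Phi> :: "'a \<Rightarrow> real^'m::finite"
  assumes closed_manifold: "closed_manifold M \<A>" and smooth_immersion: "smooth_immersion \<A> \<Phi>"
begin

abbreviation "coord_dom c \<equiv> fst c"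
abbreviation "coord_img c \<equiv> snd c ` fst c"
abbreviation "back c \<equiv> inv_into (fst c) (snd c)"
abbreviation "rep c \<equiv> local_rep c \<Phi>"
abbreviation "vol_density c x \<equiv> sqrt (det (metric (rep c) x))"
abbreviation "borelM \<equiv> restrict_space borel M"

lemma local_rep_eq: "local_rep c f x = f (back c x)"
  by (simp add: local_rep_def case_prod_unfold)

lemma compact_M: "compact M" using closed_manifold by (simp add: closed_manifold_def)
lemma M_borel: "M \<in> sets borel" using compact_imp_closed[OF compact_M] by simp
lemma union_dom: "(\<Union>c\<in>\<A>. coord_dom c) = M" using closed_manifold by (simp add: closed_manifold_def)

lemma chart:
  assumes "c \<in> \<A>"
  shows "openin (top_of_set M) (coord_dom c)" "open (coord_img c)" "homeomorphism (coord_dom c) (coord_img c) (snd c) (back c)"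
  using closed_manifold assms by (auto simp: closed_manifold_def chart_on_def case_prod_unfold)

lemma dom_subset: "c \<in> \<A> \<Longrightarrow> coord_dom c \<subseteq> M" using union_dom by auto

lemma back_chart [simp]: "c \<in> \<A> \<Longrightarrow> q \<in> coord_dom c \<Longrightarrow> back c (snd c q) = q"
  using chart(3)[of c] by (simp add: homeomorphism_def)

lemma chart_back [simp]: "c \<in> \<A> \<Longrightarrow> x \<in> coord_img c \<Longrightarrow> snd c (back c x) = x"
  by (rule f_inv_into_f)

lemma back_in: "c \<in> \<A> \<Longrightarrow> x \<in> coord_img c \<Longrightarrow> back c x \<in> coord_dom c"
  by (rule inv_into_into)

lemma continuous_back: "c \<in> \<A> \<Longrightarrow> continuous_on (coord_img c) (back c)"
  using chart(3)[of c] by (simp add: homeomorphism_def)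

lemma continuous_chart: "c \<in> \<A> \<Longrightarrow> continuous_on (coord_dom c) (snd c)"
  using chart(3)[of c] by (simp add: homeomorphism_def)

lemma open_chart_image:
  assumes c: "c \<in> \<A>" and W: "openin (top_of_set M) W"
  shows "open (snd c ` (coord_dom c \<inter> W))"
proof -
  obtain T where T: "open T" "W = M \<inter> T" using W by (auto simp: openin_open)
  have "snd c ` (coord_dom c \<inter> W) = back c -` T \<inter> coord_img c"
    using T dom_subset[OF c] c by (force simp: image_iff)
  moreover have "open (back c -` T \<inter> coord_img c)"
    using continuous_on_open_vimage[OF chart(2)[OF c]] continuous_back[OF c] T(1) by blast
  ultimately show ?thesis by simp
qed

lemma patch_rep: "c \<in> \<A> \<Longrightarrow> patch (coord_img c) (rep c)"
  using smooth_immersion chart(2)[of c] by unfold_locales (auto simp: smooth_immersion_def)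

lemma transition:
  assumes c: "c \<in> \<A>" and d: "d \<in> \<A>"
  shows "smooth_on (snd c ` (coord_dom c \<inter> coord_dom d)) (snd d \<circ> back c)" "open (snd c ` (coord_dom c \<inter> coord_dom d))"
proof -
  show "smooth_on (snd c ` (coord_dom c \<inter> coord_dom d)) (snd d \<circ> back c)"
    using closed_manifold c d unfolding closed_manifold_def by (auto simp: case_prod_unfold)
  show "open (snd c ` (coord_dom c \<inter> coord_dom d))" by (rule open_chart_image[OF c chart(1)[OF d]])
qed

lemma reparametrization_transition:
  assumes c: "c \<in> \<A>" and d: "d \<in> \<A>"
  shows "reparametrization (snd c ` (coord_dom c \<inter> coord_dom d)) (rep c) (coord_img d) (rep d) (\<lambda>x. snd d (back c x))"
proof -
  interpret C: patch "coord_img c" "rep c" by (rule patch_rep[OF c])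
  interpret C': patch "snd c ` (coord_dom c \<inter> coord_dom d)" "rep c"
    by (rule C.patch_subset[OF transition(2)[OF c d]]) auto
  interpret D: patch "coord_img d" "rep d" by (rule patch_rep[OF d])
  show ?thesis
    by unfold_locales (use transition(1)[OF c d] c d in \<open>auto simp: o_def local_rep_eq\<close>)
qed

lemma borel_iff: "B \<in> sets borelM \<longleftrightarrow> B \<in> sets borel \<and> B \<subseteq> M"
  using M_borel by (auto simp: sets_restrict_space_iff)

lemma dom_borel: "c \<in> \<A> \<Longrightarrow> coord_dom c \<in> sets borelM"
  using chart(1)[of c] M_borel dom_subset[of c] by (auto simp: openin_open borel_iff)

lemma measurable_back:
  assumes c: "c \<in> \<A>" shows "back c \<in> measurable (restrict_space borel (coord_img c)) borelM"
proof (rule measurable_restrict_space2)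
  show "back c \<in> space (restrict_space borel (coord_img c)) \<rightarrow> M"
    using back_in[OF c] dom_subset[OF c] by (auto simp: space_restrict_space)
  show "back c \<in> borel_measurable (restrict_space borel (coord_img c))"
    by (rule borel_measurable_continuous_on_restrict[OF continuous_back[OF c]])
qed

lemma chart_image_eq: "c \<in> \<A> \<Longrightarrow> snd c ` (B \<inter> coord_dom c) = back c -` B \<inter> coord_img c"
  by (force simp: image_iff)

lemma chart_image_borel:
  assumes c: "c \<in> \<A>" and B: "B \<in> sets borelM" shows "snd c ` (B \<inter> coord_dom c) \<in> sets borel"
proof -
  have "back c -` B \<inter> space (restrict_space borel (coord_img c)) \<in> sets (restrict_space borel (coord_img c))"
    by (rule measurable_sets[OF measurable_back[OF c] B])
  then show ?thesis using chart(2)[OF c] unfolding chart_image_eq[OF c]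
    by (simp add: sets_restrict_space_iff space_restrict_space)
qed

lemma continuous_vol_density: "c \<in> \<A> \<Longrightarrow> continuous_on (coord_img c) (vol_density c)"
  using patch.C_volume[OF patch_rep] C_on_continuous by blast

lemma vol_density_pos: "c \<in> \<A> \<Longrightarrow> x \<in> coord_img c \<Longrightarrow> 0 < vol_density c x"
  using patch.det_metric_pos[OF patch_rep] by simp

lemma measurable_vol_density: "c \<in> \<A> \<Longrightarrow> (vol_density c) \<in> borel_measurable (restrict_space borel (coord_img c))"
  by (rule borel_measurable_continuous_on_restrict[OF continuous_vol_density])


definition chart_measure :: "('a, 4) chart \<Rightarrow> 'a measure" where
  "chart_measure c = distr (density (restrict_space lborel (coord_img c)) (\<lambda>x. ennreal (vol_density c x))) borelM (back c)"

lemma sets_lborel_img: "sets (restrict_space lborel T) = sets (restrict_space borel T)"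
  by (simp add: sets_restrict_space)

lemma measurable_lborel_img: "measurable (restrict_space lborel T) N = measurable (restrict_space borel T) N"
  by (intro measurable_cong_sets sets_lborel_img refl)

lemma sets_chart_measure [simp]: "sets (chart_measure c) = sets borelM"
  by (simp add: chart_measure_def)

lemma nn_integral_chart_measure:
  assumes c: "c \<in> \<A>" and h: "h \<in> borel_measurable borelM"
  shows "(\<integral>\<^sup>+q. h q \<partial>chart_measure c) = (\<integral>\<^sup>+x\<in>coord_img c. ennreal (vol_density c x) * h (back c x) \<partial>lborel)"
proof -
  have mb: "back c \<in> measurable (restrict_space lborel (coord_img c)) borelM"
    using measurable_back[OF c] by (simp add: measurable_lborel_img)
  have mv: "vol_density c \<in> borel_measurable (restrict_space lborel (coord_img c))"
    using measurable_vol_density[OF c] by (simp add: measurable_lborel_img)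
  have "(\<integral>\<^sup>+q. h q \<partial>chart_measure c)
    = (\<integral>\<^sup>+x. ennreal (vol_density c x) * h (back c x) \<partial>restrict_space lborel (coord_img c))"
    unfolding chart_measure_def using mb mv h
    by (subst nn_integral_distr) (auto intro!: nn_integral_density measurable_compose[OF mb h])
  also have "\<dots> = (\<integral>\<^sup>+x\<in>coord_img c. ennreal (vol_density c x) * h (back c x) \<partial>lborel)"
    using chart(2)[OF c] by (subst nn_integral_restrict_space) auto
  finally show ?thesis .
qed

lemma emeasure_chart_measure:
  assumes c: "c \<in> \<A>" and B: "B \<in> sets borelM"
  shows "emeasure (chart_measure c) B = (\<integral>\<^sup>+x\<in>snd c ` (B \<inter> coord_dom c). ennreal (vol_density c x) \<partial>lborel)"
proof -
  have "emeasure (chart_measure c) B = (\<integral>\<^sup>+q. indicator B q \<partial>chart_measure c)"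
    using B by (simp add: nn_integral_indicator)
  also have "\<dots> = (\<integral>\<^sup>+x\<in>coord_img c. ennreal (vol_density c x) * indicator B (back c x) \<partial>lborel)"
    using B by (intro nn_integral_chart_measure[OF c]) auto
  also have "\<dots> = (\<integral>\<^sup>+x\<in>snd c ` (B \<inter> coord_dom c). ennreal (vol_density c x) \<partial>lborel)"
    unfolding chart_image_eq[OF c] by (intro nn_integral_cong) (auto simp: indicator_def)
  finally show ?thesis .
qed

text \<open>The metric determinants in two charts differ by the squared Jacobian determinant of the transition map,
  which is what the change of variables formula requires.\<close>

lemma chart_measure_consistent:
  assumes c: "c \<in> \<A>" and d: "d \<in> \<A>" and B: "B \<in> sets borelM" and sub: "B \<subseteq> coord_dom c" "B \<subseteq> coord_dom d"
  shows "emeasure (chart_measure c) B = emeasure (chart_measure d) B"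
proof -
  interpret R: reparametrization "snd c ` (coord_dom c \<inter> coord_dom d)" "rep c" "coord_img d" "rep d" "\<lambda>x. snd d (back c x)"
    by (rule reparametrization_transition[OF c d])
  let ?\<tau> = "\<lambda>x. snd d (back c x)" and ?S = "snd c ` B"
  have SV: "x \<in> snd c ` (coord_dom c \<inter> coord_dom d)" if "x \<in> ?S" for x using that sub by auto
  have im: "?\<tau> ` ?S = snd d ` B" using sub c by (auto simp: image_iff subset_eq)
  have Bc: "B \<inter> coord_dom c = B" "B \<inter> coord_dom d = B" using sub by auto
  have bor: "?S \<in> sets borel" "snd d ` B \<in> sets borel"
    using chart_image_borel[OF c B] chart_image_borel[OF d B] by (simp_all add: Bc)
  have meas: "set_borel_measurable borel (snd e ` B) (vol_density e)"
    if e: "e \<in> \<A>" and "snd e ` B \<in> sets borel" "B \<subseteq> coord_dom e" for e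
  proof -
    have "snd e ` B \<subseteq> coord_img e" using that by auto
    then have "vol_density e \<in> borel_measurable (restrict_space borel (snd e ` B))"
      by (intro borel_measurable_continuous_on_restrict continuous_on_subset[OF continuous_vol_density[OF e]])
    then show ?thesis using that by (simp add: set_borel_measurable_def borel_measurable_restrict_space_iff)
  qed
  have "(\<integral>\<^sup>+y\<in>?\<tau> ` ?S. ennreal (vol_density d y) \<partial>lborel) = (\<integral>\<^sup>+x\<in>?S. ennreal (vol_density c x) \<partial>lborel)"
  proof (rule nn_integral_change_of_variables[where g' = "\<lambda>x. frechet_derivative ?\<tau> (at x)", OF bor(1)])
    show "set_borel_measurable borel (?\<tau> ` ?S) (vol_density d)" unfolding im by (rule meas[OF d bor(2) sub(2)])
    show "0 \<le> vol_density d y" if "y \<in> ?\<tau> ` ?S" for y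
      using that sub(2) unfolding im by (intro less_imp_le vol_density_pos[OF d]) auto
    show "set_borel_measurable borel ?S (vol_density c)" by (rule meas[OF c bor(1) sub(1)])
    show "vol_density c x = \<bar>det (matrix (frechet_derivative ?\<tau> (at x)))\<bar> * vol_density d (?\<tau> x)" if "x \<in> ?S" for x
    proof -
      have "matrix (frechet_derivative ?\<tau> (at x)) = (\<chi> a i. R.J x a i)"
        by (simp add: matrix_def pd_def)
      then show ?thesis by (simp add: R.det_metric_pullback[OF SV[OF that]] real_sqrt_mult)
    qed
    show "(?\<tau> has_derivative frechet_derivative ?\<tau> (at x)) (at x)" if "x \<in> ?S" for x
      by (rule pd_works[OF R.diff_\<tau>[OF SV[OF that]]])
    show "inj_on ?\<tau> ?S"
    proof (rule inj_onI, elim imageE)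
      fix x y p p' assume eq: "?\<tau> x = ?\<tau> y" and p: "x = snd c p" "p \<in> B" "y = snd c p'" "p' \<in> B"
      moreover have "p \<in> coord_dom c" "p' \<in> coord_dom c" using p sub(1) by blast+
      ultimately have "snd d p = snd d p'" using c by simp
      then have "back d (snd d p) = back d (snd d p')" by simp
      moreover have "p \<in> coord_dom d" "p' \<in> coord_dom d" using p sub(2) by blast+
      ultimately show "x = y" using p d by simp
    qed
  qed
  then show ?thesis unfolding emeasure_chart_measure[OF c B] emeasure_chart_measure[OF d B] Bc im by simp
qed

lemma finite_atlas:
  obtains C where "finite C" "C \<subseteq> \<A>" "(\<Union>c\<in>C. coord_dom c) = M"
proof -
  have "\<forall>c\<in>\<A>. \<exists>T. open T \<and> coord_dom c = M \<inter> T" using chart(1) by (auto simp: openin_open)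
  then obtain T where T: "\<And>c. c \<in> \<A> \<Longrightarrow> open (T c) \<and> coord_dom c = M \<inter> T c" by metis
  have "M \<subseteq> (\<Union>c\<in>\<A>. T c)" using union_dom T by blast
  with compactE_image[OF compact_M, of \<A> T] obtain C where "C \<subseteq> \<A>" "finite C" "M \<subseteq> (\<Union>c\<in>C. T c)"
    using T by metis
  then have "(\<Union>c\<in>C. coord_dom c) = M" using T by blast
  then show ?thesis using that \<open>finite C\<close> \<open>C \<subseteq> \<A>\<close> by blast
qed

text \<open>A finite subatlas cuts the manifold into disjoint Borel pieces, each inside one chart: the piece of a
  chart consists of the points that lie in no earlier chart.\<close>

lemma disjoint_pieces:
  obtains n cs A where "\<forall>k<n::nat. cs k \<in> \<A> \<and> A k \<in> sets borelM \<and> A k \<subseteq> coord_dom (cs k)"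
    "disjoint_family_on A {..<n}" "(\<Union>k<n. A k) = M"
proof -
  obtain C where C: "finite C" "C \<subseteq> \<A>" "(\<Union>c\<in>C. coord_dom c) = M" by (rule finite_atlas)
  obtain n cs where cs: "C = cs ` {k. k < (n::nat)}" using C(1) by (metis finite_imp_nat_seg_image_inj_on)
  define A where "A k = coord_dom (cs k) - (\<Union>j<k. coord_dom (cs j))" for k
  have in_A: "cs k \<in> \<A>" if "k < n" for k using that cs C(2) by auto
  show ?thesis
  proof (rule that[of n cs A])
    have "A k \<in> sets borelM" if "k < n" for k
      unfolding A_def using that in_A dom_borel by (intro sets.Diff sets.finite_UN) auto
    then show "\<forall>k<n. cs k \<in> \<A> \<and> A k \<in> sets borelM \<and> A k \<subseteq> coord_dom (cs k)"
      using in_A by (auto simp: A_def)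
    have "A i \<inter> A j = {}" if "i \<noteq> j" for i j
      using that by (cases i j rule: linorder_cases) (auto simp: A_def)
    then show "disjoint_family_on A {..<n}" by (simp add: disjoint_family_on_def)
    show "(\<Union>k<n. A k) = M"
    proof
      show "(\<Union>k<n. A k) \<subseteq> M" using dom_subset[OF in_A] unfolding A_def by blast
      show "M \<subseteq> (\<Union>k<n. A k)"
      proof
        fix q assume "q \<in> M"
        then obtain k where k: "k < n" "q \<in> coord_dom (cs k)" using C(3) cs by auto
        define l where "l = (LEAST k. q \<in> coord_dom (cs k))"
        have "q \<in> coord_dom (cs l)" unfolding l_def by (rule LeastI[of "\<lambda>k. q \<in> coord_dom (cs k)", OF k(2)])
        moreover have "l \<le> k" unfolding l_def by (rule Least_le[of "\<lambda>k. q \<in> coord_dom (cs k)", OF k(2)])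
        moreover have "q \<notin> coord_dom (cs j)" if "j < l" for j using that not_less_Least unfolding l_def by blast
        ultimately show "q \<in> (\<Union>k<n. A k)" using k(1) by (auto simp: A_def intro!: bexI[of _ l])
      qed
    qed
  qed
qed

text \<open>The property by which \<open>volume_measure\<close> is described.\<close>

definition volume_spec :: "'a measure \<Rightarrow> bool" where
  "volume_spec \<mu> \<longleftrightarrow> sets \<mu> = sets borelM \<and> (\<forall>c\<in>\<A>. \<forall>B\<in>sets borelM. B \<subseteq> coord_dom c \<longrightarrow>
        emeasure \<mu> B = (\<integral>\<^sup>+x\<in>snd c ` B. ennreal (vol_density c x) \<partial>lborel))"

lemma volume_spec_chart_measure:
  "volume_spec \<mu> \<Longrightarrow> c \<in> \<A> \<Longrightarrow> B \<in> sets borelM \<Longrightarrow> B \<subseteq> coord_dom c \<Longrightarrow>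
    emeasure \<mu> B = emeasure (chart_measure c) B"
  by (simp add: volume_spec_def emeasure_chart_measure Int_absorb2)

text \<open>The measure is glued from the chart measures along the disjoint pieces. Consistency of the chart
  measures gives the required value on subsets of every chart of the atlas.\<close>

lemma volume_spec_exists: "\<exists>\<mu>. volume_spec \<mu>"
proof -
  obtain n cs A where *: "\<forall>k<n::nat. cs k \<in> \<A> \<and> A k \<in> sets borelM \<and> A k \<subseteq> coord_dom (cs k)"
    and A': "disjoint_family_on A {..<n}" "(\<Union>k<n. A k) = M" by (rule disjoint_pieces)
  then have cs: "\<And>k. k < n \<Longrightarrow> cs k \<in> \<A>" and A: "\<And>k. k < n \<Longrightarrow> A k \<in> sets borelM"
    "\<And>k. k < n \<Longrightarrow> A k \<subseteq> coord_dom (cs k)" "disjoint_family_on A {..<n}" "(\<Union>k<n. A k) = M" by auto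
  define m where "m B = (\<Sum>k<n. emeasure (chart_measure (cs k)) (B \<inter> A k))" for B
  define \<mu> where "\<mu> = measure_of M (sets borelM) m"
  have sp: "space borelM = M" by (simp add: space_restrict_space)
  have sets_\<mu>: "sets \<mu> = sets borelM"
    unfolding \<mu>_def using sets.sets_measure_of_eq[of borelM] by (simp add: sp)
  have em: "emeasure \<mu> B = m B" if B: "B \<in> sets borelM" for B
    unfolding \<mu>_def
  proof (rule emeasure_measure_of_sigma[OF _ _ _ B])
    show "sigma_algebra M (sets borelM)" using sets.sigma_algebra_axioms[of borelM] by (simp add: sp)
    show "positive (sets borelM) m" by (simp add: positive_def m_def)
    show "countably_additive (sets borelM) m"
    proof (rule countably_additiveI)
      fix F :: "nat \<Rightarrow> 'a set" assume F: "range F \<subseteq> sets borelM" "disjoint_family F"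
      have "(\<Sum>i. m (F i)) = (\<Sum>k<n. \<Sum>i. emeasure (chart_measure (cs k)) (F i \<inter> A k))"
        unfolding m_def by (rule suminf_sum) simp
      also have "\<dots> = m (\<Union>i. F i)"
        unfolding m_def
      proof (rule sum.cong[OF refl])
        fix k assume k: "k \<in> {..<n}"
        have "(\<Sum>i. emeasure (chart_measure (cs k)) (F i \<inter> A k)) = emeasure (chart_measure (cs k)) (\<Union>i. F i \<inter> A k)"
          using F A(1) k by (intro suminf_emeasure) (auto simp: disjoint_family_on_def)
        then show "(\<Sum>i. emeasure (chart_measure (cs k)) (F i \<inter> A k)) = emeasure (chart_measure (cs k)) ((\<Union>i. F i) \<inter> A k)"
          by simp
      qed
      finally show "(\<Sum>i. m (F i)) = m (\<Union>i. F i)" .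
    qed
  qed
  have "volume_spec \<mu>"
    unfolding volume_spec_def
  proof (intro conjI ballI impI sets_\<mu>)
    fix c B assume c: "c \<in> \<A>" and B: "B \<in> sets borelM" "B \<subseteq> coord_dom c"
    have "m B = (\<Sum>k<n. emeasure (chart_measure c) (B \<inter> A k))"
      unfolding m_def using B A cs c by (intro sum.cong refl chart_measure_consistent) auto
    also have "\<dots> = emeasure (chart_measure c) (\<Union>k<n. B \<inter> A k)"
    proof (rule sum_emeasure)
      show "disjoint_family_on (\<lambda>k. B \<inter> A k) {..<n}"
        using A(3) unfolding disjoint_family_on_def by blast
    qed (use A(1) B in auto)
    also have "(\<Union>k<n. B \<inter> A k) = B" using A(4) B borel_iff by blast
    finally show "emeasure \<mu> B = (\<integral>\<^sup>+x\<in>snd c ` B. ennreal (vol_density c x) \<partial>lborel)"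
      using em[OF B(1)] emeasure_chart_measure[OF c B(1)] B(2) by (simp add: Int_absorb2)
  qed
  then show ?thesis ..
qed

lemma volume_spec_unique:
  assumes \<mu>: "volume_spec \<mu>" and \<nu>: "volume_spec \<nu>" shows "\<mu> = \<nu>"
proof (rule measure_eqI)
  obtain n cs A where *: "\<forall>k<n::nat. cs k \<in> \<A> \<and> A k \<in> sets borelM \<and> A k \<subseteq> coord_dom (cs k)"
    and A': "disjoint_family_on A {..<n}" "(\<Union>k<n. A k) = M" by (rule disjoint_pieces)
  then have cs: "\<And>k. k < n \<Longrightarrow> cs k \<in> \<A>" and A: "\<And>k. k < n \<Longrightarrow> A k \<in> sets borelM"
    "\<And>k. k < n \<Longrightarrow> A k \<subseteq> coord_dom (cs k)" "disjoint_family_on A {..<n}" "(\<Union>k<n. A k) = M" by auto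
  show "sets \<mu> = sets \<nu>" using \<mu> \<nu> by (simp add: volume_spec_def)
  fix B assume "B \<in> sets \<mu>"
  then have B: "B \<in> sets borelM" using \<mu> by (simp add: volume_spec_def)
  have "emeasure \<kappa> B = (\<Sum>k<n. emeasure (chart_measure (cs k)) (B \<inter> A k))" if \<kappa>: "volume_spec \<kappa>" for \<kappa>
  proof -
    have "(\<Union>k<n. B \<inter> A k) = B" using A(4) B borel_iff by blast
    moreover have "disjoint_family_on (\<lambda>k. B \<inter> A k) {..<n}"
      using A(3) unfolding disjoint_family_on_def by blast
    moreover have "(\<lambda>k. B \<inter> A k) ` {..<n} \<subseteq> sets \<kappa>"
      using A(1) B \<kappa> by (auto simp: volume_spec_def)
    ultimately have "emeasure \<kappa> B = (\<Sum>k<n. emeasure \<kappa> (B \<inter> A k))"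
      using sum_emeasure[of "\<lambda>k. B \<inter> A k" "{..<n}" \<kappa>] by simp
    also have "\<dots> = (\<Sum>k<n. emeasure (chart_measure (cs k)) (B \<inter> A k))"
      using A B cs by (intro sum.cong refl volume_spec_chart_measure[OF \<kappa>]) auto
    finally show ?thesis .
  qed
  then show "emeasure \<mu> B = emeasure \<nu> B" using \<mu> \<nu> by simp
qed

lemma volume_spec_volume_measure: "volume_spec (volume_measure M \<A> \<Phi>)"
  and volume_measure_eqI: "volume_spec \<mu> \<Longrightarrow> volume_measure M \<A> \<Phi> = \<mu>"
proof -
  have eq: "volume_measure M \<A> \<Phi> = (THE \<mu>. volume_spec \<mu>)"
    unfolding volume_measure_def volume_spec_def ..
  show "volume_spec \<mu> \<Longrightarrow> volume_measure M \<A> \<Phi> = \<mu>" for \<mu>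
    unfolding eq using volume_spec_unique by blast
  show "volume_spec (volume_measure M \<A> \<Phi>)"
    unfolding eq using volume_spec_exists volume_spec_unique by (metis theI)
qed

abbreviation "vol \<equiv> volume_measure M \<A> \<Phi>"

lemma sets_vol: "sets vol = sets borelM"
  using volume_spec_volume_measure by (simp add: volume_spec_def)

lemma space_vol: "space vol = M"
  using sets_eq_imp_space_eq[OF sets_vol] by (simp add: space_restrict_space)

lemma chart_measure_density: assumes c: "c \<in> \<A>" shows "chart_measure c = density vol (indicator (coord_dom c))"
proof (rule measure_eqI)
  show "sets (chart_measure c) = sets (density vol (indicator (coord_dom c)))" by (simp add: sets_vol)
  fix B assume "B \<in> sets (chart_measure c)"
  then have B: "B \<in> sets borelM" by simp
  have "emeasure (density vol (indicator (coord_dom c))) B = (\<integral>\<^sup>+q. indicator (coord_dom c) q * indicator B q \<partial>vol)"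
    using B dom_borel[OF c] by (intro emeasure_density borel_measurable_indicator) (simp_all add: sets_vol)
  also have "\<dots> = (\<integral>\<^sup>+q. indicator (B \<inter> coord_dom c) q \<partial>vol)"
    by (intro nn_integral_cong) (auto simp: indicator_def)
  also have "\<dots> = emeasure vol (B \<inter> coord_dom c)"
    using B dom_borel[OF c] by (intro nn_integral_indicator) (simp add: sets_vol)
  also have "\<dots> = emeasure (chart_measure c) (B \<inter> coord_dom c)"
    using B dom_borel[OF c] by (intro volume_spec_chart_measure[OF volume_spec_volume_measure c]) auto
  also have "\<dots> = emeasure (chart_measure c) B"
    using B dom_borel[OF c] by (simp add: emeasure_chart_measure[OF c])
  finally show "emeasure (chart_measure c) B = emeasure (density vol (indicator (coord_dom c))) B" by simp
qed

lemma chart_integral: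
  assumes c: "c \<in> \<A>" and h: "continuous_on (coord_img c) (\<lambda>x. h (back c x))"
    and int: "has_bochner_integral lborel (\<lambda>x. indicator (coord_img c) x * (vol_density c x * h (back c x))) v"
  shows "has_bochner_integral vol (\<lambda>q. indicator (coord_dom c) q * h q) (v::real)"
proof -
  define h' where "h' q = indicator (coord_dom c) q * h q" for q
  have mb: "back c \<in> measurable (restrict_space lborel (coord_img c)) borelM"
    using measurable_back[OF c] by (simp add: measurable_lborel_img)
  have mv: "vol_density c \<in> borel_measurable (restrict_space lborel (coord_img c))"
    using measurable_vol_density[OF c] by (simp add: measurable_lborel_img)
  have pos: "AE x in restrict_space lborel (coord_img c). 0 \<le> vol_density c x"
    using vol_density_pos[OF c] by (intro AE_I2) (simp add: space_restrict_space less_imp_le)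
  have h': "h' \<in> borel_measurable borelM"
  proof -
    have "continuous_on (coord_dom c) (\<lambda>q. h (back c (snd c q)))"
      by (rule continuous_on_compose2[OF h continuous_chart[OF c]]) auto
    then have "continuous_on (coord_dom c) h" by (rule continuous_on_eq) (simp add: c)
    then have "h \<in> borel_measurable (restrict_space borel (coord_dom c))"
      by (rule borel_measurable_continuous_on_restrict)
    moreover have "restrict_space borel (coord_dom c) = restrict_space borelM (coord_dom c)"
      using dom_subset[OF c] by (simp add: restrict_restrict_space Int_absorb1 dom_borel[OF c] M_borel Int_absorb2
        borel_iff[THEN iffD1, OF dom_borel[OF c]])
    ultimately show ?thesis
      using dom_borel[OF c] borel_measurable_restrict_space_iff[of "coord_dom c" borelM h]
      by (simp add: h'_def[abs_def] space_restrict_space dom_subset[OF c] Int_absorb2)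
  qed
  have bb: "integrable lborel (\<lambda>x. indicator (coord_img c) x *\<^sub>R (vol_density c x * h' (back c x)))"
    "(\<integral>x. indicator (coord_img c) x *\<^sub>R (vol_density c x * h' (back c x)) \<partial>lborel) = v"
  proof -
    have "(\<lambda>x. indicator (coord_img c) x *\<^sub>R (vol_density c x * h' (back c x)))
        = (\<lambda>x. indicator (coord_img c) x * (vol_density c x * h (back c x)))"
      using back_in[OF c] by (auto simp: fun_eq_iff indicator_def h'_def)
    then show "integrable lborel (\<lambda>x. indicator (coord_img c) x *\<^sub>R (vol_density c x * h' (back c x)))"
      "(\<integral>x. indicator (coord_img c) x *\<^sub>R (vol_density c x * h' (back c x)) \<partial>lborel) = v"
      using int by (auto simp: has_bochner_integral_iff)
  qed
  have img: "coord_img c \<inter> space lborel \<in> sets lborel" using chart(2)[OF c] by simp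
  have mh: "(\<lambda>x. h' (back c x)) \<in> borel_measurable (restrict_space lborel (coord_img c))"
    by (rule measurable_compose[OF mb h'])
  have 1: "integrable (chart_measure c) h'" "integral\<^sup>L (chart_measure c) h' = v"
    unfolding chart_measure_def using bb mb mv pos mh h' img
    by (simp_all add: integrable_distr_eq integral_distr integrable_density integral_density
      integrable_restrict_space integral_restrict_space)
  have ind: "AE q in vol. 0 \<le> indicat_real (coord_dom c) q" by simp
  have mvol: "h' \<in> borel_measurable vol" "indicat_real (coord_dom c) \<in> borel_measurable vol"
    using h' dom_borel[OF c] by (auto simp: measurable_cong_sets[OF sets_vol refl])
  have dens: "chart_measure c = density vol (\<lambda>q. ennreal (indicat_real (coord_dom c) q))"
    unfolding chart_measure_density[OF c] by (intro arg_cong[where f="density vol"]) (auto simp: indicator_def)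
  have "integrable vol (\<lambda>q. indicat_real (coord_dom c) q *\<^sub>R h' q)" "(\<integral>q. indicat_real (coord_dom c) q *\<^sub>R h' q \<partial>vol) = v"
    using 1 unfolding dens integrable_density[OF mvol ind] integral_density[OF mvol ind] by auto
  moreover have "(\<lambda>q. indicat_real (coord_dom c) q *\<^sub>R h' q) = h'" by (auto simp: h'_def indicator_def fun_eq_iff)
  ultimately show ?thesis by (simp only: has_bochner_integral_iff h'_def[abs_def])
qed

end


section \<open>The divergence theorem on a closed immersed manifold\<close>

lemma C_on_1_square_pos: "C_on 1 UNIV (\<lambda>u::real. (max 0 u)\<^sup>2)"
proof -
  have der: "((\<lambda>u::real. (max 0 u)\<^sup>2) has_derivative (\<lambda>v. 2 * max 0 u * v)) (at u)" for u
  proof -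
    consider "u < 0" | "u = 0" | "u > 0" by linarith
    then show ?thesis
    proof cases
      case 1
      show ?thesis
        by (rule has_derivative_transform_within_open[where f="\<lambda>_. 0" and s="{..<0}"]) (use 1 in auto)
    next
      case 3
      have "((\<lambda>u::real. u\<^sup>2) has_derivative (\<lambda>v. 2 * max 0 u * v)) (at u)"
        using 3 by (auto intro!: derivative_eq_intros)
      then show ?thesis
        by (rule has_derivative_transform_within_open[where s="{0<..}"]) (use 3 in auto)
    next
      case 2
      have "((\<lambda>u::real. (max 0 u)\<^sup>2) has_real_derivative 0) (at 0)"
        unfolding DERIV_def
      proof (rule Lim_null_comparison)
        show "\<forall>\<^sub>F h in at 0. norm (((max 0 (0 + h))\<^sup>2 - (max 0 (0::real))\<^sup>2) / h) \<le> \<bar>h\<bar>"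
          by (intro always_eventually allI) (auto simp: max_def power2_eq_square)
        show "((\<lambda>h::real. \<bar>h\<bar>) \<longlongrightarrow> 0) (at 0)" by (rule tendsto_rabs_zero) (rule tendsto_ident_at)
      qed
      moreover have "(*) (0::real) = (\<lambda>v. 0)" by auto
      ultimately show ?thesis using 2 by (simp add: has_field_derivative_def)
    qed
  qed
  show ?thesis unfolding One_nat_def
    by (rule C_on_SucI[OF open_UNIV der]) (auto intro!: continuous_intros)
qed

context closed_immersed
begin

text \<open>The squared positive part makes the function continuously differentiable across the boundary sphere of
  its support.\<close>

definition bump :: "('a, 4) chart \<Rightarrow> real^4 \<Rightarrow> real \<Rightarrow> 'a \<Rightarrow> real" where
  "bump c y \<rho> q = (if q \<in> coord_dom c then (max 0 (\<rho>\<^sup>2 - (snd c q - y) \<bullet> (snd c q - y)))\<^sup>2 else 0)"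

lemma bump_support:
  assumes c: "c \<in> \<A>" and ball: "cball y \<rho> \<subseteq> coord_img c" and \<rho>: "0 < \<rho>"
  shows "compact (back c ` cball y \<rho>)" "back c ` cball y \<rho> \<subseteq> coord_dom c"
    "q \<notin> back c ` cball y \<rho> \<Longrightarrow> bump c y \<rho> q = 0"
proof -
  show "compact (back c ` cball y \<rho>)"
    by (intro compact_continuous_image continuous_on_subset[OF continuous_back[OF c] ball] compact_cball)
  show "back c ` cball y \<rho> \<subseteq> coord_dom c" using ball back_in[OF c] by blast
  show "bump c y \<rho> q = 0" if q: "q \<notin> back c ` cball y \<rho>"
  proof (cases "q \<in> coord_dom c")
    case True
    have "snd c q \<notin> cball y \<rho>" using q back_chart[OF c True] by (metis imageI)
    then have "\<rho> < norm (snd c q - y)" by (simp add: dist_norm norm_minus_commute)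
    then have "\<rho>\<^sup>2 \<le> (norm (snd c q - y))\<^sup>2" using \<rho> by (intro power_mono) auto
    then show ?thesis by (simp add: bump_def power2_norm_eq_inner)
  qed (simp add: bump_def)
qed

text \<open>In another chart the function is a composition with the transition map on the overlap, and it vanishes
  off the support, which is compact and hence closed in the manifold. The two regions are open and cover
  the coordinate image.\<close>

lemma C_on_bump:
  assumes c: "c \<in> \<A>" and d: "d \<in> \<A>" and ball: "cball y \<rho> \<subseteq> coord_img c" and \<rho>: "0 < \<rho>"
  shows "C_on 1 (coord_img d) (local_rep d (bump c y \<rho>))"
proof -
  let ?K = "back c ` cball y \<rho>"
  let ?V1 = "snd d ` (coord_dom d \<inter> coord_dom c)" and ?V2 = "snd d ` (coord_dom d \<inter> (M - ?K))"
  have V1: "open ?V1" by (rule transition(2)[OF d c])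
  have "closed ?K" by (rule compact_imp_closed[OF bump_support(1)[OF c ball \<rho>]])
  then have "openin (top_of_set M) (M - ?K)" by (auto simp: openin_open intro!: exI[of _ "- ?K"])
  then have V2: "open ?V2" by (rule open_chart_image[OF d])
  have "C_on 1 ?V1 (\<lambda>x. snd c (back d x))"
    using smooth_onD[OF transition(1)[OF d c]] by (simp add: o_def)
  then have "C_on 1 ?V1 (\<lambda>x. \<rho>\<^sup>2 - (snd c (back d x) - y) \<bullet> (snd c (back d x) - y))"
    by (intro C_on_diff C_on_inner C_on_const V1)
  from C_on_compose[OF V1 C_on_1_square_pos this]
  have "C_on 1 ?V1 (\<lambda>x. (max 0 (\<rho>\<^sup>2 - (snd c (back d x) - y) \<bullet> (snd c (back d x) - y)))\<^sup>2)" by simp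
  then have 1: "C_on 1 ?V1 (local_rep d (bump c y \<rho>))"
    by (rule C_on_cong[OF V1]) (use d in \<open>auto simp: local_rep_eq bump_def\<close>)
  have 2: "C_on 1 ?V2 (local_rep d (bump c y \<rho>))"
    by (rule C_on_cong[OF V2 C_on_const[of _ _ 0]])
      (use d bump_support(3)[OF c ball \<rho>] in \<open>auto simp: local_rep_eq\<close>)
  have "coord_img d = ?V1 \<union> ?V2" using bump_support(2)[OF c ball \<rho>] dom_subset[OF d] by blast
  then show ?thesis using C_on_Un[OF V1 V2 1 2] by simp
qed

text \<open>The chart at a point that \<open>energy_density\<close> selects.\<close>

definition chart_at :: "'a \<Rightarrow> ('a, 4) chart" where
  "chart_at q = (SOME c. c \<in> \<A> \<and> q \<in> coord_dom c)"

lemma chart_at: "q \<in> M \<Longrightarrow> chart_at q \<in> \<A>" "q \<in> M \<Longrightarrow> q \<in> coord_dom (chart_at q)"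
proof -
  assume "q \<in> M"
  then have "\<exists>c. c \<in> \<A> \<and> q \<in> coord_dom c" using union_dom by auto
  from someI_ex[OF this] show "chart_at q \<in> \<A>" "q \<in> coord_dom (chart_at q)" by (auto simp: chart_at_def)
qed

definition global_div :: "('a \<Rightarrow> real^'m) \<Rightarrow> 'a \<Rightarrow> real" where
  "global_div f q = (if q \<in> M then surface_div (rep (chart_at q)) (local_rep (chart_at q) f) (snd (chart_at q) q) else 0)"

definition C1_field :: "('a \<Rightarrow> real^'m) \<Rightarrow> bool" where
  "C1_field f \<longleftrightarrow> (\<forall>c\<in>\<A>. C_on 1 (coord_img c) (local_rep c f))"

lemma div_in_chart:
  assumes f: "C1_field f" and c: "c \<in> \<A>" and q: "q \<in> coord_dom c"
  shows "global_div f q = surface_div (rep c) (local_rep c f) (snd c q)"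
proof -
  have qM: "q \<in> M" using q dom_subset[OF c] by auto
  let ?d = "chart_at q"
  note d = chart_at[OF qM]
  interpret R: reparametrization "snd ?d ` (coord_dom ?d \<inter> coord_dom c)" "rep ?d" "coord_img c" "rep c" "\<lambda>x. snd c (back ?d x)"
    by (rule reparametrization_transition[OF d(1) c])
  have "surface_div (rep ?d) (local_rep ?d f) (snd ?d q) = surface_div (rep c) (local_rep c f) (snd c (back ?d (snd ?d q)))"
  proof (rule R.surface_div_pullback)
    show "local_rep c f differentiable (at (snd c (back ?d (snd ?d q))))"
      using f c q d unfolding C1_field_def by (simp add: C_on.simps)
  qed (use q d c in \<open>auto simp: local_rep_eq\<close>)
  then show ?thesis using d qM by (simp add: global_div_def)
qed

lemma div_sum:
  assumes f: "\<And>p. p \<in> P \<Longrightarrow> C1_field (f p)" and q: "q \<in> M"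
  shows "global_div (\<lambda>q. \<Sum>p\<in>P. f p q) q = (\<Sum>p\<in>P. global_div (f p) q)"
proof -
  let ?c = "chart_at q"
  note c = chart_at[OF q]
  have d: "local_rep ?c (f p) differentiable (at (snd ?c q))" if "p \<in> P" for p
    using f[OF that] c unfolding C1_field_def by (simp add: C_on.simps)
  have "local_rep ?c (\<lambda>q. \<Sum>p\<in>P. f p q) = (\<lambda>x. \<Sum>p\<in>P. local_rep ?c (f p) x)"
    by (simp add: fun_eq_iff local_rep_eq)
  then have "pd i (local_rep ?c (\<lambda>q. \<Sum>p\<in>P. f p q)) (snd ?c q) = (\<Sum>p\<in>P. pd i (local_rep ?c (f p)) (snd ?c q))" for i
    using pd_sum[OF d] by simp
  then show ?thesis using q
    by (simp add: global_div_def surface_div_def inner_sum_right) (rule sum.swap)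
qed

definition tangent_field :: "('a \<Rightarrow> real^'m) \<Rightarrow> bool" where
  "tangent_field f \<longleftrightarrow> (\<forall>c\<in>\<A>. \<forall>x\<in>coord_img c. normal_proj (rep c) x (local_rep c f x) = 0)"

lemma tangent_fieldD:
  "tangent_field f \<Longrightarrow> c \<in> \<A> \<Longrightarrow> x \<in> coord_img c \<Longrightarrow> normal_proj (rep c) x (local_rep c f x) = 0"
  unfolding tangent_field_def by blast

text \<open>If the support lies in one chart, the integral is computed there; at points outside this chart the
  field vanishes on a neighbourhood, and so does its divergence.\<close>

lemma integral_div_in_chart:
  assumes f: "C1_field f" "tangent_field f" and c: "c \<in> \<A>"
    and K: "compact K" "K \<subseteq> coord_dom c" "\<And>q. q \<notin> K \<Longrightarrow> f q = 0"
  shows "has_bochner_integral vol (global_div f) 0"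
proof -
  interpret P: patch "coord_img c" "rep c" by (rule patch_rep[OF c])
  let ?h = "\<lambda>q. surface_div (rep c) (local_rep c f) (snd c q)"
  have fc: "C_on 1 (coord_img c) (local_rep c f)" using f(1) c by (simp add: C1_field_def)
  have "C_on 0 (coord_img c) (surface_div (rep c) (local_rep c f))"
    unfolding surface_div_def[abs_def] using fc
    by (intro C_on_sum C_on_inner P.open_S P.C_dual_frame C_on_pd) simp
  then have "continuous_on (coord_img c) (surface_div (rep c) (local_rep c f))" by simp
  then have cont: "continuous_on (coord_img c) (\<lambda>x. ?h (back c x))"
    by (rule continuous_on_eq) (simp add: c)
  have "has_bochner_integral lborel (\<lambda>x. indicator (coord_img c) x *
      (vol_density c x * surface_div (rep c) (local_rep c f) x)) 0"
  proof (rule P.integral_surface_div_compact_support[OF fc])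
    show "normal_proj (rep c) x (local_rep c f x) = 0" if "x \<in> coord_img c" for x
      by (rule tangent_fieldD[OF f(2) c that])
    show "compact (snd c ` K)"
      by (intro compact_continuous_image continuous_on_subset[OF continuous_chart[OF c]] K)
    show "snd c ` K \<subseteq> coord_img c" using K(2) by auto
    show "local_rep c f x = 0" if "x \<in> coord_img c - snd c ` K" for x
    proof -
      have "back c x \<notin> K" using that chart_back[OF c, of x] by (metis DiffD1 DiffD2 imageI)
      then show ?thesis by (simp add: local_rep_eq K(3))
    qed
  qed
  moreover have "indicator (coord_img c) x * (vol_density c x * surface_div (rep c) (local_rep c f) x)
      = indicator (coord_img c) x * (vol_density c x * ?h (back c x))" for x
    using c by (simp add: indicator_def)
  ultimately have "has_bochner_integral vol (\<lambda>q. indicator (coord_dom c) q * ?h q) 0"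
    by (intro chart_integral[OF c cont]) simp
  moreover have "indicator (coord_dom c) q * ?h q = global_div f q" for q
  proof (cases "q \<in> coord_dom c")
    case True then show ?thesis by (simp add: div_in_chart[OF f(1) c])
  next
    case False
    show ?thesis
    proof (cases "q \<in> M")
      case True
      let ?d = "chart_at q"
      note d = chart_at[OF True]
      let ?V = "snd ?d ` (coord_dom ?d \<inter> (M - K))"
      have "openin (top_of_set M) (M - K)" using compact_imp_closed[OF K(1)]
        by (auto simp: openin_open intro!: exI[of _ "- K"])
      then have V: "open ?V" by (rule open_chart_image[OF d(1)])
      have "pd i (local_rep ?d f) (snd ?d q) = pd i (\<lambda>_. 0) (snd ?d q)" for i
        by (rule pd_cong[OF V]) (use True False K d in \<open>auto simp: local_rep_eq\<close>)
      then show ?thesis using False True by (simp add: global_div_def surface_div_def)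
    next
      case False
      then show ?thesis using \<open>q \<notin> coord_dom c\<close> by (simp add: global_div_def)
    qed
  qed
  ultimately show ?thesis by simp
qed

text \<open>The bump functions around finitely many points have a positive sum \<open>B\<close>. The functions \<open>b p / B\<close> decompose
  the field into fields \<open>F p\<close> supported in single charts, each of whose divergences has integral zero.\<close>

theorem divergence_theorem:
  assumes f: "C1_field f" "tangent_field f"
  shows "has_bochner_integral vol (global_div f) 0"
proof -
  have "\<exists>\<rho>>0. cball (snd (chart_at p) p) \<rho> \<subseteq> coord_img (chart_at p)" if "p \<in> M" for p
    using chart(2)[OF chart_at(1)[OF that]] chart_at(2)[OF that] by (auto simp: open_contains_cball)
  then obtain \<rho> where \<rho>: "\<And>p. p \<in> M \<Longrightarrow> \<rho> p > 0"
    "\<And>p. p \<in> M \<Longrightarrow> cball (snd (chart_at p) p) (\<rho> p) \<subseteq> coord_img (chart_at p)" by metis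
  define b where "b p = bump (chart_at p) (snd (chart_at p) p) (\<rho> p)" for p
  define W where "W p = {q \<in> coord_dom (chart_at p). dist (snd (chart_at p) p) (snd (chart_at p) q) < \<rho> p}" for p
  have W: "openin (top_of_set M) (W p)" if p: "p \<in> M" for p
  proof -
    note c = chart_at[OF p]
    have "openin (top_of_set (coord_dom (chart_at p))) (coord_dom (chart_at p) \<inter> snd (chart_at p) -` ball (snd (chart_at p) p) (\<rho> p))"
      by (rule continuous_openin_preimage_gen[OF continuous_chart[OF c(1)]]) simp
    also have "coord_dom (chart_at p) \<inter> snd (chart_at p) -` ball (snd (chart_at p) p) (\<rho> p) = W p"
      by (auto simp: W_def)
    finally show ?thesis using chart(1)[OF c(1)] openin_trans by blast
  qed
  have "\<forall>p\<in>M. \<exists>T. open T \<and> W p = M \<inter> T" using W by (auto simp: openin_open)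
  then obtain T where T: "\<And>p. p \<in> M \<Longrightarrow> open (T p) \<and> W p = M \<inter> T p" by metis
  have self: "p \<in> W p" if "p \<in> M" for p using chart_at[OF that] \<rho>(1)[OF that] by (simp add: W_def)
  have "M \<subseteq> (\<Union>p\<in>M. T p)" using self T by blast
  with compactE_image[OF compact_M, of M T] obtain P where P: "P \<subseteq> M" "finite P" "M \<subseteq> (\<Union>p\<in>P. T p)"
    using T by metis
  define B where "B q = (\<Sum>p\<in>P. b p q)" for q
  have b_nonneg: "0 \<le> b p q" for p q by (simp add: b_def bump_def)
  have B_pos: "0 < B q" if q: "q \<in> M" for q
  proof -
    obtain p where p: "p \<in> P" "q \<in> W p" using P q T by blast
    then have "(norm (snd (chart_at p) q - snd (chart_at p) p))\<^sup>2 < (\<rho> p)\<^sup>2"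
      by (intro power_strict_mono) (auto simp: W_def dist_norm norm_minus_commute)
    then have "0 < b p q" using p by (auto simp: b_def bump_def W_def power2_norm_eq_inner)
    then show ?thesis unfolding B_def using p(1) P(2) b_nonneg by (intro sum_pos2) auto
  qed
  have C_b: "C_on 1 (coord_img d) (local_rep d (b p))" if "p \<in> M" "d \<in> \<A>" for p d
    unfolding b_def using C_on_bump[OF chart_at(1)[OF that(1)] that(2) \<rho>(2,1)[OF that(1)]] .
  define F where "F p q = (b p q * inverse (B q)) *\<^sub>R f q" for p q
  have C_F: "C1_field (F p)" if p: "p \<in> P" for p
    unfolding C1_field_def
  proof
    fix d assume d: "d \<in> \<A>"
    note op = chart(2)[OF d]
    have "C_on 1 (coord_img d) (\<lambda>x. \<Sum>p\<in>P. local_rep d (b p) x)"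
      using P(1) d by (intro C_on_sum op C_b) auto
    moreover have "(\<Sum>p\<in>P. local_rep d (b p) x) = local_rep d B x" for x by (simp add: local_rep_eq B_def)
    ultimately have CB: "C_on 1 (coord_img d) (local_rep d B)" by simp
    have "C_on 1 (coord_img d) (\<lambda>x. (local_rep d (b p) x * inverse (local_rep d B x)) *\<^sub>R local_rep d f x)"
    proof (intro C_on_scaleR C_on_mult C_on_inverse op CB)
      show "C_on 1 (coord_img d) (local_rep d (b p))" using p P(1) d by (intro C_b) auto
      show "C_on 1 (coord_img d) (local_rep d f)" using f(1) d by (simp add: C1_field_def)
      show "local_rep d B x \<noteq> 0" if "x \<in> coord_img d" for x
        using B_pos[of "back d x"] back_in[OF d that] dom_subset[OF d] by (auto simp: local_rep_eq)
    qed
    then show "C_on 1 (coord_img d) (local_rep d (F p))"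
      by (rule C_on_cong[OF op]) (simp add: local_rep_eq F_def)
  qed
  have tan_F: "tangent_field (F p)" for p
    unfolding tangent_field_def
  proof (intro ballI)
    fix d x assume d: "d \<in> \<A>" and x: "x \<in> coord_img d"
    interpret D: patch "coord_img d" "rep d" by (rule patch_rep[OF d])
    show "normal_proj (rep d) x (local_rep d (F p) x) = 0"
      using tangent_fieldD[OF f(2) d x] D.normal_proj_scaleR[OF x] by (simp add: local_rep_eq F_def)
  qed
  have int_F: "has_bochner_integral vol (global_div (F p)) 0" if p: "p \<in> P" for p
  proof -
    have pM: "p \<in> M" using p P(1) by auto
    note s = bump_support[OF chart_at(1)[OF pM] \<rho>(2,1)[OF pM]]
    show ?thesis
      by (rule integral_div_in_chart[OF C_F[OF p] tan_F chart_at(1)[OF pM] s(1,2)]) (simp add: F_def b_def s(3))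
  qed
  have "has_bochner_integral vol (\<lambda>q. \<Sum>p\<in>P. global_div (F p) q) (\<Sum>p\<in>P. 0)"
    by (intro has_bochner_integral_sum int_F)
  moreover have "(\<Sum>p\<in>P. global_div (F p) q) = global_div f q" if q: "q \<in> space vol" for q
  proof -
    have qM: "q \<in> M" using q by (simp add: space_vol)
    let ?c = "chart_at q"
    have "(\<Sum>p\<in>P. global_div (F p) q) = global_div (\<lambda>q. \<Sum>p\<in>P. F p q) q" by (rule div_sum[symmetric, OF C_F qM])
    also have "\<dots> = global_div f q"
    proof -
      have "local_rep ?c (\<lambda>q. \<Sum>p\<in>P. F p q) x = local_rep ?c f x" if "x \<in> coord_img ?c" for x
      proof -
        have "back ?c x \<in> M" using back_in[OF chart_at(1)[OF qM] that] dom_subset[OF chart_at(1)[OF qM]] by auto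
        then have "B (back ?c x) \<noteq> 0" using B_pos by force
        then show ?thesis
          by (simp add: local_rep_eq F_def scaleR_sum_left[symmetric] sum_distrib_right[symmetric] B_def[symmetric])
      qed
      then have "pd i (local_rep ?c (\<lambda>q. \<Sum>p\<in>P. F p q)) (snd ?c q) = pd i (local_rep ?c f) (snd ?c q)" for i
        using chart_at(2)[OF qM] by (intro pd_cong[OF chart(2)[OF chart_at(1)[OF qM]]]) auto
      then show ?thesis by (simp add: global_div_def surface_div_def)
    qed
    finally show ?thesis .
  qed
  ultimately show ?thesis by (simp cong: has_bochner_integral_cong)
qed

end


section \<open>Conformal invariance of the energy\<close>

context closed_immersed
begin

lemma continuous_on_immersion: "continuous_on M \<Phi>"
proof -
  have "continuous (at q within M) \<Phi>" if q: "q \<in> M" for q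
  proof -
    note c = chart_at[OF q]
    obtain T where T: "open T" "coord_dom (chart_at q) = M \<inter> T" using chart(1)[OF c(1)] by (auto simp: openin_open)
    have "continuous_on (coord_dom (chart_at q)) (\<lambda>p. rep (chart_at q) (snd (chart_at q) p))"
      by (rule continuous_on_compose2[OF C_on_continuous[OF patch.C_X[OF patch_rep[OF c(1)]]]
            continuous_chart[OF c(1)] order_refl])
    then have "continuous_on (coord_dom (chart_at q)) \<Phi>"
      by (rule continuous_on_eq) (simp add: local_rep_eq c)
    then have "continuous_on (M \<inter> T) \<Phi>" by (simp only: T(2))
    then have "continuous (at q within M \<inter> T) \<Phi>" using c T by (auto simp: continuous_on_eq_continuous_within)
    moreover have "at q within M \<inter> T = at q within M"
      using c T by (intro at_within_nhd[of q T]) auto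
    ultimately show ?thesis by simp
  qed
  then show ?thesis by (simp add: continuous_on_eq_continuous_within)
qed

text \<open>If the metric is multiplied by \<open>k\<^sup>2\<close>, the volume element in dimension four is multiplied by \<open>k\<^sup>4\<close>: the measure with
  density \<open>k\<^sup>4\<close> satisfies the description that characterizes the volume measure of the new immersion.\<close>

lemma energy_conformal:
  assumes imm: "smooth_immersion \<A> \<Phi>'" and k: "continuous_on M k" "\<And>q. q \<in> M \<Longrightarrow> 0 < k q"
    and metric: "\<And>c x. c \<in> \<A> \<Longrightarrow> x \<in> coord_img c \<Longrightarrow>
      metric (local_rep c \<Phi>') x = (k (back c x))\<^sup>2 *\<^sub>R metric (rep c) x"
  shows "energy M \<A> \<Phi>' = (\<integral>q. (k q)^4 * energy_density \<A> \<Phi>' q \<partial>vol)"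
proof -
  interpret N: closed_immersed M \<A> \<Phi>' using closed_manifold imm by unfold_locales
  have kM: "k \<in> borel_measurable borelM" by (rule borel_measurable_continuous_on_restrict[OF k(1)])
  have mk: "(\<lambda>q. (k q)^4) \<in> borel_measurable vol"
    using kM by (simp add: measurable_cong_sets[OF sets_vol refl])
  have "N.volume_spec (density vol (\<lambda>q. ennreal ((k q)^4)))"
    unfolding N.volume_spec_def
  proof (intro conjI ballI impI)
    show "sets (density vol (\<lambda>q. ennreal ((k q)^4))) = sets borelM" by (simp add: sets_vol)
    fix c B assume c: "c \<in> \<A>" and B: "B \<in> sets borelM" "B \<subseteq> coord_dom c"
    have mh: "(\<lambda>q. ennreal ((k q)^4) * indicator B q) \<in> borel_measurable borelM"
      using kM B(1) by simp
    have mh': "(\<lambda>q. ennreal ((k q)^4) * indicator B q) \<in> borel_measurable vol"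
      using mh by (simp add: measurable_cong_sets[OF sets_vol refl])
    have "emeasure (density vol (\<lambda>q. ennreal ((k q)^4))) B = (\<integral>\<^sup>+q. ennreal ((k q)^4) * indicator B q \<partial>vol)"
      using mk B(1) by (intro emeasure_density) (simp_all add: sets_vol)
    also have "\<dots> = (\<integral>\<^sup>+q. indicator (coord_dom c) q * (ennreal ((k q)^4) * indicator B q) \<partial>vol)"
      using B(2) by (intro nn_integral_cong) (auto simp: indicator_def)
    also have "\<dots> = (\<integral>\<^sup>+q. ennreal ((k q)^4) * indicator B q \<partial>chart_measure c)"
      unfolding chart_measure_density[OF c] using dom_borel[OF c] mh'
      by (subst nn_integral_density) (auto simp: sets_vol intro!: borel_measurable_indicator)
    also have "\<dots> = (\<integral>\<^sup>+x\<in>coord_img c. ennreal (vol_density c x) * (ennreal ((k (back c x))^4) * indicator B (back c x)) \<partial>lborel)"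
      by (rule nn_integral_chart_measure[OF c mh])
    also have "\<dots> = (\<integral>\<^sup>+x\<in>snd c ` B. ennreal (N.vol_density c x) \<partial>lborel)"
    proof (rule nn_integral_cong)
      fix x
      have sB: "snd c ` B = back c -` B \<inter> coord_img c"
        using chart_image_eq[OF c, of B] B(2) by (simp add: Int_absorb2)
      show "ennreal (vol_density c x) * (ennreal ((k (back c x))^4) * indicator B (back c x)) * indicator (coord_img c) x
          = ennreal (N.vol_density c x) * indicator (snd c ` B) x"
      proof (cases "x \<in> coord_img c")
        case True
        have "N.vol_density c x = sqrt (((k (back c x))^4)\<^sup>2 * det (metric (rep c) x))"
          by (simp add: metric[OF c True] det_scaleR power_mult[symmetric])
        also have "\<dots> = (k (back c x))^4 * vol_density c x"
          unfolding real_sqrt_mult real_sqrt_abs by simp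
        finally have "N.vol_density c x = (k (back c x))^4 * vol_density c x" .
        then show ?thesis using True vol_density_pos[OF c True] unfolding sB
          by (simp add: ennreal_mult'' indicator_def mult.commute)
      qed (auto simp: sB indicator_def)
    qed
    finally show "emeasure (density vol (\<lambda>q. ennreal ((k q)^4))) B = (\<integral>\<^sup>+x\<in>snd c ` B. ennreal (N.vol_density c x) \<partial>lborel)" .
  qed
  from N.volume_measure_eqI[OF this]
  have "energy M \<A> \<Phi>' = (\<integral>q. energy_density \<A> \<Phi>' q \<partial>density vol (\<lambda>q. ennreal ((k q)^4)))"
    by (simp add: energy_def)
  also have "\<dots> = (\<integral>q. (k q)^4 * energy_density \<A> \<Phi>' q \<partial>vol)"
    by (rule integral_density_positive[OF mk]) (simp only: space_vol zero_less_power[OF k(2)])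
  finally show ?thesis .
qed

lemma energy_density_eq: "energy_density \<A> \<Phi>' q = local_density (local_rep (chart_at q) \<Phi>') (snd (chart_at q) q)"
  by (simp add: energy_density_def chart_at_def Let_def)

text \<open>The local representatives of the two maps may differ outside the coordinate images, which are open, so
  that no derivative at an interior point sees the difference.\<close>

lemma energy_cong:
  assumes eq: "\<And>q. q \<in> M \<Longrightarrow> \<Phi>' q = \<Phi> q"
  shows "energy M \<A> \<Phi>' = energy M \<A> \<Phi>"
proof -
  have rep': "local_rep c \<Phi>' x = rep c x" if "c \<in> \<A>" "x \<in> coord_img c" for c x
    using eq back_in[OF that] dom_subset[OF that(1)] by (auto simp: local_rep_eq)
  have pd': "pd i (local_rep c \<Phi>') x = pd i (rep c) x" if "c \<in> \<A>" "x \<in> coord_img c" for c x i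
    by (rule pd_cong[OF chart(2)[OF that(1)] that(2) rep'[OF that(1)]])
  have patch': "patch (coord_img c) (local_rep c \<Phi>')" if c: "c \<in> \<A>" for c
  proof
    interpret P: patch "coord_img c" "rep c" by (rule patch_rep[OF c])
    show "open (coord_img c)" by (rule P.open_S)
    have C: "C_on k (coord_img c) (local_rep c \<Phi>')" for k
      by (rule C_on_cong[OF P.open_S P.C_X]) (simp add: rep'[OF c])
    then show "smooth_on (coord_img c) (local_rep c \<Phi>')" by (rule smooth_onI)
    fix x assume x: "x \<in> coord_img c"
    have "frechet_derivative (local_rep c \<Phi>') (at x) = frechet_derivative (rep c) (at x)"
      using frechet_derivative_pd[OF P.diff_X[OF x]] frechet_derivative_pd[OF P.C_on_diffble[OF C x]] pd'[OF c x]
      by (simp add: fun_eq_iff)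
    then show "inj (frechet_derivative (local_rep c \<Phi>') (at x))" using P.immersed[OF x] by simp
  qed
  have imm: "smooth_immersion \<A> \<Phi>'"
    unfolding smooth_immersion_def using patch' by (auto simp: patch_def)
  have "energy M \<A> \<Phi>' = (\<integral>q. 1^4 * energy_density \<A> \<Phi>' q \<partial>vol)"
    by (rule energy_conformal[OF imm continuous_on_const]) (simp_all add: metric_def pd')
  also have "\<dots> = (\<integral>q. energy_density \<A> \<Phi> q \<partial>vol)"
  proof (rule Bochner_Integration.integral_cong[OF refl])
    fix q assume "q \<in> space vol"
    then have q: "q \<in> M" by (simp add: space_vol)
    note c = chart_at[OF q]
    let ?c = "chart_at q"
    interpret R: reparametrization "coord_img ?c" "local_rep ?c \<Phi>'" "coord_img ?c" "rep ?c" "\<lambda>x. x"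
      by (intro reparametrization.intro reparametrization_axioms.intro patch' patch_rep c)
        (auto intro!: smooth_onI C_on_ident chart(2) c rep')
    show "1^4 * energy_density \<A> \<Phi>' q = energy_density \<A> \<Phi> q"
      unfolding energy_density_eq using R.local_density_pullback[of "snd ?c q"] c by simp
  qed
  finally show ?thesis by (simp add: energy_def)
qed

lemma similarity_invariance:
  fixes U :: "real^'m \<Rightarrow> real^'m"
  assumes r: "0 < r" and U: "orthogonal_transformation U"
  shows "smooth_immersion \<A> (\<lambda>q. r *\<^sub>R U (\<Phi> q) + a)"
    "energy M \<A> (\<lambda>q. r *\<^sub>R U (\<Phi> q) + a) = energy M \<A> \<Phi>"
proof -
  let ?\<Phi>' = "\<lambda>q. r *\<^sub>R U (\<Phi> q) + a"
  have rep': "local_rep c ?\<Phi>' = (\<lambda>x. r *\<^sub>R U (rep c x) + a)" for c by (simp add: fun_eq_iff local_rep_eq)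
  have sim: "similarity_patch (coord_img c) (rep c) r U" if "c \<in> \<A>" for c
    using patch_rep[OF that] r U by (simp add: similarity_patch_def similarity_patch_axioms_def)
  show imm: "smooth_immersion \<A> ?\<Phi>'"
    unfolding smooth_immersion_def rep'
    using similarity_patch.patch_Xs[OF sim] by (auto simp: patch_def)
  have "energy M \<A> ?\<Phi>' = (\<integral>q. r^4 * energy_density \<A> ?\<Phi>' q \<partial>vol)"
    by (rule energy_conformal[OF imm continuous_on_const]) (simp_all add: r rep' similarity_patch.metric_Xs[OF sim])
  also have "\<dots> = (\<integral>q. energy_density \<A> \<Phi> q \<partial>vol)"
  proof (rule Bochner_Integration.integral_cong[OF refl])
    fix q assume "q \<in> space vol"
    then have "q \<in> M" by (simp add: space_vol)
    note c = chart_at[OF this]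
    show "r^4 * energy_density \<A> ?\<Phi>' q = energy_density \<A> \<Phi> q"
      unfolding energy_density_eq rep' using similarity_patch.local_density_similarity[OF sim[OF c(1)]] c(2) by simp
  qed
  finally show "energy M \<A> ?\<Phi>' = energy M \<A> \<Phi>" by (simp add: energy_def)
qed

text \<open>The two energy densities, compared with respect to the same measure, differ by the divergence of a
  global tangent field of class \<open>C\<^sup>1\<close>, whose integral vanishes.\<close>

lemma inversion_invariance:
  assumes nonzero: "\<And>q. q \<in> M \<Longrightarrow> \<Phi> q \<noteq> 0"
  shows "smooth_immersion \<A> (\<lambda>q. inversion (\<Phi> q))"
    "energy M \<A> (\<lambda>q. inversion (\<Phi> q)) = energy M \<A> \<Phi>"
proof -
  let ?\<Phi>' = "\<lambda>q. inversion (\<Phi> q)"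
  define k where "k q = inverse (\<Phi> q \<bullet> \<Phi> q)" for q
  have rep': "local_rep c ?\<Phi>' = (\<lambda>x. inversion (rep c x))" for c by (simp add: fun_eq_iff local_rep_eq)
  have pun: "punctured_patch (coord_img c) (rep c)" if "c \<in> \<A>" for c
    using patch_rep[OF that] nonzero back_in[OF that] dom_subset[OF that]
    by (auto simp: punctured_patch_def punctured_patch_axioms_def local_rep_eq)
  show imm: "smooth_immersion \<A> ?\<Phi>'"
    unfolding smooth_immersion_def rep'
    using punctured_patch.patch_Xt[OF pun] by (auto simp: patch_def)
  have k: "continuous_on M k" "\<And>q. q \<in> M \<Longrightarrow> 0 < k q"
    unfolding k_def[abs_def] using continuous_on_immersion nonzero by (auto intro!: continuous_intros)
  have kr: "k (back c x) = punctured_patch.r (rep c) x" if "c \<in> \<A>" for c x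
    by (simp add: k_def punctured_patch.r_def[OF pun[OF that]] local_rep_eq)
  have "energy M \<A> ?\<Phi>' = (\<integral>q. (k q)^4 * energy_density \<A> ?\<Phi>' q \<partial>vol)"
    by (rule energy_conformal[OF imm k])
      (simp_all add: rep' vec_eq_iff kr punctured_patch.metric_Xt[OF pun])
  also have "\<dots> = (\<integral>q. energy_density \<A> \<Phi> q \<partial>vol)"
  proof -
    define V where "V q = defect_field (rep (chart_at q)) (snd (chart_at q) q)" for q
    have V: "local_rep c V x = defect_field (rep c) x" if c: "c \<in> \<A>" and x: "x \<in> coord_img c" for c x
    proof -
      let ?q = "back c x" let ?d = "chart_at (back c x)"
      have q: "?q \<in> coord_dom c" by (rule back_in[OF c x])
      then have "?q \<in> M" using dom_subset[OF c] by auto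
      note d = chart_at[OF this]
      interpret R: reparametrization "snd ?d ` (coord_dom ?d \<inter> coord_dom c)" "rep ?d" "coord_img c" "rep c" "\<lambda>x. snd c (back ?d x)"
        by (rule reparametrization_transition[OF d(1) c])
      show ?thesis using R.defect_field_pullback[of "snd ?d ?q"] q d c x by (simp add: local_rep_eq V_def)
    qed
    have C1: "C1_field V" unfolding C1_field_def
      using V C_on_cong[OF chart(2) punctured_patch.C_defect_field[OF pun]] by (metis (no_types, lifting))
    have "tangent_field V" unfolding tangent_field_def
    proof (intro ballI)
      fix c x assume c: "c \<in> \<A>" and x: "x \<in> coord_img c"
      show "normal_proj (rep c) x (local_rep c V x) = 0"
        unfolding V[OF c x] by (rule punctured_patch.defect_field_tangent[OF pun[OF c] x])
    qed
    with C1 have int: "integrable vol (global_div V)" "integral\<^sup>L vol (global_div V) = 0"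
      using divergence_theorem[of V] by (auto simp: has_bochner_integral_iff)
    have dens: "(k q)^4 * energy_density \<A> ?\<Phi>' q = energy_density \<A> \<Phi> q + global_div V q" if q: "q \<in> M" for q
    proof -
      note c = chart_at[OF q]
      let ?c = "chart_at q" let ?x = "snd ?c q"
      have x: "?x \<in> coord_img ?c" using c by auto
      have "pd i (local_rep ?c V) ?x = pd i (defect_field (rep ?c)) ?x" for i
        by (rule pd_cong[OF chart(2)[OF c(1)] x V[OF c(1)]])
      then have "global_div V q = surface_div (rep ?c) (defect_field (rep ?c)) ?x"
        using q by (simp add: global_div_def surface_div_def)
      then show ?thesis
        using punctured_patch.local_density_inversion[OF pun[OF c(1)] x] kr[OF c(1), of ?x] c
        by (simp add: energy_density_eq rep')
    qed
    have "(\<integral>q. (k q)^4 * energy_density \<A> ?\<Phi>' q \<partial>vol) = (\<integral>q. energy_density \<A> \<Phi> q + global_div V q \<partial>vol)"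
      by (rule Bochner_Integration.integral_cong) (simp_all add: dens space_vol)
    also have "\<dots> = (\<integral>q. energy_density \<A> \<Phi> q \<partial>vol)"
    \<comment> \<open>Adding the integrable divergence preserves integrability and non-integrability; in the latter case both integrals are zero.\<close>
    proof (cases "integrable vol (energy_density \<A> \<Phi>)")
      case True
      then show ?thesis using int by simp
    next
      case False
      have "\<not> integrable vol (\<lambda>q. energy_density \<A> \<Phi> q + global_div V q)"
      proof
        assume "integrable vol (\<lambda>q. energy_density \<A> \<Phi> q + global_div V q)"
        from Bochner_Integration.integrable_diff[OF this int(1)] show False using False by simp
      qed
      then show ?thesis using False by (simp add: not_integrable_integral_eq)
    qed
    finally show ?thesis .
  qed
  finally show "energy M \<A> ?\<Phi>' = energy M \<A> \<Phi>" by (simp add: energy_def)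
qed

end

text \<open>The denominator is \<open>|c|\<^sup>2 |x - p|\<^sup>2\<close>, where \<open>p\<close> is the point sent to infinity. So the special conformal
  transformation is the inversion centred at \<open>p\<close>, followed by the reflection \<open>reflect c\<close>, a dilation and a
  translation.\<close>

lemma special_conformal_eq:
  fixes c x :: "real^'m::finite"
  assumes c: "c \<noteq> 0" and nz: "sct_denom c x \<noteq> 0"
  defines "p \<equiv> - inverse (c \<bullet> c) *\<^sub>R c"
  shows "x - p \<noteq> 0"
    "special_conformal c x = inverse (c \<bullet> c) *\<^sub>R reflect c (inversion (x - p)) + inverse (c \<bullet> c) *\<^sub>R c"
proof -
  define y where "y = x - p"
  have cc: "c \<bullet> c \<noteq> 0" using c by simp
  have x: "x = y - inverse (c \<bullet> c) *\<^sub>R c" by (simp add: y_def p_def)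
  have den: "sct_denom c x = (c \<bullet> c) * (y \<bullet> y)"
    unfolding sct_denom_def power2_norm_eq_inner x using cc
    by (simp add: inner_diff_left inner_diff_right inner_commute field_simps)
  then show "x - p \<noteq> 0" using nz by (auto simp: y_def)
  then have yy: "y \<bullet> y \<noteq> 0" by (simp add: y_def)
  have nx: "x \<bullet> x = y \<bullet> y - 2 * (c \<bullet> y) * inverse (c \<bullet> c) + inverse (c \<bullet> c)"
    unfolding x using cc by (simp add: inner_diff_left inner_diff_right inner_commute field_simps)
  have "x + (x \<bullet> x) *\<^sub>R c = reflect c y + (y \<bullet> y) *\<^sub>R c"
    unfolding nx unfolding x reflect_def by (simp add: algebra_simps)
  then have "special_conformal c x = inverse ((c \<bullet> c) * (y \<bullet> y)) *\<^sub>R (reflect c y + (y \<bullet> y) *\<^sub>R c)"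
    unfolding special_conformal_def den power2_norm_eq_inner by (simp add: divide_inverse)
  also have "\<dots> = inverse (c \<bullet> c) *\<^sub>R reflect c (inversion y) + inverse (c \<bullet> c) *\<^sub>R c"
    using cc yy by (simp add: inversion_def reflect_scaleR scaleR_add_right)
  finally show "special_conformal c x = inverse (c \<bullet> c) *\<^sub>R reflect c (inversion (x - p)) + inverse (c \<bullet> c) *\<^sub>R c"
    by (simp add: y_def)
qed

theorem theorem2p5p1:
  fixes \<Sigma> :: "'a::t2_space set" and \<A> :: "('a, 4) chart set" and \<Phi> :: "'a \<Rightarrow> real^'m::finite"
  assumes "closed_manifold \<Sigma> \<A>" and "smooth_immersion \<A> \<Phi>"
  shows "(\<forall>a. energy \<Sigma> \<A> (\<lambda>q. \<Phi> q + a) = energy \<Sigma> \<A> \<Phi>) \<and>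
    (\<forall>R. rotation_matrix R \<longrightarrow> energy \<Sigma> \<A> (\<lambda>q. R *v \<Phi> q) = energy \<Sigma> \<A> \<Phi>) \<and>
    (\<forall>r>0. energy \<Sigma> \<A> (\<lambda>q. r *\<^sub>R \<Phi> q) = energy \<Sigma> \<A> \<Phi>) \<and>
    (\<forall>c. (\<forall>q\<in>\<Sigma>. sct_denom c (\<Phi> q) \<noteq> 0) \<longrightarrow>
       energy \<Sigma> \<A> (\<lambda>q. special_conformal c (\<Phi> q)) = energy \<Sigma> \<A> \<Phi>)"
proof (intro conjI allI impI)
  interpret closed_immersed \<Sigma> \<A> \<Phi> using assms by unfold_locales
  have id: "orthogonal_transformation (\<lambda>v. v :: real^'m)" by (simp add: orthogonal_transformation_def linear_id[unfolded id_def])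
  show "energy \<Sigma> \<A> (\<lambda>q. \<Phi> q + a) = energy \<Sigma> \<A> \<Phi>" for a
    using similarity_invariance(2)[OF zero_less_one id, of a] by simp
  show "energy \<Sigma> \<A> (\<lambda>q. R *v \<Phi> q) = energy \<Sigma> \<A> \<Phi>" if "rotation_matrix R" for R
  proof -
    have "orthogonal_transformation (\<lambda>v. R *v v)"
      using that by (simp add: rotation_matrix_def orthogonal_transformation_matrix)
    then show ?thesis using similarity_invariance(2)[of 1 "\<lambda>v. R *v v" 0] by simp
  qed
  show "energy \<Sigma> \<A> (\<lambda>q. r *\<^sub>R \<Phi> q) = energy \<Sigma> \<A> \<Phi>" if "0 < r" for r
    using similarity_invariance(2)[OF that id, of 0] by simp
  fix c assume nz: "\<forall>q\<in>\<Sigma>. sct_denom c (\<Phi> q) \<noteq> 0"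
  show "energy \<Sigma> \<A> (\<lambda>q. special_conformal c (\<Phi> q)) = energy \<Sigma> \<A> \<Phi>"
  proof (cases "c = 0")
    case True
    then show ?thesis by (simp add: special_conformal_def sct_denom_def)
  next
    case False
    define p where "p = - inverse (c \<bullet> c) *\<^sub>R c"
    let ?k = "inverse (c \<bullet> c)"
    \<comment> \<open>The three steps of \<open>special_conformal_eq\<close> on the level of immersions: a translation, an inversion, a similarity.\<close>
    note eq = special_conformal_eq[OF False nz[rule_format], folded p_def]
    have refl: "orthogonal_transformation (reflect c)"
      using linear_reflect reflect_inner[OF False] by (simp add: orthogonal_transformation_def)
    have imm1: "smooth_immersion \<A> (\<lambda>q. \<Phi> q - p)" and en1: "energy \<Sigma> \<A> (\<lambda>q. \<Phi> q - p) = energy \<Sigma> \<A> \<Phi>"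
      using similarity_invariance[OF zero_less_one id, of "- p"] by simp_all
    interpret P1: closed_immersed \<Sigma> \<A> "\<lambda>q. \<Phi> q - p" using closed_manifold imm1 by unfold_locales
    have imm2: "smooth_immersion \<A> (\<lambda>q. inversion (\<Phi> q - p))"
      and en2: "energy \<Sigma> \<A> (\<lambda>q. inversion (\<Phi> q - p)) = energy \<Sigma> \<A> (\<lambda>q. \<Phi> q - p)"
      using P1.inversion_invariance eq(1) by blast+
    interpret P2: closed_immersed \<Sigma> \<A> "\<lambda>q. inversion (\<Phi> q - p)" using closed_manifold imm2 by unfold_locales
    have k: "0 < ?k" using False by simp
    note s = P2.similarity_invariance[OF k refl, of "?k *\<^sub>R c"]
    interpret P3: closed_immersed \<Sigma> \<A> "\<lambda>q. ?k *\<^sub>R reflect c (inversion (\<Phi> q - p)) + ?k *\<^sub>R c"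
      using closed_manifold s(1) by unfold_locales
    show ?thesis using P3.energy_cong[OF eq(2)] s(2) en2 en1 by simp
  qed
qed

end
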